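(* Suppose $(\bar\rho,\bar v)\in\mathscr T_2$, so that $\bar\psi=\bar v+\Phi*\bar\rho\in L^2(\mathbb R,\bar\rho)$. Define $\bar M(x)=\bar\rho((-\infty,x])$, let $\bar X$ be the right-continuous monotone rearrangement of $\bar\rho$, $\bar V=\bar v\circ\bar X$, $\bar\Psi=\bar\psi\circ\bar X$, and define the flux function $A(m)=\int_0^m\bar\Psi(\omega)\,d\omega$, $m\in[0,1]$. Let $X_t$ be the Lagrangian solution with data $(\bar X,\bar V)$, $\rho_t=X_{t\#}\mathfrak m$, and let $M_t$ be the generalized inverse of $X_t$, i.e. $M_t(x)=\rho_t((-\infty,x])$. Then $M_t$ is an entropy solution of the scalar balance law $$\partial_tM_t+\partial_xA(M_t)=(\Phi*\rho_t)\,\partial_xM_t$$ with initial value $\bar M$.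
   Context: The communication protocol $\phi$ on $\mathbb R$ is nonnegative, symmetric, radially nonincreasing and locally integrable; $\Phi(x)=\int_0^x\phi(y)dy$. $\mathscr T_2=\{(\rho,v):\rho\in\mathscr P_2(\mathbb R),v\in L^2(\mathbb R,\rho)\}$, where $\mathscr P_2(\mathbb R)$ is the set of probability measures with finite second moment. $\Omega=(0,1)$, $\mathfrak m$ is Lebesgue measure on $\Omega$. The right-continuous monotone rearrangement of $\rho$ is $X_\rho(m)=\inf\{x:\rho((-\infty,x])>m\}$, $m\in\Omega$. $\mathcal K\subset L^2(\Omega)$: closed convex cone of nondecreasing right-continuous functions; for $X\in\mathcal K$, $\partial I_{\mathcal K}(X)=\{W\in L^2(\Omega):\langle W,Y-X\rangle\le0\ \forall Y\in\mathcal K\}$. The Lagrangian solution with data $(\bar X,\bar V)$ is the unique absolutely continuous curve $X_t:[0,\infty)\to\mathcal K$ with $X_0=\bar X$ and $\bar\Psi-\int_\Omega\Phi(X_t-X_t(\omega))d\omega-\dot X_t\in\partial I_{\mathcal K}(X_t)$ for a.e. $t>0$, where $\bar\Psi=\bar V+\int_\Omega\Phi(\bar X-\bar X(\omega))d\omega$ (which equals $\bar\psi\circ\bar X$ here). Entropy-entropy flux pair: $(\eta,q)$ with $\eta:[0,1]\to\mathbb R$ Lipschitz and convex, and $q:[0,1]\to\mathbb R$ with $q'=\eta'A'$. A function $M_t:[0,T]\times\mathbb R\to[0,1]$ (with $\rho_t=\partial_xM_t$) is an entropy solution of the balance law if it is nondecreasing (in $x$) and satisfies, for every entropy-entropy flux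 pair, $$\partial_t\eta(M_t)+\partial_xq(M_t)\le(\Phi*\rho_t)\,\partial_x\eta(M_t)$$ in the weak sense, i.e. for all $0\le\varphi\in C_c^\infty((0,T)\times\mathbb R)$, $$\int_0^T\!\left(\int_{\mathbb R}\left[\eta(M_t)\partial_t\varphi+q(M_t)\partial_x\varphi\right]dx+\int_{\mathbb R}\varphi\,(\Phi*\rho_t)\,d(\partial_x\eta(M_t))\right)dt\ge0,$$ where $\partial_x\eta(M_t)$ is the distributional derivative (a finite measure). Here $T>0$ is arbitrary, and "initial value $\bar M$" means $M_0=\bar M$. *)

theory Defs
  imports "HOL-Probability.Probability"
begin

section \<open>Communication protocol\<close>

text \<open>Monotonicity is imposed away from the origin only: a locally integrable protocol may be
  singular at the origin (e.g. a negative power of the distance), in which case the real value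
  assigned to the protocol at \<open>0\<close> is immaterial.\<close>

definition protocol :: "(real \<Rightarrow> real) \<Rightarrow> bool" where
  "protocol \<phi> \<longleftrightarrow>
     (\<forall>x. 0 \<le> \<phi> x) \<and>
     (\<forall>x. \<phi> (- x) = \<phi> x) \<and>
     (\<forall>x y. 0 < \<bar>x\<bar> \<and> \<bar>x\<bar> \<le> \<bar>y\<bar> \<longrightarrow> \<phi> y \<le> \<phi> x) \<and>
     (\<forall>a b. set_integrable lborel {a..b} \<phi>)"

definition primitive :: "(real \<Rightarrow> real) \<Rightarrow> real \<Rightarrow> real" where
  "primitive \<phi> x = (LBINT y=ereal 0..ereal x. \<phi> y)"

definition conv :: "(real \<Rightarrow> real) \<Rightarrow> real measure \<Rightarrow> real \<Rightarrow> real" where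
  "conv f \<rho> x = (LINT y|\<rho>. f (x - y))"


section \<open>Square-integrable functions and the phase space\<close>

definition L2 :: "'a measure \<Rightarrow> ('a \<Rightarrow> real) set" where
  "L2 M = {f \<in> borel_measurable M. integrable M (\<lambda>x. (f x)\<^sup>2)}"

definition L2_inner :: "'a measure \<Rightarrow> ('a \<Rightarrow> real) \<Rightarrow> ('a \<Rightarrow> real) \<Rightarrow> real" where
  "L2_inner M f g = (LINT x|M. f x * g x)"

definition L2_dist :: "'a measure \<Rightarrow> ('a \<Rightarrow> real) \<Rightarrow> ('a \<Rightarrow> real) \<Rightarrow> real" where
  "L2_dist M f g = sqrt (LINT x|M. (f x - g x)\<^sup>2)"

definition P2 :: "real measure set" where
  "P2 = {\<rho>. prob_space \<rho> \<and> sets \<rho> = sets borel \<and> integrable \<rho> (\<lambda>x. x\<^sup>2)}"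

definition T2 :: "(real measure \<times> (real \<Rightarrow> real)) set" where
  "T2 = {(\<rho>, v). \<rho> \<in> P2 \<and> v \<in> L2 \<rho>}"


section \<open>Lagrangian solutions\<close>

definition Omega :: "real set" where
  "Omega = {0<..<1}"

definition leb_Omega :: "real measure" where
  "leb_Omega = restrict_space lborel Omega"

definition rearrangement :: "real measure \<Rightarrow> real \<Rightarrow> real" where
  "rearrangement \<rho> m = Inf {x. measure \<rho> {..x} > m}"

text \<open>Elements of the cone are represented by their right-continuous representatives; the values
  of such a function outside \<open>Omega\<close> are irrelevant throughout.\<close>

definition cone_K :: "(real \<Rightarrow> real) set" where
  "cone_K = {X \<in> L2 leb_Omega. mono_on Omega X \<and> (\<forall>m\<in>Omega. continuous (at_right m) X)}"

definition subdiff_K :: "(real \<Rightarrow> real) \<Rightarrow> (real \<Rightarrow> real) set" where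
  "subdiff_K X = {W \<in> L2 leb_Omega. \<forall>Y\<in>cone_K. L2_inner leb_Omega W (\<lambda>m. Y m - X m) \<le> 0}"

text \<open>Absolutely continuous curves \<open>[a, b] \<rightarrow> (E, d)\<close> in a (pseudo)metric space, in the sense of
  Ambrosio, Gigli and Savare: increments are dominated by integrals of an \<open>L\<^sup>1\<close> function.\<close>

definition abs_continuous_curve ::
  "('e \<Rightarrow> 'e \<Rightarrow> real) \<Rightarrow> real \<Rightarrow> real \<Rightarrow> (real \<Rightarrow> 'e) \<Rightarrow> bool" where
  "abs_continuous_curve d a b c \<longleftrightarrow>
     (\<exists>g. set_integrable lborel {a..b} g \<and>
          (\<forall>s t. a \<le> s \<and> s \<le> t \<and> t \<le> b \<longrightarrow> d (c s) (c t) \<le> (LINT r:{s..t}|lborel. g r)))"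

definition has_L2_derivative ::
  "(real \<Rightarrow> real \<Rightarrow> real) \<Rightarrow> (real \<Rightarrow> real) \<Rightarrow> real \<Rightarrow> bool" where
  "has_L2_derivative X D t \<longleftrightarrow>
     D \<in> L2 leb_Omega \<and>
     ((\<lambda>s. L2_dist leb_Omega (\<lambda>m. (X s m - X t m) / (s - t)) D) \<longlongrightarrow> 0) (at t)"

definition mean_Phi :: "(real \<Rightarrow> real) \<Rightarrow> (real \<Rightarrow> real) \<Rightarrow> real \<Rightarrow> real" where
  "mean_Phi \<Phi> Y m = (LINT \<omega>|leb_Omega. \<Phi> (Y m - Y \<omega>))"

definition lagrangian_solution ::
  "(real \<Rightarrow> real) \<Rightarrow> (real \<Rightarrow> real) \<Rightarrow> (real \<Rightarrow> real) \<Rightarrow> (real \<Rightarrow> real \<Rightarrow> real) \<Rightarrow> bool" where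
  "lagrangian_solution \<Phi> X0 V0 X \<longleftrightarrow>
     (\<forall>t\<ge>0. X t \<in> cone_K) \<and>
     (\<forall>b>0. abs_continuous_curve (L2_dist leb_Omega) 0 b X) \<and>
     (\<forall>m\<in>Omega. X 0 m = X0 m) \<and>
     (AE t in lborel. t > 0 \<longrightarrow>
        (\<exists>D. has_L2_derivative X D t \<and>
             (\<lambda>m. (V0 m + mean_Phi \<Phi> X0 m) - mean_Phi \<Phi> (X t) m - D m) \<in> subdiff_K (X t)))"


section \<open>Smooth test functions and distributional derivatives\<close>

definition dir_deriv :: "'a::euclidean_space \<Rightarrow> ('a \<Rightarrow> real) \<Rightarrow> 'a \<Rightarrow> real" where
  "dir_deriv b f x = frechet_derivative f (at x) b"

text \<open>All iterated partial derivatives exist and are differentiable (hence continuous).\<close>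

definition smooth :: "('a::euclidean_space \<Rightarrow> real) \<Rightarrow> bool" where
  "smooth f \<longleftrightarrow> (\<forall>bs. set bs \<subseteq> Basis \<longrightarrow> (\<forall>x. fold dir_deriv bs f differentiable (at x)))"

definition test_functions :: "'a::euclidean_space set \<Rightarrow> ('a \<Rightarrow> real) set" where
  "test_functions U =
     {f. smooth f \<and> compact (closure {x. f x \<noteq> 0}) \<and> closure {x. f x \<noteq> 0} \<subseteq> U}"

text \<open>The finite signed Borel measure \<open>\<mu> - \<nu>\<close>, given as a difference of two finite measures, is the
  distributional derivative of \<open>g\<close>. The pair \<open>(\<mu>, \<nu>)\<close> is not unique, but \<open>\<mu> - \<nu>\<close> is.\<close>

definition distr_derivative :: "(real \<Rightarrow> real) \<Rightarrow> real measure \<Rightarrow> real measure \<Rightarrow> bool" where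
  "distr_derivative g \<mu> \<nu> \<longleftrightarrow>
     finite_measure \<mu> \<and> sets \<mu> = sets borel \<and>
     finite_measure \<nu> \<and> sets \<nu> = sets borel \<and>
     (\<forall>a b. set_integrable lborel {a..b} g) \<and>
     (\<forall>\<psi>\<in>test_functions UNIV.
        (LINT x|\<mu>. \<psi> x) - (LINT x|\<nu>. \<psi> x) = - (LINT x|lborel. g x * deriv \<psi> x))"


section \<open>Entropy solutions of the balance law\<close>

text \<open>A Lipschitz \<open>\<eta>\<close> and a primitive \<open>A\<close> of an integrable function are differentiable only almost
  everywhere, so \<open>q' = \<eta>' A'\<close> is the almost-everywhere identity for absolutely continuous \<open>q\<close>.\<close>

definition entropy_pair :: "(real \<Rightarrow> real) \<Rightarrow> (real \<Rightarrow> real) \<Rightarrow> (real \<Rightarrow> real) \<Rightarrow> bool" where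
  "entropy_pair A \<eta> q \<longleftrightarrow>
     (\<exists>L. L-lipschitz_on {0..1} \<eta>) \<and> convex_on {0..1} \<eta> \<and>
     abs_continuous_curve dist 0 1 q \<and>
     (AE m in lborel. m \<in> {0<..<1} \<longrightarrow>
        (\<exists>\<eta>' A'. (\<eta> has_real_derivative \<eta>') (at m) \<and> (A has_real_derivative A') (at m) \<and>
                 (q has_real_derivative \<eta>' * A') (at m)))"

definition flux_integrand ::
  "(real \<Rightarrow> real) \<Rightarrow> (real \<Rightarrow> real) \<Rightarrow> (real \<Rightarrow> real \<Rightarrow> real) \<Rightarrow> (real \<times> real \<Rightarrow> real) \<Rightarrow>
   real \<Rightarrow> real \<Rightarrow> real" where
  "flux_integrand \<eta> q M f t x =
     \<eta> (M t x) * dir_deriv (1, 0) f (t, x) + q (M t x) * dir_deriv (0, 1) f (t, x)"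

definition source_integrand ::
  "(real \<Rightarrow> real) \<Rightarrow> (real \<Rightarrow> real measure) \<Rightarrow> (real \<times> real \<Rightarrow> real) \<Rightarrow> real \<Rightarrow> real \<Rightarrow> real" where
  "source_integrand \<Phi> \<rho> f t x = f (t, x) * conv \<Phi> (\<rho> t) x"

definition weak_integrand ::
  "(real \<Rightarrow> real) \<Rightarrow> (real \<Rightarrow> real) \<Rightarrow> (real \<Rightarrow> real) \<Rightarrow> (real \<Rightarrow> real \<Rightarrow> real) \<Rightarrow>
   (real \<Rightarrow> real measure) \<Rightarrow> (real \<Rightarrow> real measure) \<Rightarrow> (real \<Rightarrow> real measure) \<Rightarrow>
   (real \<times> real \<Rightarrow> real) \<Rightarrow> real \<Rightarrow> real" where
  "weak_integrand \<Phi> \<eta> q M \<rho> \<mu> \<nu> f t =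
     (LINT x|lborel. flux_integrand \<eta> q M f t x) +
     ((LINT x|\<mu> t. source_integrand \<Phi> \<rho> f t x) - (LINT x|\<nu> t. source_integrand \<Phi> \<rho> f t x))"

text \<open>Here \<open>\<mu> t - \<nu> t\<close> is the distributional derivative of \<open>\<eta> \<circ> M t\<close>. The integrability clauses
  guarantee that no integral in the entropy inequality takes its default value.\<close>

definition entropy_solution ::
  "(real \<Rightarrow> real) \<Rightarrow> (real \<Rightarrow> real) \<Rightarrow> real \<Rightarrow> (real \<Rightarrow> real \<Rightarrow> real) \<Rightarrow>
   (real \<Rightarrow> real measure) \<Rightarrow> bool" where
  "entropy_solution \<Phi> A T M \<rho> \<longleftrightarrow>
     (\<forall>t\<in>{0..T}. (\<forall>x. M t x \<in> {0..1}) \<and> mono (M t) \<and>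
        distr_derivative (M t) (\<rho> t) (null_measure borel) \<and>
        (\<forall>x. integrable (\<rho> t) (\<lambda>y. \<Phi> (x - y)))) \<and>
     (\<forall>\<eta> q. entropy_pair A \<eta> q \<longrightarrow>
        (\<exists>\<mu> \<nu>. (\<forall>t\<in>{0<..<T}. distr_derivative (\<lambda>x. \<eta> (M t x)) (\<mu> t) (\<nu> t)) \<and>
           (\<forall>f\<in>test_functions ({0<..<T} \<times> UNIV). (\<forall>z. 0 \<le> f z) \<longrightarrow>
              (\<forall>t\<in>{0<..<T}.
                 integrable lborel (flux_integrand \<eta> q M f t) \<and>
                 integrable (\<mu> t) (source_integrand \<Phi> \<rho> f t) \<and>
                 integrable (\<nu> t) (source_integrand \<Phi> \<rho> f t)) \<and>
              set_integrable lborel {0<..<T} (weak_integrand \<Phi> \<eta> q M \<rho> \<mu> \<nu> f) \<and>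
              0 \<le> (LINT t:{0<..<T}|lborel. weak_integrand \<Phi> \<eta> q M \<rho> \<mu> \<nu> f t))))"

end

theory Submission
  imports Defs
begin

text \<open>Everything is rewritten in the mass variable. Let \<open>h\<close> be the right derivative of the convex
  entropy \<open>\<eta>\<close>. Up to null sets \<open>m < M\<^sub>t x\<close> means \<open>X\<^sub>t m \<le> x\<close>, so
  \<open>\<eta> (M\<^sub>t x) = \<eta> 0 + \<integral> h m \<cdot> 1(X\<^sub>t m \<le> x) dm\<close>, and \<open>q\<close> has the same representation with
  density \<open>h \<Psi>\<close>. With \<open>F t x = - \<integral>\<^sub>x\<^sup>\<infinity> f (t, y) dy\<close>, Fubini turns the weak formulation at time
  \<open>t\<close> into
  \<open>- d/dt \<integral> h m \<cdot> F t (X\<^sub>t m) dm - \<integral> W\<^sub>t m \<cdot> h m \<cdot> f (t, X\<^sub>t m) dm\<close> (plus the derivative of a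
  function of \<open>t\<close> vanishing at both ends), where \<open>W\<^sub>t\<close> is the element of the subdifferential
  given by the evolution. The last integral is at most \<open>0\<close>: since \<open>h\<close> is nondecreasing,
  \<open>f \<ge> 0\<close>, and both are bounded with \<open>f\<close> Lipschitz, \<open>X\<^sub>t + \<epsilon> h f (t, X\<^sub>t)\<close> is nondecreasing for
  small \<open>\<epsilon> > 0\<close> and may be used as a competitor.\<close>

section \<open>Lebesgue differentiation on the line\<close>

text \<open>The obstacle is that all ingredients are differentiable only almost everywhere: the
  curve in time, and \<eta>, \<open>A\<close>, \<open>q\<close> in mass. Every passage from
  derivatives to increments therefore rests on two facts: an integral has its integrand as
  derivative at almost every point, and an absolutely continuous function whose derivative is
  nonnegative almost everywhere is monotone. In mass they turn q' = \<eta>' A' into an integral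
  formula for q; in time they turn the pointwise sign of the production into a sign of its integral.
  The choice of the right derivative matters: it is right continuous at every point, so the
  perturbed map again belongs to \<open>cone_K\<close>. The tail primitive \<open>F\<close> has
  derivative f in x. Transport with velocity D thus changes the integral of h F at rate h f D, the
  one term of the variational inequality that the weak formulation does not show. This nonlinear
  functional can be differentiated along a curve that has a derivative only in L2 because
  \<open>F\<close> is bounded and has a quadratic Taylor remainder.\<close>

lemma emeasure_density_integral:
  fixes f :: "'a \<Rightarrow> real"
  assumes "integrable M f" "\<And>x. 0 \<le> f x" "B \<in> sets M"
  shows "emeasure (density M (\<lambda>x. ennreal (f x))) B = ennreal (LINT x:B|M. f x)"
proof -
  have "emeasure (density M (\<lambda>x. ennreal (f x))) B = (\<integral>\<^sup>+x. ennreal (f x) * indicator B x \<partial>M)"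
    using assms by (intro emeasure_density) auto
  also have "\<dots> = (\<integral>\<^sup>+x. ennreal (indicator B x *\<^sub>R f x) \<partial>M)"
    by (intro nn_integral_cong) (auto simp: indicator_def)
  also have "\<dots> = ennreal (LINT x:B|M. f x)"
    unfolding set_lebesgue_integral_def
    using assms by (intro nn_integral_eq_integral integrable_mult_indicator) auto
  finally show ?thesis .
qed

text \<open>Vitali covering argument. At a point of \<open>S\<close> where the claim fails for
  \<open>e\<close>, arbitrarily small balls carry mass above \<open>e\<close> times their radius.
  Disjoint such balls inside an open set of small \<mu>-measure have small total length, since the
  length 2 r of a ball is at most 2 / e times its mass.\<close>

lemma AE_small_on_null:
  fixes \<mu> :: "real measure"
  assumes fin: "finite_measure \<mu>" and sets: "sets \<mu> = sets borel"
    and S: "S \<in> sets borel" "emeasure \<mu> S = 0"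
  shows "AE x in lborel. x \<in> S \<longrightarrow> (\<forall>e>0. \<exists>d>0. \<forall>r. 0 < r \<and> r < d \<longrightarrow> measure \<mu> (ball x r) \<le> e * r)"
proof -
  interpret finite_measure \<mu> by fact
  define E where "E e = {x\<in>S. \<forall>d>0. \<exists>r. 0 < r \<and> r < d \<and> e * r < measure \<mu> (ball x r)}" for e
  have neg: "negligible (E e)" if "e > 0" for e
    unfolding negligible_outer_le
  proof safe
    fix \<epsilon> :: real assume "\<epsilon> > 0"
    \<comment> \<open>The factor 2 / e from comparing length with mass turns this bound into exactly
      \<epsilon>.\<close>
    have "emeasure \<mu> S < ennreal (e * \<epsilon> / 2)"
      using S \<open>e>0\<close> \<open>\<epsilon>>0\<close> by simp
    then have "(INF U\<in>{U. S \<subseteq> U \<and> open U}. emeasure \<mu> U) < ennreal (e * \<epsilon> / 2)"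
      using outer_regular[OF sets _ S(1)] by simp
    then obtain U where U: "S \<subseteq> U" "open U" "emeasure \<mu> U < ennreal (e * \<epsilon> / 2)"
      by (auto simp: INF_less_iff)
    define K where "K = {(x, r). x \<in> E e \<and> r > 0 \<and> ball x r \<subseteq> U \<and> e * r < measure \<mu> (ball x r)}"
    have cov: "\<exists>i. i \<in> K \<and> x \<in> ball (fst i) (snd i) \<and> snd i < d"
      if xE: "x \<in> E e" and "d > 0" for x d
    proof -
      have "x \<in> U" using that U by (auto simp: E_def)
      then obtain d' where d': "d' > 0" "ball x d' \<subseteq> U"
        using U(2) open_contains_ball by blast
      have "min d d' > 0" using that d' by simp
      then obtain r where r: "0 < r" "r < min d d'" "e * r < measure \<mu> (ball x r)"
        using xE unfolding E_def by blast
      then have "(x, r) \<in> K"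
        using d' that by (auto simp: K_def)
      then show ?thesis using r by (intro exI[of _ "(x, r)"]) auto
    qed
    obtain C where C: "countable C" "C \<subseteq> K"
      "pairwise (\<lambda>i j. disjnt (ball (fst i) (snd i)) (ball (fst j) (snd j))) C"
      "negligible (E e - (\<Union>i\<in>C. ball (fst i) (snd i)))"
      by (rule Vitali_covering_theorem_balls[of "E e" K fst snd, OF cov]) auto
    let ?B = "\<lambda>i::real\<times>real. ball (fst i) (snd i)"
    have dis: "disjoint_family_on ?B C"
      using C(3) by (auto simp: disjoint_family_on_def pairwise_def disjnt_def)
    have "emeasure lborel (\<Union>i\<in>C. ?B i) = (\<integral>\<^sup>+i. emeasure lborel (?B i) \<partial>count_space C)"
      by (rule emeasure_UN_countable[OF _ C(1) dis]) auto
    also have "\<dots> \<le> (\<integral>\<^sup>+i. ennreal (2 / e) * emeasure \<mu> (?B i) \<partial>count_space C)"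
    proof (rule nn_integral_mono)
      fix i assume "i \<in> space (count_space C)"
      then have i: "snd i > 0" "e * snd i < measure \<mu> (?B i)"
        using C(2) by (auto simp: K_def)
      have "emeasure lborel (?B i) = ennreal (2 * snd i)"
        using i by (simp add: ball_eq_greaterThanLessThan)
      also have "\<dots> \<le> ennreal (2 / e * measure \<mu> (?B i))"
        using i \<open>e > 0\<close> by (intro ennreal_leI) (simp add: field_simps)
      also have "\<dots> = ennreal (2 / e) * emeasure \<mu> (?B i)"
        using \<open>e > 0\<close> unfolding emeasure_eq_measure by (intro ennreal_mult) auto
      finally show "emeasure lborel (?B i) \<le> ennreal (2 / e) * emeasure \<mu> (?B i)" .
    qed
    also have "\<dots> = ennreal (2 / e) * (\<integral>\<^sup>+i. emeasure \<mu> (?B i) \<partial>count_space C)"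
      by (rule nn_integral_cmult) auto
    also have "(\<integral>\<^sup>+i. emeasure \<mu> (?B i) \<partial>count_space C) = emeasure \<mu> (\<Union>i\<in>C. ?B i)"
      by (rule emeasure_UN_countable[symmetric, OF _ C(1) dis]) (auto simp: sets)
    also have "ennreal (2 / e) * \<dots> \<le> ennreal (2 / e) * emeasure \<mu> U"
    proof (intro mult_left_mono emeasure_mono)
      show "(\<Union>i\<in>C. ?B i) \<subseteq> U"
        using C(2) by (intro UN_least) (auto simp: K_def subset_iff)
    qed (auto simp: sets U(2))
    also have "\<dots> \<le> ennreal (2 / e) * ennreal (e * \<epsilon> / 2)"
      using U(3) by (intro mult_left_mono) auto
    also have "\<dots> = ennreal \<epsilon>"
      using \<open>e > 0\<close> \<open>\<epsilon> > 0\<close> by (subst ennreal_mult[symmetric]) auto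
    finally have le: "emeasure lborel (\<Union>i\<in>C. ?B i) \<le> ennreal \<epsilon>" .
    have o: "open (\<Union>i\<in>C. ?B i)" by auto
    have lm: "(\<Union>i\<in>C. ?B i) \<in> lmeasurable"
      using le o by (intro fmeasurableI) (auto simp: top.not_eq_extremum intro: le_less_trans)
    have lm2: "E e - (\<Union>i\<in>C. ?B i) \<in> lmeasurable" "measure lebesgue (E e - (\<Union>i\<in>C. ?B i)) = 0"
      using C(4) negligible_iff_measure by blast+
    have "measure lebesgue ((E e - (\<Union>i\<in>C. ?B i)) \<union> (\<Union>i\<in>C. ?B i))
        \<le> measure lebesgue (E e - (\<Union>i\<in>C. ?B i)) + measure lebesgue (\<Union>i\<in>C. ?B i)"
      by (intro measure_Un_le) (use lm lm2 in \<open>auto simp: fmeasurable_def\<close>)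
    also have "\<dots> \<le> \<epsilon>"
      using le lm2(2) o \<open>\<epsilon> > 0\<close> by (simp add: measure_def enn2real_leI)
    finally show "\<exists>T. E e \<subseteq> T \<and> T \<in> lmeasurable \<and> measure lebesgue T \<le> \<epsilon>"
      using lm lm2 by (intro exI[of _ "(E e - (\<Union>i\<in>C. ?B i)) \<union> (\<Union>i\<in>C. ?B i)"] conjI fmeasurable.Un) auto
  qed
  \<comment> \<open>The exceptional set depends on \<open>e\<close>; the countably many rates 1 / (n
    + 1) give one null set that serves every \<open>e\<close>.\<close>
  have "negligible (\<Union>n. E (1 / real (Suc n)))"
    by (rule negligible_countable_Union[of "range (\<lambda>n. E (1 / real (Suc n)))"])
      (auto intro!: neg simp del: of_nat_Suc)
  then have "AE x in lebesgue. x \<notin> (\<Union>n. E (1 / real (Suc n)))"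
    by (intro AE_not_in) (auto simp: negligible_iff_null_sets)
  then have "AE x in lborel. x \<notin> (\<Union>n. E (1 / real (Suc n)))"
    by (simp add: AE_completion_iff)
  then show ?thesis
  proof (eventually_elim, intro impI allI)
    fix x e :: real assume x: "x \<notin> (\<Union>n. E (1 / real (Suc n)))" "x \<in> S" "0 < e"
    obtain n where n: "1 / real (Suc n) < e" using nat_approx_posE[OF x(3)] by blast
    from x have "x \<notin> E (1 / real (Suc n))" by blast
    then have "\<not> (\<forall>d>0. \<exists>r. 0 < r \<and> r < d \<and> 1 / real (Suc n) * r < measure \<mu> (ball x r))"
      using x(2) unfolding E_def by blast
    then obtain d where d: "d > 0" "\<And>r. 0 < r \<Longrightarrow> r < d \<Longrightarrow> measure \<mu> (ball x r) \<le> 1 / real (Suc n) * r"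
      by (meson not_less)
    then show "\<exists>d>0. \<forall>r. 0 < r \<and> r < d \<longrightarrow> measure \<mu> (ball x r) \<le> e * r"
    proof (intro exI[of _ d] conjI allI impI)
      fix r assume r: "0 < r \<and> r < d"
      have "1 / real (Suc n) * r \<le> e * r" using n r by (intro mult_right_mono) auto
      with d(2)[of r] r show "measure \<mu> (ball x r) \<le> e * r" by linarith
    qed auto
  qed
qed

text \<open>For a constant c, the measure with density \<open>g c\<close>, the positive part of f -
  c, vanishes on the set where f \<le> c, so the previous lemma makes it of small density at almost
  every point of that set. A rational c just above \<open>f x\<close> then bounds the averages of f
  over short intervals around x, centred or not. The rationals being countable, one null set
  suffices.\<close>

lemma AE_upper_derivative:
  fixes f :: "real \<Rightarrow> real"
  assumes f: "set_integrable lborel {a<..<b} f"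
  shows "AE x in lborel. x \<in> {a<..<b} \<longrightarrow>
    (\<forall>e>0. \<exists>d>0. \<forall>u v. u \<le> x \<and> x \<le> v \<and> v - u < d \<longrightarrow> (LINT z:{u<..<v}|lborel. f z) \<le> (f x + e) * (v - u))"
proof -
  define g where "g c z = indicator {a<..<b} z * max (indicator {a<..<b} z * f z - c) 0" for c z :: real
  have fi: "integrable lborel (\<lambda>z. indicator {a<..<b} z * f z)"
    using f by (simp add: set_integrable_def)
  have ci: "integrable lborel (\<lambda>z. indicator {a<..<b} z * c)" for c :: real
    by (cases "a \<le> b") (auto intro!: integrable_mult_left integrable_real_indicator)
  have m[measurable]: "(\<lambda>z. indicator {a<..<b} z * f z) \<in> borel_measurable borel"
    using fi borel_measurable_integrable by fastforce
  have gi: "integrable lborel (g c)" for c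
  proof (rule Bochner_Integration.integrable_bound)
    show "integrable lborel (\<lambda>z. \<bar>indicator {a<..<b} z * f z\<bar> + \<bar>indicator {a<..<b} z * c\<bar>)"
      using fi ci by (intro Bochner_Integration.integrable_add integrable_abs)
    show "g c \<in> borel_measurable lborel" unfolding g_def by measurable
    show "AE x in lborel. norm (g c x) \<le> norm (\<bar>indicator {a<..<b} x * f x\<bar> + \<bar>indicator {a<..<b} x * c\<bar>)"
      by (intro AE_I2) (auto simp: g_def indicator_def)
  qed
  define \<mu> where "\<mu> c = density lborel (\<lambda>z. ennreal (g c z))" for c
  have g0: "g c z \<ge> 0" for c z by (simp add: g_def)
  have em: "emeasure (\<mu> c) B = ennreal (LINT z:B|lborel. g c z)" if "B \<in> sets borel" for c B
    unfolding \<mu>_def by (rule emeasure_density_integral) (use that gi g0 in auto)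
  have fin: "finite_measure (\<mu> c)" for c
    by (rule finite_measureI) (subst em, auto simp: \<mu>_def)
  have sets: "sets (\<mu> c) = sets borel" for c by (simp add: \<mu>_def)
  have "AE x in lborel. \<forall>c\<in>\<rat>. x \<in> {x. indicator {a<..<b} x * f x \<le> c} \<longrightarrow>
      (\<forall>e>0. \<exists>d>0. \<forall>r. 0 < r \<and> r < d \<longrightarrow> measure (\<mu> c) (ball x r) \<le> e * r)"
  proof (subst AE_ball_countable[OF countable_rat], rule ballI)
    fix c :: real
    have "(LINT z:{x. indicator {a<..<b} x * f x \<le> c}|lborel. g c z) = 0"
      unfolding set_lebesgue_integral_def
      by (rule integral_eq_zero_AE) (auto simp: g_def indicator_def)
    then show "AE x in lborel. x \<in> {x. indicator {a<..<b} x * f x \<le> c} \<longrightarrow>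
      (\<forall>e>0. \<exists>d>0. \<forall>r. 0 < r \<and> r < d \<longrightarrow> measure (\<mu> c) (ball x r) \<le> e * r)"
      by (intro AE_small_on_null[OF fin sets]) (auto simp: em)
  qed
  then show ?thesis
  proof (eventually_elim, intro impI allI)
    fix x e :: real
    assume *: "\<forall>c\<in>\<rat>. x \<in> {x. indicator {a<..<b} x * f x \<le> c} \<longrightarrow>
      (\<forall>e>0. \<exists>d>0. \<forall>r. 0 < r \<and> r < d \<longrightarrow> measure (\<mu> c) (ball x r) \<le> e * r)"
      and x: "x \<in> {a<..<b}" and "e > 0"
    obtain c where c: "c \<in> \<rat>" "f x < c" "c < f x + e / 2"
      using Rats_dense_in_real[of "f x" "f x + e/2"] \<open>e > 0\<close> by auto
    then obtain d where d: "d > 0" "\<And>r. 0 < r \<Longrightarrow> r < d \<Longrightarrow> measure (\<mu> c) (ball x r) \<le> e / 4 * r"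
    proof -
      have "\<forall>e>0. \<exists>d>0. \<forall>r. 0 < r \<and> r < d \<longrightarrow> measure (\<mu> c) (ball x r) \<le> e * r"
        using bspec[OF * c(1)] c(2) x by simp
      then have "\<exists>d>0. \<forall>r. 0 < r \<and> r < d \<longrightarrow> measure (\<mu> c) (ball x r) \<le> e / 4 * r"
        using \<open>e > 0\<close> by (metis divide_pos_pos zero_less_numeral)
      then show thesis using that by blast
    qed
    \<comment> \<open>Half of \<open>d\<close>, because the interval is enclosed in the ball of
      radius 2 (v - u) about x; the other two bounds keep the interval inside (a, b). The factor 2
      is also why the density was requested below e / 4.\<close>
    define d' where "d' = min (d / 2) (min (x - a) (b - x))"
    have "d' > 0" using d x by (auto simp: d'_def)
    moreover have "(LINT z:{u<..<v}|lborel. f z) \<le> (f x + e) * (v - u)"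
      if uv: "u \<le> x" "x \<le> v" "v - u < d'" for u v
    proof (cases "u = v")
      case True then show ?thesis by (simp add: set_lebesgue_integral_def)
    next
      case False
      then have "u < v" using uv by auto
      have ab: "a < u" "v < b" using uv by (auto simp: d'_def)
      have sub: "set_integrable lborel {u<..<v} f"
        by (rule set_integrable_subset[OF f]) (use ab in auto)
      have gi': "set_integrable lborel B (g c)" if "B \<in> sets borel" for B
        using integrable_mult_indicator[OF _ gi[of c], of B] that by (simp add: set_integrable_def)
      have ic: "set_integrable lborel {u<..<v} (\<lambda>z. c)"
        using \<open>u < v\<close> unfolding set_integrable_def
        by (intro integrable_scaleR_left integrable_real_indicator) auto
      have "(LINT z:{u<..<v}|lborel. f z) \<le> (LINT z:{u<..<v}|lborel. c + g c z)"
      proof (rule set_integral_mono[OF sub])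
        show "set_integrable lborel {u<..<v} (\<lambda>z. c + g c z)"
          by (intro set_integral_add(1) gi' ic) auto
      qed (use ab in \<open>auto simp: g_def indicator_def\<close>)
      also have "\<dots> = c * (v - u) + (LINT z:{u<..<v}|lborel. g c z)"
        by (subst set_integral_add(2)) (use gi' ic \<open>u < v\<close> in \<open>auto simp: set_lebesgue_integral_def\<close>)
      also have "(LINT z:{u<..<v}|lborel. g c z) \<le> (LINT z:ball x (2 * (v - u))|lborel. g c z)"
        unfolding set_lebesgue_integral_def
      proof (rule integral_mono)
        show "indicator {u<..<v} z *\<^sub>R g c z \<le> indicator (ball x (2 * (v - u))) z *\<^sub>R g c z" for z
          using uv g0 by (auto simp: indicator_def dist_real_def)
      qed (use gi' in \<open>auto simp: set_integrable_def\<close>)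
      also have "\<dots> = measure (\<mu> c) (ball x (2 * (v - u)))"
        unfolding measure_def em[OF borel_open[OF open_ball]]
        by (rule enn2real_ennreal[symmetric]) (auto simp: set_lebesgue_integral_def g0)
      also have "\<dots> \<le> e / 4 * (2 * (v - u))"
        using uv \<open>u < v\<close> by (intro d) (auto simp: d'_def)
      also have "c * (v - u) + e / 4 * (2 * (v - u)) = (c + e / 2) * (v - u)"
        by (simp add: field_simps)
      also have "\<dots> \<le> (f x + e) * (v - u)"
        using c \<open>u < v\<close> by (intro mult_right_mono) auto
      finally show ?thesis by simp
    qed
    ultimately show "\<exists>d>0. \<forall>u v. u \<le> x \<and> x \<le> v \<and> v - u < d \<longrightarrow>
        (LINT z:{u<..<v}|lborel. f z) \<le> (f x + e) * (v - u)" by blast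
  qed
qed

lemma set_integral_interval_diff:
  fixes f :: "real \<Rightarrow> real"
  assumes f: "set_integrable lborel {a<..<b} f" and "a \<le> u" "u \<le> v" "v \<le> b"
  shows "(LINT z:{a<..<v}|lborel. f z) - (LINT z:{a<..<u}|lborel. f z) = (LINT z:{u..v}|lborel. f z)"
    and "set_integrable lborel {u..v} f"
proof -
  have eq: "(LINT z:{u<..<v}|lborel. f z) = (LINT z:{u..v}|lborel. f z)"
    unfolding set_lebesgue_integral_def
    by (rule integral_discrete_difference[where X="{u, v}"]) (auto simp: indicator_def)
  have "set_integrable lborel {u<..<v} f"
    by (rule set_integrable_subset[OF f]) (use assms in auto)
  moreover have "set_integrable lborel {u<..<v} f \<longleftrightarrow> set_integrable lborel {u..v} f"
    unfolding set_integrable_def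
    by (rule integrable_discrete_difference[where X="{u, v}"]) (auto simp: indicator_def)
  ultimately show iuv: "set_integrable lborel {u..v} f" by simp
  have "(LINT z:{a<..<v}|lborel. f z) = (LINT z:{a<..<u} \<union> {u<..<v}|lborel. f z)"
    unfolding set_lebesgue_integral_def
    by (rule integral_discrete_difference[where X="{u}"]) (use assms in \<open>auto simp: indicator_def\<close>)
  also have "\<dots> = (LINT z:{a<..<u}|lborel. f z) + (LINT z:{u<..<v}|lborel. f z)"
    using assms by (intro set_integral_Un set_integrable_subset[OF f]) auto
  finally show "(LINT z:{a<..<v}|lborel. f z) - (LINT z:{a<..<u}|lborel. f z) = (LINT z:{u..v}|lborel. f z)"
    using eq by simp
qed

text \<open>The upper estimates for f and for - f squeeze the difference quotients of the integral
  from both sides.\<close>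

theorem AE_has_derivative_integral:
  fixes f :: "real \<Rightarrow> real"
  assumes f: "set_integrable lborel {a<..<b} f"
  shows "AE x in lborel. x \<in> {a<..<b} \<longrightarrow>
    ((\<lambda>y. LINT z:{a<..<y}|lborel. f z) has_real_derivative f x) (at x)"
proof -
  have "set_integrable lborel {a<..<b} (\<lambda>z. - f z)"
    using f by (simp add: set_integrable_def)
  from AE_upper_derivative[OF f] AE_upper_derivative[OF this]
  show ?thesis
  proof (eventually_elim, intro impI)
    fix x
    assume up: "x \<in> {a<..<b} \<longrightarrow> (\<forall>e>0. \<exists>d>0. \<forall>u v. u \<le> x \<and> x \<le> v \<and> v - u < d \<longrightarrow>
        (LINT z:{u<..<v}|lborel. f z) \<le> (f x + e) * (v - u))"
      and lo: "x \<in> {a<..<b} \<longrightarrow> (\<forall>e>0. \<exists>d>0. \<forall>u v. u \<le> x \<and> x \<le> v \<and> v - u < d \<longrightarrow>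
        (LINT z:{u<..<v}|lborel. - f z) \<le> (- f x + e) * (v - u))"
      and x: "x \<in> {a<..<b}"
    define F where "F y = (LINT z:{a<..<y}|lborel. f z)" for y
    have F: "F v - F u = (LINT z:{u<..<v}|lborel. f z)" if "a < u" "u \<le> v" "v < b" for u v
    proof -
      have "F v - F u = (LINT z:{u..v}|lborel. f z)"
        unfolding F_def by (rule set_integral_interval_diff(1)[OF f]) (use that in auto)
      also have "\<dots> = (LINT z:{u<..<v}|lborel. f z)"
        unfolding set_lebesgue_integral_def
        by (rule integral_discrete_difference[where X="{u, v}"]) (auto simp: indicator_def)
      finally show ?thesis .
    qed
    have "\<exists>d>0. \<forall>y. \<bar>y - x\<bar> < d \<longrightarrow> \<bar>F y - F x - f x * (y - x)\<bar> \<le> e * \<bar>y - x\<bar>" if e: "e > 0" for e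
    proof -
      obtain d1 where d1: "d1 > 0" "\<And>u v. u \<le> x \<Longrightarrow> x \<le> v \<Longrightarrow> v - u < d1 \<Longrightarrow>
          (LINT z:{u<..<v}|lborel. f z) \<le> (f x + e) * (v - u)"
        using mp[OF up x] e by metis
      obtain d2 where d2: "d2 > 0" "\<And>u v. u \<le> x \<Longrightarrow> x \<le> v \<Longrightarrow> v - u < d2 \<Longrightarrow>
          (LINT z:{u<..<v}|lborel. - f z) \<le> (- f x + e) * (v - u)"
        using mp[OF lo x] e by metis
      define d where "d = min (min d1 d2) (min (x - a) (b - x))"
      have "d > 0" using d1 d2 x by (auto simp: d_def)
      moreover have "\<bar>F y - F x - f x * (y - x)\<bar> \<le> e * \<bar>y - x\<bar>" if "\<bar>y - x\<bar> < d" for y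
      proof -
        have N: "(LINT z:{u<..<v}|lborel. - f z) = - (LINT z:{u<..<v}|lborel. f z)" for u v
          by (simp add: set_lebesgue_integral_def)
        show ?thesis
        proof (cases "x \<le> y")
          case True
          have "y - x < d1" "y - x < d2" "a < x" "y < b" using that by (auto simp: d_def)
          then have "F y - F x \<le> (f x + e) * (y - x)" "- (F y - F x) \<le> (- f x + e) * (y - x)"
            using d1(2)[of x y] d2(2)[of x y] True F[of x y] unfolding N by simp_all
          then show ?thesis using True by (auto simp: algebra_simps abs_if)
        next
          case False
          have "x - y < d1" "x - y < d2" "a < y" "x < b" using that False by (auto simp: d_def)
          then have "F x - F y \<le> (f x + e) * (x - y)" "- (F x - F y) \<le> (- f x + e) * (x - y)"
            using d1(2)[of y x] d2(2)[of y x] False F[of y x] unfolding N by simp_all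
          then show ?thesis using False by (auto simp: algebra_simps abs_if)
        qed
      qed
      ultimately show ?thesis by blast
    qed
    then show "((\<lambda>y. LINT z:{a<..<y}|lborel. f z) has_real_derivative f x) (at x)"
      unfolding has_field_derivative_def has_derivative_within_alt F_def
      by (auto intro!: bounded_linear_mult_right)
  qed
qed

section \<open>Absolutely continuous curves\<close>

lemma abs_continuous_curve_nonneg:
  assumes "abs_continuous_curve d a b c"
  obtains g where "set_integrable lborel {a..b} g" "\<And>r. 0 \<le> g r"
    "\<And>s t. a \<le> s \<Longrightarrow> s \<le> t \<Longrightarrow> t \<le> b \<Longrightarrow> d (c s) (c t) \<le> (LINT r:{s..t}|lborel. g r)"
proof -
  obtain g where g: "set_integrable lborel {a..b} g"
    "\<And>s t. a \<le> s \<Longrightarrow> s \<le> t \<Longrightarrow> t \<le> b \<Longrightarrow> d (c s) (c t) \<le> (LINT r:{s..t}|lborel. g r)"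
    using assms by (auto simp: abs_continuous_curve_def)
  show thesis
  proof
    show ga: "set_integrable lborel {a..b} (\<lambda>r. \<bar>g r\<bar>)"
      using g(1) by (rule set_integrable_abs)
    show "d (c s) (c t) \<le> (LINT r:{s..t}|lborel. \<bar>g r\<bar>)" if "a \<le> s" "s \<le> t" "t \<le> b" for s t
    proof -
      have "(LINT r:{s..t}|lborel. g r) \<le> (LINT r:{s..t}|lborel. \<bar>g r\<bar>)"
        using that by (intro set_integral_mono set_integrable_subset[OF g(1)] set_integrable_subset[OF ga]) auto
      then show ?thesis using g(2)[OF that] by simp
    qed
  qed simp
qed

text \<open>Cousin's lemma, with the increments at the exceptional points controlled by an open set on
  which the dominating function has small integral.\<close>

lemma abs_continuous_mono_AE:
  fixes r :: "real \<Rightarrow> real"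
  assumes "a \<le> b" and ac: "abs_continuous_curve dist a b r"
    and der: "AE t in lborel. t \<in> {a<..<b} \<longrightarrow> (\<exists>d\<ge>0. (r has_real_derivative d) (at t))"
  shows "r a \<le> r b"
proof -
  obtain g where g: "set_integrable lborel {a..b} g" "\<And>z. 0 \<le> g z"
    and inc: "\<And>s t. a \<le> s \<Longrightarrow> s \<le> t \<Longrightarrow> t \<le> b \<Longrightarrow> dist (r s) (r t) \<le> (LINT z:{s..t}|lborel. g z)"
    using abs_continuous_curve_nonneg[OF ac] by blast
  define \<mu> where "\<mu> = density lborel (\<lambda>z. ennreal (indicator {a..b} z * g z))"
  have gi: "integrable lborel (\<lambda>z. indicator {a..b} z * g z)"
    using g(1) by (simp add: set_integrable_def)
  have [measurable]: "(\<lambda>z. indicator {a..b} z * g z) \<in> borel_measurable borel"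
    using gi borel_measurable_integrable by fastforce
  have em: "emeasure \<mu> B = ennreal (LINT z:B|lborel. indicator {a..b} z * g z)" if "B \<in> sets borel" for B
    unfolding \<mu>_def by (rule emeasure_density_integral) (use that gi g(2) in auto)
  have fin: "emeasure \<mu> (space \<mu>) \<noteq> \<infinity>"
    by (subst em) (auto simp: \<mu>_def)
  have sets: "sets \<mu> = sets borel" by (simp add: \<mu>_def)
  obtain N where N: "N \<in> null_sets lborel"
      "{t. \<not> (t \<in> {a<..<b} \<longrightarrow> (\<exists>d\<ge>0. (r has_real_derivative d) (at t)))} \<subseteq> N"
    using der by (auto elim!: AE_E simp: null_sets_def)
  \<comment> \<open>The end points join the exceptional set, since the hypothesis on the derivative
    covers only the open interval. The enlarged set is still Lebesgue null, hence of \<mu>-measure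
    zero.\<close>
  have N0: "N \<union> {a, b} \<in> sets borel" "emeasure \<mu> (N \<union> {a, b}) = 0"
  proof -
    show "N \<union> {a, b} \<in> sets borel" using N by auto
    have "N \<union> {a, b} \<in> null_sets lborel"
      using N(1) by (intro null_sets.Un) (auto simp: finite_imp_null_set_lborel)
    then have "AE z in lborel. z \<notin> N \<union> {a, b}" by (rule AE_not_in)
    then show "emeasure \<mu> (N \<union> {a, b}) = 0"
    proof (subst em)
      have "(LINT z:N \<union> {a, b}|lborel. indicator {a..b} z * g z) = 0"
        unfolding set_lebesgue_integral_def
        by (rule integral_eq_zero_AE) (use \<open>AE z in lborel. z \<notin> N \<union> {a, b}\<close> in eventually_elim, simp)
      then show "ennreal (LINT z:N \<union> {a, b}|lborel. indicator {a..b} z * g z) = 0" by simp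
    qed (use N in auto)
  qed
  have "r b - r a \<ge> - (e * (b - a) + e)" if "e > 0" for e
  proof -
    have "(INF U\<in>{U. N \<union> {a, b} \<subseteq> U \<and> open U}. emeasure \<mu> U) < ennreal e"
      using outer_regular[OF sets fin N0(1)] N0(2) that by simp
    then obtain U where U: "N \<union> {a, b} \<subseteq> U" "open U" "emeasure \<mu> U < ennreal e"
      by (auto simp: INF_less_iff)
    \<comment> \<open>The half-open interval makes the error additive under concatenation. The
      premise on u and v is needed because the local step of \<open>Bolzano\<close> also produces
      intervals that stick out of [a, b].\<close>
    define P where "P u v \<longleftrightarrow> (a \<le> u \<and> v \<le> b \<longrightarrow>
        r v - r u \<ge> - (e * (v - u) + (LINT z:{u<..v}|lborel. indicator U z * (indicator {a..b} z * g z))))" for u v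
    have gU: "integrable lborel (\<lambda>z. indicator U z * (indicator {a..b} z * g z))"
      using U(2) integrable_mult_indicator[OF _ gi, of U] by simp
    have gUs: "set_integrable lborel B (\<lambda>z. indicator U z * (indicator {a..b} z * g z))" if "B \<in> sets borel" for B
      using that integrable_mult_indicator[OF _ gU, of B] by (simp add: set_integrable_def)
    have "P a b"
      using \<open>a \<le> b\<close>
    proof (induction rule: Bolzano)
      case (trans u v w)
      have "(LINT z:{u<..w}|lborel. indicator U z * (indicator {a..b} z * g z)) =
        (LINT z:{u<..v} \<union> {v<..w}|lborel. indicator U z * (indicator {a..b} z * g z))"
        using trans by (intro arg_cong2[where f="\<lambda>S. set_lebesgue_integral lborel S"]) auto
      also have "\<dots> = (LINT z:{u<..v}|lborel. indicator U z * (indicator {a..b} z * g z)) +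
          (LINT z:{v<..w}|lborel. indicator U z * (indicator {a..b} z * g z))"
        by (intro set_integral_Un gUs) auto
      finally show ?case
        using trans by (auto simp: P_def algebra_simps)
    next
      case (local x)
      show ?case
      proof (cases "x \<in> N \<union> {a, b}")
        case True
        then obtain d where d: "d > 0" "ball x d \<subseteq> U"
          using U open_contains_ball by (meson subsetD)
        \<comment> \<open>Close to an exceptional point the interval lies in \<open>U\<close>, so
          its whole increment is charged to the integral of \<open>g\<close> over
          \<open>U\<close>.\<close>
        have "P u v" if uv: "u \<le> x" "x \<le> v" "v - u < d" for u v
          unfolding P_def
        proof (intro impI)
          assume ab: "a \<le> u \<and> v \<le> b"
          have sub: "{u..v} \<subseteq> U \<inter> {a..b}"
            using d(2) uv ab by (auto simp: subset_iff dist_real_def)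
          have "dist (r u) (r v) \<le> (LINT z:{u..v}|lborel. g z)"
            using inc ab uv by auto
          also have "\<dots> = (LINT z:{u..v}|lborel. indicator U z * (indicator {a..b} z * g z))"
            using sub by (intro set_lebesgue_integral_cong) (auto simp: indicator_def)
          also have "\<dots> = (LINT z:{u<..v}|lborel. indicator U z * (indicator {a..b} z * g z))"
            unfolding set_lebesgue_integral_def
            by (rule integral_discrete_difference[where X="{u}"]) (auto simp: indicator_def)
          finally show "r v - r u \<ge> - (e * (v - u) + (LINT z:{u<..v}|lborel. indicator U z * (indicator {a..b} z * g z)))"
            using that \<open>e > 0\<close> by (simp add: dist_real_def) (smt (verit) mult_nonneg_nonneg)
        qed
        then show ?thesis using d by blast
      next
        case False
        then obtain D where D: "D \<ge> 0" "(r has_real_derivative D) (at x)"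
          using N(2) local by force
        from D(2) \<open>e > 0\<close> obtain d where d: "d > 0"
          "\<And>y. \<bar>y - x\<bar> < d \<Longrightarrow> \<bar>r y - r x - D * (y - x)\<bar> \<le> e * \<bar>y - x\<bar>"
          unfolding has_field_derivative_def has_derivative_within_alt by auto
        \<comment> \<open>At the remaining points the derivative is nonnegative, and the increment
          can lose at most \<open>e\<close> times the length.\<close>
        have "P u v" if uv: "u \<le> x" "x \<le> v" "v - u < d" for u v
        proof -
          have 1: "r v - r x - D * (v - x) \<ge> - (e * (v - x))" "r u - r x - D * (u - x) \<le> e * (x - u)"
            using d(2)[of v] d(2)[of u] uv by auto
          have 2: "D * (v - x) \<ge> 0" "D * (u - x) \<le> 0" using D uv
            by (auto simp: mult_nonneg_nonpos)
          have "(LINT z:{u<..v}|lborel. indicator U z * (indicator {a..b} z * g z)) \<ge> 0"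
            unfolding set_lebesgue_integral_def
            by (intro integral_nonneg_AE AE_I2) (auto simp: g)
          with 1 2 show ?thesis unfolding P_def by (auto simp: algebra_simps)
        qed
        then show ?thesis using d by blast
      qed
    qed
    moreover have "(LINT z:{a<..b}|lborel. indicator U z * (indicator {a..b} z * g z)) \<le> e"
    proof -
      have "(LINT z:{a<..b}|lborel. indicator U z * (indicator {a..b} z * g z)) \<le>
        (LINT z:U|lborel. indicator {a..b} z * g z)"
        unfolding set_lebesgue_integral_def
      proof (rule integral_mono)
        show "indicator {a<..b} z *\<^sub>R (indicator U z * (indicator {a..b} z * g z))
            \<le> indicator U z *\<^sub>R (indicator {a..b} z * g z)" for z
          using g by (auto simp: indicator_def)
      qed (use gUs[of "{a<..b}"] gU in \<open>auto simp: set_integrable_def\<close>)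
      also have "\<dots> = measure \<mu> U"
        unfolding measure_def em[OF borel_open[OF U(2)]]
        by (rule enn2real_ennreal[symmetric]) (auto simp: set_lebesgue_integral_def g)
      also have "\<dots> \<le> e"
        unfolding measure_def using U(3) \<open>e > 0\<close> by (intro enn2real_leI) auto
      finally show ?thesis .
    qed
    ultimately show ?thesis using \<open>a \<le> b\<close> by (auto simp: P_def)
  qed
  then have ineq: "- (e * (b - a + 1)) \<le> r b - r a" if "e > 0" for e
    using that by (force simp: algebra_simps)
  show ?thesis
  proof (rule ccontr)
    assume "\<not> r a \<le> r b"
    \<comment> \<open>This value of e, inserted into \<open>ineq\<close>, would limit the drop of r
      to half of itself.\<close>
    then have pos: "(r a - r b) / (2 * (b - a + 1)) > 0" using \<open>a \<le> b\<close> by simp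
    have "(r a - r b) / (2 * w) * w = (r a - r b) / 2" if "w > 0" for w
      using that by simp
    from this[of "b - a + 1"] have "(r a - r b) / (2 * (b - a + 1)) * (b - a + 1) = (r a - r b) / 2"
      using \<open>a \<le> b\<close> by linarith
    with ineq[OF pos] have "- ((r a - r b) / 2) \<le> r b - r a" by metis
    with \<open>\<not> r a \<le> r b\<close> show False by argo
  qed
qed

lemma abs_continuous_curve_integral:
  fixes f :: "real \<Rightarrow> real"
  assumes f: "set_integrable lborel {a<..<b} f" and "a \<le> b"
  shows "abs_continuous_curve dist a b (\<lambda>y. LINT z:{a<..<y}|lborel. f z)"
  unfolding abs_continuous_curve_def
proof (intro exI[of _ "\<lambda>z. \<bar>f z\<bar>"] conjI allI impI)
  have "set_integrable lborel {a..b} f"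
    using set_integral_interval_diff(2)[OF f, of a b] assms by simp
  then show "set_integrable lborel {a..b} (\<lambda>z. \<bar>f z\<bar>)"
    by (rule set_integrable_abs)
  fix s t assume st: "a \<le> s \<and> s \<le> t \<and> t \<le> b"
  have "norm (LINT z:{s..t}|lborel. f z) \<le> (LINT z:{s..t}|lborel. norm (f z))"
    by (rule set_integral_norm_bound) (use set_integral_interval_diff(2)[OF f] st in auto)
  then show "dist (LINT z:{a<..<s}|lborel. f z) (LINT z:{a<..<t}|lborel. f z) \<le> (LINT z:{s..t}|lborel. \<bar>f z\<bar>)"
    using set_integral_interval_diff(1)[OF f, of s t] st by (simp add: dist_real_def abs_minus_commute)
qed

lemma abs_continuous_curve_id: "abs_continuous_curve dist a b (\<lambda>t::real. t)"
  unfolding abs_continuous_curve_def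
proof (intro exI[of _ "\<lambda>_. 1"] conjI allI impI)
  show "set_integrable lborel {a..b} (\<lambda>_. 1 :: real)"
    unfolding set_integrable_def
    by (intro integrable_scaleR_left integrable_real_indicator) (auto simp: emeasure_lborel_Icc_eq)
qed (auto simp: set_lebesgue_integral_def dist_real_def)

text \<open>Transfers absolute continuity from two known curves to any quantity whose increments
  they control. Combined with the identity curve it covers a Lipschitz dependence on time, and with
  the L2 curve the dependence on the particle positions.\<close>

lemma abs_continuous_curve_bound:
  assumes "abs_continuous_curve d a b c" "abs_continuous_curve d' a b c'"
    and "\<And>s t. a \<le> s \<Longrightarrow> s \<le> t \<Longrightarrow> t \<le> b \<Longrightarrow> d'' (c'' s) (c'' t) \<le> K * d (c s) (c t) + L * d' (c' s) (c' t)"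
    and "0 \<le> K" "0 \<le> L"
  shows "abs_continuous_curve d'' a b c''"
proof -
  obtain g where g: "set_integrable lborel {a..b} g"
    "\<And>s t. a \<le> s \<Longrightarrow> s \<le> t \<Longrightarrow> t \<le> b \<Longrightarrow> d (c s) (c t) \<le> (LINT r:{s..t}|lborel. g r)"
    using assms(1) by (auto simp: abs_continuous_curve_def)
  obtain g' where g': "set_integrable lborel {a..b} g'"
    "\<And>s t. a \<le> s \<Longrightarrow> s \<le> t \<Longrightarrow> t \<le> b \<Longrightarrow> d' (c' s) (c' t) \<le> (LINT r:{s..t}|lborel. g' r)"
    using assms(2) by (auto simp: abs_continuous_curve_def)
  show ?thesis
    unfolding abs_continuous_curve_def
  proof (intro exI[of _ "\<lambda>r. K * g r + L * g' r"] conjI allI impI)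
    show "set_integrable lborel {a..b} (\<lambda>r. K * g r + L * g' r)"
      using g(1) g'(1) by (intro set_integral_add set_integrable_mult_right) auto
    fix s t assume st: "a \<le> s \<and> s \<le> t \<and> t \<le> b"
    have "set_integrable lborel {s..t} g" "set_integrable lborel {s..t} g'"
      by (rule set_integrable_subset[OF g(1)] set_integrable_subset[OF g'(1)]; use st in auto)+
    then have "(LINT r:{s..t}|lborel. K * g r + L * g' r)
      = K * (LINT r:{s..t}|lborel. g r) + L * (LINT r:{s..t}|lborel. g' r)"
      by (subst set_integral_add(2)) auto
    moreover have "K * d (c s) (c t) \<le> K * (LINT r:{s..t}|lborel. g r)"
      using g(2) st assms(4) by (intro mult_left_mono) auto
    moreover have "L * d' (c' s) (c' t) \<le> L * (LINT r:{s..t}|lborel. g' r)"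
      using g'(2) st assms(5) by (intro mult_left_mono) auto
    ultimately show "d'' (c'' s) (c'' t) \<le> (LINT r:{s..t}|lborel. K * g r + L * g' r)"
      using assms(3)[of s t] st by simp
  qed
qed

lemma abs_continuous_curve_subset:
  assumes "abs_continuous_curve d a b c" "a \<le> a'" "b' \<le> b"
  shows "abs_continuous_curve d a' b' c"
proof -
  obtain g where g: "set_integrable lborel {a..b} g"
    "\<And>s t. a \<le> s \<Longrightarrow> s \<le> t \<Longrightarrow> t \<le> b \<Longrightarrow> d (c s) (c t) \<le> (LINT r:{s..t}|lborel. g r)"
    using assms(1) by (auto simp: abs_continuous_curve_def)
  then show ?thesis
    unfolding abs_continuous_curve_def
    by (intro exI[of _ g] conjI set_integrable_subset[OF g(1)]) (use assms in auto)
qed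

text \<open>The difference of r and the integral of f has derivative zero almost everywhere, so it
  and its negative are both nondecreasing; hence it is constant.\<close>

theorem abs_continuous_FTC:
  fixes r f :: "real \<Rightarrow> real"
  assumes ac: "abs_continuous_curve dist a b r" and f: "set_integrable lborel {a<..<b} f"
    and der: "AE t in lborel. t \<in> {a<..<b} \<longrightarrow> (r has_real_derivative f t) (at t)"
    and x: "x \<in> {a..b}"
  shows "r x = r a + (LINT z:{a<..<x}|lborel. f z)"
proof -
  define F where "F y = (LINT z:{a<..<y}|lborel. f z)" for y
  have "a \<le> x" "x \<le> b" using x by auto
  have acF: "abs_continuous_curve dist a b F"
    unfolding F_def by (rule abs_continuous_curve_integral[OF f]) (use x in auto)
  have derF: "AE t in lborel. t \<in> {a<..<b} \<longrightarrow> (F has_real_derivative f t) (at t)"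
    unfolding F_def by (rule AE_has_derivative_integral[OF f])
  have ac1: "abs_continuous_curve dist a b (\<lambda>y. r y - F y)"
    by (rule abs_continuous_curve_bound[OF ac acF, where K=1 and L=1]) (auto simp: dist_real_def)
  have ac2: "abs_continuous_curve dist a b (\<lambda>y. F y - r y)"
    by (rule abs_continuous_curve_bound[OF ac acF, where K=1 and L=1]) (auto simp: dist_real_def)
  \<comment> \<open>The derivative is kept in the form \<open>f t - f t\<close> so that
    \<open>DERIV_diff\<close> applies to either order of subtraction.\<close>
  have le: "u a \<le> u x" if acu: "abs_continuous_curve dist a b u"
    and du: "\<And>t. (r has_real_derivative f t) (at t) \<Longrightarrow> (F has_real_derivative f t) (at t) \<Longrightarrow>
      (u has_real_derivative f t - f t) (at t)" for u
    using \<open>a \<le> x\<close>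
  proof (rule abs_continuous_mono_AE)
    show "abs_continuous_curve dist a x u"
      by (rule abs_continuous_curve_subset[OF acu]) (use x in auto)
    show "AE t in lborel. t \<in> {a<..<x} \<longrightarrow> (\<exists>d\<ge>0. (u has_real_derivative d) (at t))"
      using der derF
    proof eventually_elim
      case (elim t)
      show ?case
      proof
        assume "t \<in> {a<..<x}"
        then have "(u has_real_derivative f t - f t) (at t)"
          using elim \<open>x \<le> b\<close> by (intro du) auto
        then show "\<exists>d\<ge>0. (u has_real_derivative d) (at t)" by force
      qed
    qed
  qed
  have "r a - F a \<le> r x - F x" by (rule le[OF ac1]) (rule DERIV_diff)
  moreover have "F a - r a \<le> F x - r x" by (rule le[OF ac2]) (rule DERIV_diff)
  moreover have "F a = 0" by (simp add: F_def set_lebesgue_integral_def)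
  ultimately show ?thesis by (simp add: F_def)
qed

section \<open>Convex entropies and communication protocols\<close>

text \<open>Supplies a version of the derivative of \<eta> that is defined, monotone and right
  continuous at every point of the open interval, while the entropy pair only speaks of almost every
  point.\<close>

lemma convex_right_derivative:
  fixes \<eta> :: "real \<Rightarrow> real"
  assumes lip: "L-lipschitz_on {0..1} \<eta>" and conv: "convex_on {0..1} \<eta>"
  obtains h where "mono_on {0<..<1} h" "\<And>m. m \<in> {0<..<1} \<Longrightarrow> \<bar>h m\<bar> \<le> L"
    "\<And>m. m \<in> {0<..<1} \<Longrightarrow> continuous (at_right m) h"
    "\<And>m d. m \<in> {0<..<1} \<Longrightarrow> (\<eta> has_real_derivative d) (at m) \<Longrightarrow> d = h m"
proof
  define \<sigma> where "\<sigma> m s = (\<eta> s - \<eta> m) / (s - m)" for m s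
  \<comment> \<open>By convexity forward slopes increase with their end point, so the right
    derivative is their infimum. This form yields monotonicity and the bound by \<open>L\<close>
    directly.\<close>
  define h where "h m = (INF s\<in>{m<..<1}. \<sigma> m s)" for m
  have bound: "\<bar>\<sigma> m s\<bar> \<le> L" if "m \<in> {0<..<1}" "s \<in> {m<..<1}" for m s
  proof -
    have "dist (\<eta> s) (\<eta> m) \<le> L * dist s m"
      using that by (intro lipschitz_onD[OF lip]) auto
    then show ?thesis using that by (simp add: \<sigma>_def dist_real_def field_simps)
  qed
  have slope: "\<sigma> x t \<le> \<sigma> x y" "\<sigma> x y \<le> \<sigma> t y" if "0 \<le> x" "x < t" "t < y" "y \<le> 1" for x t y
    using convex_on_slope_le[OF conv, of x y t] that
    by (simp_all add: \<sigma>_def minus_divide_divide[of "\<eta> x - \<eta> t" "x - t", symmetric]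
        minus_divide_divide[of "\<eta> x - \<eta> y" "x - y", symmetric] minus_divide_divide[of "\<eta> t - \<eta> y" "t - y", symmetric])
  have bdd: "bdd_below (\<sigma> m ` {m<..<1})" if "m \<in> {0<..<1}" for m
    by (rule bdd_belowI2[of _ "-L"]) (use bound[OF that] in \<open>auto simp: abs_le_iff minus_le_iff\<close>)
  have ne: "{m<..<1} \<noteq> {}" if "m \<in> {0<..<1}" for m :: real
    using that by auto
  have h_le: "h m \<le> \<sigma> m s" if "m \<in> {0<..<1}" "s \<in> {m<..<1}" for m s
    unfolding h_def by (rule cINF_lower[OF bdd[OF that(1)] that(2)])
  have h_ge: "c \<le> h m" if "m \<in> {0<..<1}" "\<And>s. s \<in> {m<..<1} \<Longrightarrow> c \<le> \<sigma> m s" for m c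
    unfolding h_def by (rule cINF_greatest[OF ne[OF that(1)] that(2)])
  have mono: "h m \<le> h m'" if "m \<in> {0<..<1}" "m' \<in> {0<..<1}" "m \<le> m'" for m m'
  proof (cases "m = m'")
    case False
    show ?thesis
    proof (rule h_ge[OF that(2)])
      fix s assume s: "s \<in> {m'<..<1}"
      have "h m \<le> \<sigma> m s" using s that by (intro h_le) auto
      also have "\<dots> \<le> \<sigma> m' s" using s that False by (intro slope) auto
      finally show "h m \<le> \<sigma> m' s" .
    qed
  qed simp
  then show "mono_on {0<..<1} h" by (auto intro!: mono_onI)
  show "\<bar>h m\<bar> \<le> L" if m: "m \<in> {0<..<1}" for m
  proof -
    obtain s where s: "s \<in> {m<..<1}" using ne[OF m] by blast
    have "h m \<le> L" using h_le[OF m s] bound[OF m s] by linarith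
    moreover have "- L \<le> h m" by (rule h_ge[OF m]) (use bound[OF m] in \<open>auto simp: abs_le_iff minus_le_iff\<close>)
    ultimately show ?thesis by simp
  qed
  have cont: "continuous_on {0..1} \<eta>" using lip by (rule lipschitz_on_continuous_on)
  show "continuous (at_right m) h" if m: "m \<in> {0<..<1}" for m
    unfolding continuous_within
  proof (rule order_tendstoI)
    have ev: "\<forall>\<^sub>F m' in at_right m. m' \<in> {m<..<1}"
      using m by (intro eventually_at_rightI[of m 1]) auto
    fix c
    show "\<forall>\<^sub>F m' in at_right m. c < h m'" if "c < h m"
      using ev by eventually_elim (use mono[OF m] m that in force)
    \<comment> \<open>Upper half of right continuity: fix s with a slope from m below c. The slope
      from m' to this s depends continuously on m' and dominates \<open>h m'\<close>.\<close>
    show "\<forall>\<^sub>F m' in at_right m. h m' < c" if "h m < c"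
    proof -
      obtain s where s: "s \<in> {m<..<1}" "\<sigma> m s < c"
        using h_ge[OF m, of c] \<open>h m < c\<close> by (meson not_le)
      have "isCont \<eta> m"
        using cont m by (intro continuous_on_interior) auto
      then have "((\<lambda>m'. \<sigma> m' s) \<longlongrightarrow> \<sigma> m s) (at m)"
        unfolding \<sigma>_def isCont_def using s by (intro tendsto_intros) auto
      then have "((\<lambda>m'. \<sigma> m' s) \<longlongrightarrow> \<sigma> m s) (at_right m)"
        by (rule filterlim_mono) (auto simp: at_within_le_at)
      then have "\<forall>\<^sub>F m' in at_right m. \<sigma> m' s < c"
        using s(2) by (rule order_tendstoD)
      moreover have "\<forall>\<^sub>F m' in at_right m. m' \<in> {m<..<s}"
        using s by (intro eventually_at_rightI[of m s]) auto
      ultimately show ?thesis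
      proof eventually_elim
        case (elim m')
        have "h m' \<le> \<sigma> m' s" using elim s m by (intro h_le) auto
        with elim show ?case by simp
      qed
    qed
  qed
  show "d = h m" if m: "m \<in> {0<..<1}" and d: "(\<eta> has_real_derivative d) (at m)" for m d
  proof -
    have "((\<lambda>s. (\<eta> s - \<eta> m) / (s - m)) \<longlongrightarrow> d) (at m)"
      using d by (simp add: has_field_derivative_iff)
    then have lim: "(\<sigma> m \<longlongrightarrow> d) (at_right m)"
      unfolding \<sigma>_def[abs_def] by (rule filterlim_mono) (auto simp: at_within_le_at)
    have ev: "\<forall>\<^sub>F s in at_right m. s \<in> {m<..<1}"
      using m by (intro eventually_at_rightI[of m 1]) auto
    have "h m \<le> d"
      by (rule tendsto_lowerbound[OF lim]) (use ev h_le[OF m] in \<open>auto elim!: eventually_mono\<close>)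
    moreover have "d \<le> h m"
    proof (rule h_ge[OF m])
      fix s assume s: "s \<in> {m<..<1}"
      have "\<forall>\<^sub>F t in at_right m. t \<in> {m<..<s}"
        using s by (intro eventually_at_rightI[of m s]) auto
      then have "\<forall>\<^sub>F t in at_right m. \<sigma> m t \<le> \<sigma> m s"
        by eventually_elim (use s m in \<open>auto intro!: slope\<close>)
      then show "d \<le> \<sigma> m s" by (intro tendsto_upperbound[OF lim]) auto
    qed
    ultimately show ?thesis by simp
  qed
qed

section \<open>Monotonicity and linear growth of the primitive of the protocol\<close>

lemma primitive_eq:
  "primitive \<phi> x = (if 0 \<le> x then LINT y:{0<..<x}|lborel. \<phi> y else - (LINT y:{x<..<0}|lborel. \<phi> y))"
  by (simp add: primitive_def interval_lebesgue_integral_def zero_ereal_def)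

text \<open>Nonnegativity of the protocol gives monotonicity, which later yields Borel
  measurability. For the growth, a possible singularity sits in [-1, 1], where the integral is
  finite, and elsewhere the protocol is at most its value at 1.\<close>

lemma protocol_primitive:
  assumes "protocol \<phi>"
  shows "mono (primitive \<phi>)" "\<exists>C\<ge>0. \<forall>x. \<bar>primitive \<phi> x\<bar> \<le> C * (1 + \<bar>x\<bar>)"
proof -
  have nn: "0 \<le> \<phi> x" and dec: "0 < \<bar>x\<bar> \<Longrightarrow> \<bar>x\<bar> \<le> \<bar>y\<bar> \<Longrightarrow> \<phi> y \<le> \<phi> x" and int: "set_integrable lborel {a..b} \<phi>" for x y a b
    using assms by (auto simp: protocol_def)
  have int': "set_integrable lborel {a<..<b} \<phi>" for a b
    by (rule set_integrable_subset[OF int[of a b]]) auto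
  have le: "(LINT y:A|lborel. \<phi> y) \<le> (LINT y:B|lborel. \<phi> y)"
    if "A \<subseteq> B" "set_integrable lborel A \<phi>" "set_integrable lborel B \<phi>" for A B
    using that(2,3) unfolding set_lebesgue_integral_def set_integrable_def
    by (rule integral_mono) (use that(1) nn in \<open>auto simp: indicator_def\<close>)
  have ge0: "0 \<le> (LINT y:A|lborel. \<phi> y)" for A
    unfolding set_lebesgue_integral_def by (intro integral_nonneg_AE AE_I2) (auto simp: nn)
  show "mono (primitive \<phi>)"
  proof (rule monoI)
    fix x y :: real assume "x \<le> y"
    then have "{0<..<x} \<subseteq> {0<..<y}" "{y<..<0} \<subseteq> {x<..<0}" by auto
    then show "primitive \<phi> x \<le> primitive \<phi> y"
      using le[of "{0<..<x}" "{0<..<y}"] le[of "{y<..<0}" "{x<..<0}"] int' ge0[of "{0<..<y}"] ge0[of "{x<..<0}"]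
      by (auto simp: primitive_eq intro: order_trans)
  qed
  define C0 where "C0 = (LINT y:{-1..1}|lborel. \<phi> y)"
  have part: "(LINT y:{a<..<b}|lborel. \<phi> y) \<le> C0 + \<phi> 1 * (b - a)" if "a \<le> b" for a b
  proof -
    have ic: "set_integrable lborel {a<..<b} (\<lambda>z. \<phi> 1)"
      using that unfolding set_integrable_def
      by (intro integrable_scaleR_left integrable_real_indicator) auto
    have ii: "integrable lborel (\<lambda>y. indicator {-1..1} y * \<phi> y)"
      using int[of "-1" 1] by (simp add: set_integrable_def)
    have i2: "set_integrable lborel {a<..<b} (\<lambda>y. indicator {-1..1} y * \<phi> y)"
      using integrable_mult_indicator[OF _ ii, of "{a<..<b}"] by (simp add: set_integrable_def)
    have "(LINT y:{a<..<b}|lborel. \<phi> y) \<le> (LINT y:{a<..<b}|lborel. indicator {-1..1} y * \<phi> y + \<phi> 1)"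
    proof (rule set_integral_mono[OF int'])
      show "\<phi> y \<le> indicator {-1..1} y * \<phi> y + \<phi> 1" for y
        using dec[of 1 y] nn[of 1] by (auto simp: indicator_def abs_le_iff)
    qed (intro set_integral_add i2 ic)
    also have "\<dots> = (LINT y:{a<..<b}|lborel. indicator {-1..1} y * \<phi> y) + \<phi> 1 * (b - a)"
      using that by (subst set_integral_add(2)[OF i2 ic]) (simp add: set_lebesgue_integral_def)
    also have "(LINT y:{a<..<b}|lborel. indicator {-1..1} y * \<phi> y) \<le> C0"
      unfolding C0_def set_lebesgue_integral_def
      by (rule integral_mono) (use i2 ii nn in \<open>auto simp: set_integrable_def indicator_def\<close>)
    finally show ?thesis by simp
  qed
  have "\<bar>primitive \<phi> x\<bar> \<le> (C0 + \<phi> 1) * (1 + \<bar>x\<bar>)" for x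
  proof -
    have "0 \<le> C0" unfolding C0_def by (rule ge0)
    have "\<bar>primitive \<phi> x\<bar> \<le> C0 + \<phi> 1 * \<bar>x\<bar>"
      using part[of 0 x] part[of x 0] ge0 by (auto simp: primitive_eq)
    also have "\<dots> \<le> (C0 + \<phi> 1) * (1 + \<bar>x\<bar>)"
      using \<open>0 \<le> C0\<close> nn[of 1] by (simp add: algebra_simps)
    finally show ?thesis .
  qed
  moreover have "0 \<le> C0 + \<phi> 1" using ge0 nn[of 1] by (simp add: C0_def)
  ultimately show "\<exists>C\<ge>0. \<forall>x. \<bar>primitive \<phi> x\<bar> \<le> C * (1 + \<bar>x\<bar>)" by blast
qed

section \<open>Monotone rearrangements on the unit interval\<close>

lemma space_leb_Omega [simp]: "space leb_Omega = Omega"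
  by (simp add: leb_Omega_def space_restrict_space)

lemma prob_space_leb_Omega: "prob_space leb_Omega"
  by (rule prob_spaceI) (simp add: leb_Omega_def emeasure_restrict_space space_restrict_space Omega_def)

interpretation leb_Omega: prob_space leb_Omega
  by (rule prob_space_leb_Omega)

lemma measurable_leb_Omega_borel: "f \<in> borel_measurable borel \<Longrightarrow> f \<in> borel_measurable leb_Omega"
  unfolding leb_Omega_def by (rule measurable_restrict_space1) simp

lemma integrable_leb_Omega: "integrable leb_Omega f \<longleftrightarrow> set_integrable lborel {0<..<1} (f :: real \<Rightarrow> real)"
  unfolding leb_Omega_def set_integrable_def Omega_def
  by (subst integrable_restrict_space) auto

lemma integral_leb_Omega: "integral\<^sup>L leb_Omega f = (LINT z:{0<..<1}|lborel. (f z :: real))"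
  unfolding leb_Omega_def set_lebesgue_integral_def Omega_def
  by (subst integral_restrict_space) auto

lemma AE_leb_Omega: "(AE m in leb_Omega. P m) \<longleftrightarrow> (AE m in lborel. m \<in> {0<..<1} \<longrightarrow> P m)"
  unfolding leb_Omega_def Omega_def by (rule AE_restrict_space_iff) simp

lemma mono_on_borel_measurable_leb_Omega:
  fixes h :: "real \<Rightarrow> real"
  assumes "mono_on Omega h"
  shows "h \<in> borel_measurable leb_Omega"
proof -
  have "h \<in> borel_measurable (restrict_space borel Omega)"
    by (rule borel_measurable_mono_on_fnc[OF assms])
  then show ?thesis
    unfolding leb_Omega_def by (simp add: measurable_def space_restrict_space sets_restrict_space)
qed

text \<open>Sublevel sets of a nondecreasing map are initial segments that may or may not contain
  their right end point; the sandwich makes it unnecessary to decide which.\<close>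

lemma measure_leb_Omega_initial:
  assumes S: "S \<in> sets leb_Omega" and c: "0 \<le> c" "c \<le> 1"
    and sub: "{0<..<c} \<subseteq> S" "S \<subseteq> {0<..c}"
  shows "measure leb_Omega S = c"
proof -
  have S': "S \<in> sets borel" "S \<subseteq> Omega"
    using S by (auto simp: leb_Omega_def sets_restrict_space_iff Omega_def)
  have "measure leb_Omega S = measure lborel S"
    using S' by (simp add: leb_Omega_def measure_restrict_space Omega_def)
  also have "\<dots> = c"
  proof (rule antisym)
    have "measure lborel S \<le> measure lborel {0<..c}"
      using sub S' c by (intro measure_mono_fmeasurable) (auto simp: fmeasurable_def)
    then show "measure lborel S \<le> c" using c by simp
    have fin: "S \<in> fmeasurable lborel"
      by (rule fmeasurableI2[of "{0<..c}"]) (use S' sub c in \<open>auto simp: fmeasurable_def\<close>)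
    have "measure lborel {0<..<c} \<le> measure lborel S"
      using sub S' c fin by (intro measure_mono_fmeasurable) (auto simp: fmeasurable_def)
    then show "c \<le> measure lborel S" using c by simp
  qed
  finally show ?thesis .
qed

lemma measure_distr_leb_Omega:
  fixes X :: "real \<Rightarrow> real"
  assumes "X \<in> borel_measurable leb_Omega"
  shows "measure (distr leb_Omega borel X) {..x} = measure leb_Omega {m\<in>Omega. X m \<le> x}"
proof (subst measure_distr)
  show "measure leb_Omega (X -` {..x} \<inter> space leb_Omega) = measure leb_Omega {m \<in> Omega. X m \<le> x}"
    by (rule arg_cong[where f="measure leb_Omega"]) auto
qed (use assms in auto)

text \<open>Both conditions describe initial segments of the same length, so they can differ only at
  the single mass m = M x. There they may really differ, as for X the identity and x in
  Omega.\<close>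

lemma AE_le_iff_less_cdf:
  fixes X :: "real \<Rightarrow> real"
  assumes X: "mono_on Omega X"
  shows "AE m in leb_Omega. X m \<le> x \<longleftrightarrow> m < measure (distr leb_Omega borel X) {..x}"
proof -
  let ?c = "measure (distr leb_Omega borel X) {..x}"
  note [measurable] = mono_on_borel_measurable_leb_Omega[OF X]
  let ?S = "{m\<in>Omega. X m \<le> x}"
  have c: "?c = measure leb_Omega ?S" by (rule measure_distr_leb_Omega) measurable
  have S: "?S \<in> sets leb_Omega"
    using measurable_sets[of X leb_Omega borel "{..x}"] by (simp add: vimage_def Int_def conj_commute)
  have lt: "X m \<le> x" if "m \<in> Omega" "m < ?c" for m
  proof (rule ccontr)
    assume "\<not> X m \<le> x"
    then have "?S \<subseteq> {0<..<m}"
      using mono_onD[OF X that(1)] by (force simp: Omega_def not_le)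
    then have "measure leb_Omega ?S \<le> measure leb_Omega {0<..<m}"
      using that by (intro leb_Omega.finite_measure_mono) (auto simp: leb_Omega_def sets_restrict_space_iff Omega_def)
    also have "\<dots> = m"
      using that by (intro measure_leb_Omega_initial) (auto simp: leb_Omega_def sets_restrict_space_iff Omega_def)
    finally show False using that c by simp
  qed
  have ge: "m \<le> ?c" if "m \<in> Omega" "X m \<le> x" for m
  proof -
    have "{0<..m} \<subseteq> ?S"
      using mono_onD[OF X _ that(1)] that by (force simp: Omega_def)
    then have "measure leb_Omega {0<..m} \<le> measure leb_Omega ?S"
      using S by (intro leb_Omega.finite_measure_mono) auto
    moreover have "measure leb_Omega {0<..m} = m"
      using that by (intro measure_leb_Omega_initial) (auto simp: leb_Omega_def sets_restrict_space_iff Omega_def)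
    ultimately show ?thesis using c by simp
  qed
  have "AE m in lborel. m \<noteq> ?c" by (rule AE_lborel_singleton)
  then show ?thesis
    unfolding AE_leb_Omega by eventually_elim (use lt ge in \<open>force simp: Omega_def\<close>)
qed

text \<open>The rearrangement is the quantile function: {X \<le> x} lies between (0, cdf x) and (0,
  cdf x], so both measures have the same distribution function. Only the values of \<open>X\<close>
  on \<open>Omega\<close> enter.\<close>

lemma distr_rearrangement:
  assumes \<rho>: "prob_space \<rho>" "sets \<rho> = sets borel"
    and X: "mono_on Omega X" "\<And>m. m \<in> Omega \<Longrightarrow> X m = rearrangement \<rho> m"
  shows "distr leb_Omega borel X = \<rho>"
proof (rule cdf_unique)
  interpret \<rho>: real_distribution \<rho>
    using \<rho> by (simp add: real_distribution_def real_distribution_axioms_def)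
  note [measurable] = mono_on_borel_measurable_leb_Omega[OF X(1)]
  show "real_distribution (distr leb_Omega borel X)"
    by (rule leb_Omega.real_distribution_distr) measurable
  show "real_distribution \<rho>" by unfold_locales
  have ub: "X m \<le> x" if "m \<in> Omega" "m < cdf \<rho> x" for m x
  proof -
    \<comment> \<open>A point where the distribution function is below m bounds the set in
      \<open>rearrangement\<close> from below; without such a bound its infimum would carry no
      information.\<close>
    obtain b where b: "cdf \<rho> b < m"
    proof -
      have "\<forall>\<^sub>F b in at_bot. cdf \<rho> b < m"
        using \<open>m \<in> Omega\<close> by (intro order_tendstoD[OF \<rho>.cdf_lim_at_bot]) (auto simp: Omega_def)
      then show thesis using that by (auto simp: eventually_at_bot_linorder)
    qed
    have "bdd_below {x. m < measure \<rho> {..x}}"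
    proof (rule bdd_belowI[of _ b])
      fix y assume "y \<in> {x. m < measure \<rho> {..x}}"
      then have "cdf \<rho> b < cdf \<rho> y" using b by (simp add: cdf_def)
      then show "b \<le> y" using \<rho>.cdf_nondecreasing[of y b] by linarith
    qed
    then show ?thesis using that X(2) by (auto simp: rearrangement_def cdf_def intro: cInf_lower)
  qed
  have lb: "m \<le> cdf \<rho> x" if "m \<in> Omega" "X m \<le> x" for m x
  proof (rule ccontr)
    assume "\<not> m \<le> cdf \<rho> x"
    \<comment> \<open>Right continuity of the distribution function pushes the strict inequality
      slightly beyond x, which forces the infimum defining \<open>X m\<close> to lie strictly above
      x.\<close>
    then have "\<forall>\<^sub>F y in at_right x. cdf \<rho> y < m"
      using \<rho>.cdf_is_right_cont[of x] by (intro order_tendstoD) (auto simp: continuous_within)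
    then obtain b where b: "b > x" "\<And>y. x < y \<Longrightarrow> y < b \<Longrightarrow> cdf \<rho> y < m"
      by (auto simp: eventually_at_right_field)
    obtain z where "cdf \<rho> z > m"
    proof -
      have "\<forall>\<^sub>F b in at_top. cdf \<rho> b > m"
        using \<open>m \<in> Omega\<close> by (intro order_tendstoD[OF \<rho>.cdf_lim_at_top_prob]) (auto simp: Omega_def)
      then show thesis using that by (auto simp: eventually_at_top_linorder)
    qed
    then have ne: "{x. m < measure \<rho> {..x}} \<noteq> {}" by (auto simp: cdf_def)
    have "(x + b) / 2 \<le> rearrangement \<rho> m"
      unfolding rearrangement_def
    proof (rule cInf_greatest[OF ne])
      fix y assume y: "y \<in> {x. m < measure \<rho> {..x}}"
      show "(x + b) / 2 \<le> y"
      proof (rule ccontr)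
        assume "\<not> (x + b) / 2 \<le> y"
        then have "cdf \<rho> y \<le> cdf \<rho> ((x + b) / 2)" by (intro \<rho>.cdf_nondecreasing) auto
        also have "\<dots> < m" using b by (intro b(2)) auto
        finally show False using y by (simp add: cdf_def)
      qed
    qed
    then show False using that X(2) b(1) by simp
  qed
  show "cdf (distr leb_Omega borel X) = cdf \<rho>"
  proof
    fix x
    have "cdf (distr leb_Omega borel X) x = measure leb_Omega {m\<in>Omega. X m \<le> x}"
      unfolding cdf_def by (rule measure_distr_leb_Omega) measurable
    also have "\<dots> = cdf \<rho> x"
    proof (rule measure_leb_Omega_initial)
      show "{m\<in>Omega. X m \<le> x} \<in> sets leb_Omega"
        using measurable_sets[of X leb_Omega borel "{..x}"] by (simp add: vimage_def Int_def conj_commute)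
      show "{0<..<cdf \<rho> x} \<subseteq> {m\<in>Omega. X m \<le> x}"
        using ub \<rho>.cdf_bounded_prob[of x] by (force simp: Omega_def)
      show "{m\<in>Omega. X m \<le> x} \<subseteq> {0<..cdf \<rho> x}"
        using lb by (auto simp: Omega_def)
    qed (auto simp: \<rho>.cdf_nonneg \<rho>.cdf_bounded_prob)
    finally show "cdf (distr leb_Omega borel X) x = cdf \<rho> x" .
  qed
qed

section \<open>Layer-cake formula for functions of a distribution function\<close>

lemma (in pair_sigma_finite) integrable_mult_product:
  fixes f g :: "_ \<Rightarrow> real"
  assumes "integrable M1 f" "integrable M2 g"
  shows "integrable (M1 \<Otimes>\<^sub>M M2) (\<lambda>(x, y). f x * g y)"
proof (rule Fubini_integrable)
  have [measurable]: "f \<in> borel_measurable M1" "g \<in> borel_measurable M2" using assms by auto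
  show "(\<lambda>(x, y). f x * g y) \<in> borel_measurable (M1 \<Otimes>\<^sub>M M2)" by measurable
  have "integrable M1 (\<lambda>x. \<bar>f x\<bar> * (\<integral>y. \<bar>g y\<bar> \<partial>M2))" using assms by auto
  then show "integrable M1 (\<lambda>x. \<integral> y. norm (case (x, y) of (x, y) \<Rightarrow> f x * g y) \<partial>M2)"
    by (simp add: abs_mult)
  show "AE x in M1. integrable M2 (\<lambda>y. case (x, y) of (x, y) \<Rightarrow> f x * g y)"
    using assms by auto
qed

text \<open>Replaces the chain rule: H composed with M is a superposition, with weights
  \<open>k m\<close>, of the unit steps located at the positions \<open>X m\<close>. Atoms and gaps
  of the distribution need no separate treatment.\<close>

lemma cdf_composite_eq:
  fixes X k H :: "real \<Rightarrow> real"
  assumes X: "mono_on Omega X" and k[measurable]: "k \<in> borel_measurable leb_Omega"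
    and H: "\<And>m. m \<in> {0..1} \<Longrightarrow> H m = H 0 + (LINT z:{0<..<m}|lborel. k z)"
  shows "H (measure (distr leb_Omega borel X) {..x}) = H 0 + (LINT m|leb_Omega. k m * indicator {X m..} x)"
proof -
  let ?c = "measure (distr leb_Omega borel X) {..x}"
  have m[measurable]: "X \<in> borel_measurable leb_Omega" by (rule mono_on_borel_measurable_leb_Omega[OF X])
  interpret d: prob_space "distr leb_Omega borel X" using m by (rule leb_Omega.prob_space_distr)
  have c: "?c \<le> 1" "0 \<le> ?c" by auto
  have c1: "z < 1" if "z < ?c" for z using that c by linarith
  have "(LINT z:{0<..<?c}|lborel. k z) = (LINT z:{0<..<1}|lborel. k z * indicator {..<?c} z)"
    unfolding set_lebesgue_integral_def
    by (intro Bochner_Integration.integral_cong) (auto simp: indicator_def dest: c1)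
  also have "\<dots> = (LINT m|leb_Omega. k m * indicator {..<?c} m)"
    by (rule integral_leb_Omega[symmetric])
  also have "\<dots> = (LINT m|leb_Omega. k m * indicator {X m..} x)"
  proof (intro integral_cong_AE)
    show "(\<lambda>m. k m * indicator {..<?c} m) \<in> borel_measurable leb_Omega"
    proof (intro borel_measurable_times k measurable_leb_Omega_borel)
      show "indicator {..<?c} \<in> borel_measurable borel"
        by (rule borel_measurable_indicator) simp
    qed
    have eq: "(\<lambda>m. k m * indicator {X m..} x) = (\<lambda>m. if X m \<le> x then k m else 0)"
      by (auto simp: indicator_def fun_eq_iff)
    show "(\<lambda>m. k m * indicator {X m..} x) \<in> borel_measurable leb_Omega"
      unfolding eq by measurable
    show "AE m in leb_Omega. k m * indicator {..<?c} m = k m * indicator {X m..} x"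
      using AE_le_iff_less_cdf[OF X, of x] by eventually_elim (auto simp: indicator_def)
  qed
  finally show ?thesis using H[of ?c] c by auto
qed

text \<open>Fubini for the superposition of steps: integrating a step against g leaves the tail
  integral of g from \<open>X m\<close> onwards. The constant \<open>H 0\<close> has no step to
  carry it and therefore appears as a separate term.\<close>

lemma layer_cake:
  fixes X k H g :: "real \<Rightarrow> real"
  assumes X: "mono_on Omega X" and k: "integrable leb_Omega k" and g: "integrable lborel g"
    and H: "\<And>m. m \<in> {0..1} \<Longrightarrow> H m = H 0 + (LINT z:{0<..<m}|lborel. k z)"
  defines "N \<equiv> \<lambda>x. measure (distr leb_Omega borel X) {..x}"
  shows "integrable lborel (\<lambda>x. H (N x) * g x)" (is ?I)
    and "(LINT x|lborel. H (N x) * g x) =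
      H 0 * (LINT x|lborel. g x) + (LINT m|leb_Omega. k m * (LINT x:{X m..}|lborel. g x))" (is ?E)
    and "integrable leb_Omega (\<lambda>m. k m * (LINT x:{X m..}|lborel. g x))" (is ?J)
proof -
  interpret pair_sigma_finite leb_Omega lborel ..
  note [measurable] = mono_on_borel_measurable_leb_Omega[OF X]
  have [measurable]: "k \<in> borel_measurable leb_Omega" "g \<in> borel_measurable borel" using k g by auto
  define K where "K = (\<lambda>(m, x). (k m * g x) * indicator {p. X (fst p) \<le> snd p} (m, x))"
  have K: "integrable (leb_Omega \<Otimes>\<^sub>M lborel) K"
  proof (rule Bochner_Integration.integrable_bound[OF integrable_mult_product[OF k g]])
    have "K = (\<lambda>p. (k (fst p) * g (snd p)) * (if X (fst p) \<le> snd p then 1 else 0))"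
      by (auto simp: K_def fun_eq_iff)
    then show "K \<in> borel_measurable (leb_Omega \<Otimes>\<^sub>M lborel)" by simp
  qed (auto simp: K_def indicator_def)
  have kb: "k \<in> borel_measurable leb_Omega" by measurable
  have eq: "H (N x) * g x = H 0 * g x + (LINT m|leb_Omega. K (m, x))" for x
  proof -
    have "(LINT m|leb_Omega. K (m, x)) = (LINT m|leb_Omega. (k m * indicator {X m..} x) * g x)"
      by (intro Bochner_Integration.integral_cong) (auto simp: K_def indicator_def)
    moreover have "H (N x) = H 0 + (LINT m|leb_Omega. k m * indicator {X m..} x)"
      unfolding N_def by (rule cdf_composite_eq[OF X kb H])
    ultimately show ?thesis by (simp add: algebra_simps)
  qed
  have K': "integrable (leb_Omega \<Otimes>\<^sub>M lborel) (case_prod (\<lambda>m x. K (m, x)))" using K by simp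
  have eq2: "(LINT x|lborel. K (m, x)) = k m * (LINT x:{X m..}|lborel. g x)" for m
    by (simp add: K_def set_lebesgue_integral_def indicator_def mult_ac
        flip: integral_mult_right_zero)
  have i: "integrable lborel (\<lambda>x. LINT m|leb_Omega. K (m, x))"
    by (rule integrable_snd[OF K'])
  show ?I unfolding eq using g i by auto
  show ?J using integrable_fst[OF K'] unfolding eq2 .
  show ?E unfolding eq using g i Fubini_integral[OF K'] by (simp add: eq2)
qed

section \<open>Square-integrable functions\<close>

lemma L2_measurable: "u \<in> L2 M \<Longrightarrow> u \<in> borel_measurable M"
  by (simp add: L2_def)

lemma L2_mult_integrable:
  assumes "u \<in> L2 M" "v \<in> L2 M"
  shows "integrable M (\<lambda>x. u x * v x)"
proof (rule Bochner_Integration.integrable_bound)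
  show "integrable M (\<lambda>x. (u x)\<^sup>2 + (v x)\<^sup>2)" using assms by (auto simp: L2_def)
  show "(\<lambda>x. u x * v x) \<in> borel_measurable M" using assms by (auto simp: L2_def)
  have "\<bar>a * b\<bar> \<le> a\<^sup>2 + b\<^sup>2" for a b :: real
  proof -
    have "2 * \<bar>a * b\<bar> \<le> a\<^sup>2 + b\<^sup>2"
      using sum_squares_bound[of "\<bar>a\<bar>" "\<bar>b\<bar>"] by (simp add: abs_mult)
    then show ?thesis by linarith
  qed
  then show "AE x in M. norm (u x * v x) \<le> norm ((u x)\<^sup>2 + (v x)\<^sup>2)" by simp
qed

lemma L2_add: "u \<in> L2 M \<Longrightarrow> v \<in> L2 M \<Longrightarrow> (\<lambda>x. u x + v x) \<in> L2 M"
  using L2_mult_integrable[of u M v] by (auto simp: L2_def power2_sum mult.assoc)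

lemma L2_cmult: "u \<in> L2 M \<Longrightarrow> (\<lambda>x. c * u x) \<in> L2 M"
  by (auto simp: L2_def power_mult_distrib)

lemma L2_diff: "u \<in> L2 M \<Longrightarrow> v \<in> L2 M \<Longrightarrow> (\<lambda>x. u x - v x) \<in> L2 M"
  using L2_add[of u M "\<lambda>x. (-1) * v x"] L2_cmult[of v M "-1"] by simp

lemma L2_abs: "u \<in> L2 M \<Longrightarrow> (\<lambda>x. \<bar>u x\<bar>) \<in> L2 M"
  by (auto simp: L2_def)

lemma L2_mult_bounded:
  assumes u: "u \<in> L2 M" and b: "b \<in> borel_measurable M" "\<And>x. x \<in> space M \<Longrightarrow> \<bar>b x\<bar> \<le> B"
  shows "(\<lambda>x. b x * u x) \<in> L2 M"
proof -
  have "integrable M (\<lambda>x. (b x * u x)\<^sup>2)"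
  proof (rule Bochner_Integration.integrable_bound)
    show "integrable M (\<lambda>x. B\<^sup>2 * (u x)\<^sup>2)" using u by (auto simp: L2_def)
    show "(\<lambda>x. (b x * u x)\<^sup>2) \<in> borel_measurable M" using u b by (auto simp: L2_def)
    show "AE x in M. norm ((b x * u x)\<^sup>2) \<le> norm (B\<^sup>2 * (u x)\<^sup>2)"
    proof (rule AE_I2)
      fix x assume "x \<in> space M"
      then have "(b x)\<^sup>2 \<le> B\<^sup>2" using b(2) by (metis abs_ge_zero power2_abs power_mono)
      then show "norm ((b x * u x)\<^sup>2) \<le> norm (B\<^sup>2 * (u x)\<^sup>2)"
        by (simp add: power_mult_distrib mult_right_mono)
    qed
  qed
  then show ?thesis using u b by (auto simp: L2_def)
qed

lemma L2_cong: "(\<And>x. x \<in> space M \<Longrightarrow> u x = v x) \<Longrightarrow> u \<in> L2 M \<longleftrightarrow> v \<in> L2 M"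
  unfolding L2_def mem_Collect_eq
  by (intro conj_cong measurable_cong Bochner_Integration.integrable_cong) auto

lemma L2_dominated:
  assumes "v \<in> L2 M" "u \<in> borel_measurable M" "\<And>x. \<bar>u x\<bar> \<le> v x"
  shows "u \<in> L2 M"
proof -
  have "integrable M (\<lambda>x. (u x)\<^sup>2)"
  proof (rule Bochner_Integration.integrable_bound)
    show "integrable M (\<lambda>x. (v x)\<^sup>2)" using assms by (simp add: L2_def)
    have "(u x)\<^sup>2 \<le> (v x)\<^sup>2" for x
      using assms(3)[of x] by (metis abs_ge_zero power2_abs power_mono)
    then show "AE x in M. norm ((u x)\<^sup>2) \<le> norm ((v x)\<^sup>2)" by (intro AE_I2) simp
  qed (use assms in simp)
  then show ?thesis using assms by (simp add: L2_def)
qed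

lemma (in prob_space) L2_const: "(\<lambda>x. c) \<in> L2 M"
  by (auto simp: L2_def)

lemma (in prob_space) L2_bounded:
  assumes "b \<in> borel_measurable M" "\<And>x. x \<in> space M \<Longrightarrow> \<bar>b x\<bar> \<le> B"
  shows "b \<in> L2 M"
  using L2_mult_bounded[OF L2_const[of 1] assms] by simp

lemma (in prob_space) L2_integrable: "u \<in> L2 M \<Longrightarrow> integrable M u"
  using L2_mult_integrable[OF _ L2_const[of 1]] by simp

text \<open>The inequality says that the variance of the absolute value is nonnegative.\<close>

lemma (in prob_space) L1_le_L2:
  assumes "u \<in> L2 M"
  shows "(LINT x|M. \<bar>u x\<bar>) \<le> sqrt (LINT x|M. (u x)\<^sup>2)"
proof (rule real_le_rsqrt)
  have i: "integrable M (\<lambda>x. \<bar>u x\<bar>)" "integrable M (\<lambda>x. \<bar>u x\<bar>\<^sup>2)"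
    using L2_integrable[OF L2_abs[OF assms]] assms by (auto simp: L2_def)
  have "0 \<le> variance (\<lambda>x. \<bar>u x\<bar>)" by simp
  also have "\<dots> = expectation (\<lambda>x. (u x)\<^sup>2) - (expectation (\<lambda>x. \<bar>u x\<bar>))\<^sup>2"
    using variance_eq[OF i] by simp
  finally show "(expectation (\<lambda>x. \<bar>u x\<bar>))\<^sup>2 \<le> expectation (\<lambda>x. (u x)\<^sup>2)" by simp
qed

section \<open>Test functions\<close>

text \<open>Outside the support G is locally constant, so its derivative vanishes there as well. The
  integrals over the line and over a half line then reduce to a bounded interval whose outer ends
  lie beyond the support.\<close>

lemma integral_derivative_compact_support:
  fixes G g :: "real \<Rightarrow> real"
  assumes der: "\<And>x. (G has_real_derivative g x) (at x)" and cont: "continuous_on UNIV g"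
    and supp: "\<And>x. \<bar>x\<bar> > R \<Longrightarrow> G x = 0"
  shows "integrable lborel g" "(LINT x|lborel. g x) = 0" "(LINT x:{a..}|lborel. g x) = - G a"
proof -
  have g0: "g x = 0" if "\<bar>x\<bar> > R" for x
  proof -
    have "open {x :: real. R < \<bar>x\<bar>}" by (intro open_Collect_less continuous_intros)
    then have "\<forall>\<^sub>F y in nhds x. R < \<bar>y\<bar>"
      using that by (auto simp: eventually_nhds)
    then have "\<forall>\<^sub>F y in nhds x. G y = 0"
      by eventually_elim (rule supp)
    then have "(G has_real_derivative g x) (at x) \<longleftrightarrow> ((\<lambda>_. 0) has_real_derivative g x) (at x)"
      by (intro DERIV_cong_ev) auto
    then show ?thesis using der[of x] DERIV_unique by (metis DERIV_const)
  qed
  have hb: "has_bochner_integral lborel (\<lambda>x. g x * indicator {a..b} x) (G b - G a)" if "a \<le> b" for a b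
    using that der cont by (intro has_bochner_integral_FTC_Icc_real) (auto simp: continuous_on_eq_continuous_at)
  have ng: "\<bar>x\<bar> \<le> R" if "g x \<noteq> 0" for x using g0[of x] that by linarith
  define b where "b = \<bar>R\<bar> + 1"
  have eq: "(\<lambda>x. g x * indicator {-b..b} x) = g"
    by (auto simp: b_def indicator_def fun_eq_iff dest!: ng)
  have "has_bochner_integral lborel g (G b - G (-b))"
    using hb[of "-b" b] unfolding eq by (simp add: b_def)
  moreover have "G b = 0" "G (-b) = 0" by (auto simp: b_def intro!: supp)
  ultimately show "integrable lborel g" "(LINT x|lborel. g x) = 0"
    by (auto simp: has_bochner_integral_iff)
  define c where "c = \<bar>R\<bar> + \<bar>a\<bar> + 1"
  have "indicator {a..} x *\<^sub>R g x = g x * indicator {a..c} x" for x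
    using ng[of x] by (cases "g x = 0") (auto simp: c_def indicator_def)
  then have "(LINT x:{a..}|lborel. g x) = (LINT x|lborel. g x * indicator {a..c} x)"
    unfolding set_lebesgue_integral_def by (rule arg_cong[where f="integral\<^sup>L lborel", OF ext])
  also have "\<dots> = G c - G a"
    using hb[of a c] by (auto simp: c_def has_bochner_integral_iff)
  also have "G c = 0" by (auto simp: c_def intro!: supp)
  finally show "(LINT x:{a..}|lborel. g x) = - G a" by simp
qed

lemma dir_deriv_eq_0_outside:
  fixes f :: "'a::euclidean_space \<Rightarrow> real"
  assumes "closed K" "\<And>x. x \<notin> K \<Longrightarrow> f x = 0" "x \<notin> K"
  shows "dir_deriv b f x = 0"
proof -
  have "(f has_derivative (\<lambda>_. 0)) (at x)"
    by (rule has_derivative_transform_within_open[OF has_derivative_const[of 0] open_Compl[OF assms(1)]])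
      (use assms in auto)
  then have "frechet_derivative f (at x) = (\<lambda>_. 0)"
    using frechet_derivative_at by metis
  then show ?thesis by (simp add: dir_deriv_def)
qed

lemma smooth_differentiable:
  assumes "smooth f"
  shows "f differentiable (at x)" "b \<in> Basis \<Longrightarrow> dir_deriv b f differentiable (at x)"
    "b \<in> Basis \<Longrightarrow> c \<in> Basis \<Longrightarrow> dir_deriv c (dir_deriv b f) differentiable (at x)"
  using assms[unfolded smooth_def, rule_format, of "[]"] assms[unfolded smooth_def, rule_format, of "[b]"]
    assms[unfolded smooth_def, rule_format, of "[b, c]"] by auto

lemma test_function_real:
  assumes "\<psi> \<in> test_functions (UNIV :: real set)"
  obtains R where "\<And>x. (\<psi> has_real_derivative deriv \<psi> x) (at x)" "continuous_on UNIV (deriv \<psi>)"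
    "\<And>x. \<bar>x\<bar> > R \<Longrightarrow> \<psi> x = 0"
proof -
  have s: "smooth \<psi>" and c: "compact (closure {x. \<psi> x \<noteq> 0})"
    using assms by (auto simp: test_functions_def)
  have d: "(\<psi> has_real_derivative deriv \<psi> x) (at x)" for x
    using smooth_differentiable(1)[OF s, of x] by (simp add: DERIV_deriv_iff_real_differentiable)
  have "dir_deriv 1 \<psi> = deriv \<psi>"
  proof
    fix x
    have "frechet_derivative \<psi> (at x) = (*) (deriv \<psi> x)"
      using d[of x] unfolding has_field_derivative_def by (metis frechet_derivative_at)
    then show "dir_deriv 1 \<psi> x = deriv \<psi> x" by (simp add: dir_deriv_def)
  qed
  then have "continuous_on UNIV (deriv \<psi>)"
    using smooth_differentiable(2)[OF s, of 1]
    by (auto simp: continuous_on_eq_continuous_at intro: differentiable_imp_continuous_within)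
  moreover obtain R where R: "\<And>x. x \<in> closure {x. \<psi> x \<noteq> 0} \<Longrightarrow> norm x \<le> R"
    using compact_imp_bounded[OF c] by (auto simp: bounded_iff)
  moreover have "\<psi> x = 0" if "\<bar>x\<bar> > R" for x
    using R[of x] that closure_subset[of "{x. \<psi> x \<noteq> 0}"] by (auto simp: subset_iff)
  ultimately show thesis using d that by blast
qed

section \<open>Uniform bounds for test functions in space-time\<close>

lemma partial_derivatives:
  fixes f :: "real \<times> real \<Rightarrow> real"
  assumes "f differentiable (at (t, x))"
  shows "((\<lambda>t. f (t, x)) has_real_derivative dir_deriv (1, 0) f (t, x)) (at t)"
    "((\<lambda>x. f (t, x)) has_real_derivative dir_deriv (0, 1) f (t, x)) (at x)"
proof -
  let ?D = "frechet_derivative f (at (t, x))"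
  have D: "(f has_derivative ?D) (at (t, x))" using assms frechet_derivative_works by blast
  interpret bounded_linear ?D using D by (rule has_derivative_bounded_linear)
  have "((f \<circ> (\<lambda>t. (t, x))) has_derivative (?D \<circ> (\<lambda>h. (h, 0)))) (at t)"
    by (intro diff_chain_at has_derivative_Pair has_derivative_ident has_derivative_const D)
  moreover have "?D \<circ> (\<lambda>h. (h, 0)) = (*) (dir_deriv (1, 0) f (t, x))"
  proof
    fix h
    have "?D (h *\<^sub>R (1, 0)) = h *\<^sub>R ?D (1, 0)" by (rule scaleR)
    then show "(?D \<circ> (\<lambda>h. (h, 0))) h = dir_deriv (1, 0) f (t, x) * h"
      unfolding o_def dir_deriv_def by (simp only: scaleR_Pair real_scaleR_def mult_zero_right mult_1_right mult_1_left mult_zero_left mult.commute)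
  qed
  ultimately show "((\<lambda>t. f (t, x)) has_real_derivative dir_deriv (1, 0) f (t, x)) (at t)"
    by (simp add: has_field_derivative_def o_def)
  have "((f \<circ> (\<lambda>x. (t, x))) has_derivative (?D \<circ> (\<lambda>h. (0, h)))) (at x)"
    by (intro diff_chain_at has_derivative_Pair has_derivative_ident has_derivative_const D)
  moreover have "?D \<circ> (\<lambda>h. (0, h)) = (*) (dir_deriv (0, 1) f (t, x))"
  proof
    fix h
    have "?D (h *\<^sub>R (0, 1)) = h *\<^sub>R ?D (0, 1)" by (rule scaleR)
    then show "(?D \<circ> (\<lambda>h. (0, h))) h = dir_deriv (0, 1) f (t, x) * h"
      unfolding o_def dir_deriv_def by (simp only: scaleR_Pair real_scaleR_def mult_zero_right mult_1_right mult_1_left mult_zero_left mult.commute)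
  qed
  ultimately show "((\<lambda>x. f (t, x)) has_real_derivative dir_deriv (0, 1) f (t, x)) (at x)"
    by (simp add: has_field_derivative_def o_def)
qed

lemma bounded_compact_support:
  fixes f :: "'a::metric_space \<Rightarrow> real"
  assumes "compact K" "continuous_on UNIV f" "\<And>x. x \<notin> K \<Longrightarrow> f x = 0"
  obtains B where "0 \<le> B" "\<And>x. \<bar>f x\<bar> \<le> B"
proof -
  have "bounded (f ` K)"
    using assms by (intro compact_imp_bounded compact_continuous_image) (auto intro: continuous_on_subset)
  then obtain B where B: "\<And>x. x \<in> K \<Longrightarrow> \<bar>f x\<bar> \<le> B" by (auto simp: bounded_iff)
  show thesis
  proof
    show "\<bar>f x\<bar> \<le> max 0 B" for x using B[of x] assms(3)[of x] by (cases "x \<in> K") auto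
  qed simp
qed

lemma test_function_bounded:
  assumes "f \<in> test_functions U"
  obtains B where "0 \<le> B" "\<And>x. \<bar>f x\<bar> \<le> B" "continuous_on UNIV f"
proof -
  have c: "continuous_on UNIV f"
  proof -
    have "smooth f" using assms by (simp add: test_functions_def)
    then show ?thesis
      using smooth_differentiable(1) differentiable_imp_continuous_within
      unfolding continuous_on_eq_continuous_at[OF open_UNIV] by blast
  qed
  have z: "f x = 0" if "x \<notin> closure {x. f x \<noteq> 0}" for x
    using that closure_subset[of "{x. f x \<noteq> 0}"] by auto
  have "compact (closure {x. f x \<noteq> 0})" using assms by (simp add: test_functions_def)
  then obtain B where "0 \<le> B" "\<And>x. \<bar>f x\<bar> \<le> B"
    using bounded_compact_support[OF _ c z] by blast
  then show thesis using c that by blast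
qed

lemma bounded_derivative_lipschitz:
  fixes u u' :: "real \<Rightarrow> real"
  assumes "\<And>x. (u has_real_derivative u' x) (at x)" "\<And>x. \<bar>u' x\<bar> \<le> B"
  shows "\<bar>u y - u x\<bar> \<le> B * \<bar>y - x\<bar>"
  using field_differentiable_bound[of UNIV u u' B y x] assms by auto

text \<open>Collects every quantitative fact about a test function that is used later, with a single
  constant. The last estimate is a second-order Taylor bound in time, the source of the quadratic
  remainder of the tail primitive.\<close>

lemma test_function_plane:
  assumes "f \<in> test_functions ({0<..<T::real} \<times> (UNIV :: real set))"
  obtains R C where "0 \<le> R" "0 \<le> C"
    "\<And>t x. ((\<lambda>t. f (t, x)) has_real_derivative dir_deriv (1, 0) f (t, x)) (at t)"
    "\<And>t x. ((\<lambda>x. f (t, x)) has_real_derivative dir_deriv (0, 1) f (t, x)) (at x)"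
    "continuous_on UNIV f" "continuous_on UNIV (dir_deriv (1, 0) f)" "continuous_on UNIV (dir_deriv (0, 1) f)"
    "\<And>t x. R < \<bar>x\<bar> \<Longrightarrow> f (t, x) = 0" "\<And>t x. R < \<bar>x\<bar> \<Longrightarrow> dir_deriv (1, 0) f (t, x) = 0"
    "\<And>t x. t \<notin> {0<..<T} \<Longrightarrow> f (t, x) = 0"
    "\<And>z. \<bar>f z\<bar> \<le> C" "\<And>z. \<bar>dir_deriv (1, 0) f z\<bar> \<le> C"
    "\<And>s t x y. \<bar>f (s, y) - f (t, x)\<bar> \<le> C * (\<bar>s - t\<bar> + \<bar>y - x\<bar>)"
    "\<And>s t x. \<bar>f (s, x) - f (t, x) - (s - t) * dir_deriv (1, 0) f (t, x)\<bar> \<le> C * (s - t)\<^sup>2"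
proof -
  let ?K = "closure {z. f z \<noteq> 0}"
  let ?ft = "dir_deriv (1, 0) f" and ?fx = "dir_deriv (0, 1) f"
  have s: "smooth f" and c: "compact ?K" and K: "?K \<subseteq> {0<..<T} \<times> UNIV"
    using assms by (auto simp: test_functions_def)
  have B: "(1, 0) \<in> (Basis :: (real \<times> real) set)" "(0, 1) \<in> (Basis :: (real \<times> real) set)"
    by (auto simp: Basis_prod_def)
  have out: "f z = 0" if "z \<notin> ?K" for z
    using that closure_subset[of "{z. f z \<noteq> 0}"] by auto
  have out1: "dir_deriv b f z = 0" if "z \<notin> ?K" for z b
    by (rule dir_deriv_eq_0_outside[OF closed_closure out that])
  have out2: "dir_deriv b' (dir_deriv b f) z = 0" if "z \<notin> ?K" for z b b'
    by (rule dir_deriv_eq_0_outside[OF closed_closure out1 that])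
  note sd = smooth_differentiable[OF s]
  have cont: "continuous_on UNIV f" "continuous_on UNIV ?ft" "continuous_on UNIV ?fx"
    "continuous_on UNIV (dir_deriv (1, 0) ?ft)"
    using sd(1) sd(2)[OF B(1)] sd(2)[OF B(2)] sd(3)[OF B(1) B(1)]
    by (auto simp: continuous_on_eq_continuous_at intro: differentiable_imp_continuous_within)
  obtain C0 where C0: "0 \<le> C0" "\<And>z. \<bar>f z\<bar> \<le> C0"
    using bounded_compact_support[OF c cont(1) out] by blast
  obtain C1 where C1: "0 \<le> C1" "\<And>z. \<bar>?ft z\<bar> \<le> C1"
    using bounded_compact_support[OF c cont(2) out1] by blast
  obtain C2 where C2: "0 \<le> C2" "\<And>z. \<bar>?fx z\<bar> \<le> C2"
    using bounded_compact_support[OF c cont(3) out1] by blast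
  obtain C3 where C3: "0 \<le> C3" "\<And>z. \<bar>dir_deriv (1, 0) ?ft z\<bar> \<le> C3"
    using bounded_compact_support[OF c cont(4) out2] by blast
  \<comment> \<open>The sum of the bounds of f, its two first derivatives and its second time
    derivative, so that it dominates each of them.\<close>
  define C where "C = C0 + C1 + C2 + C3"
  obtain R where R: "\<And>z. z \<in> ?K \<Longrightarrow> norm z \<le> R"
    using compact_imp_bounded[OF c] by (auto simp: bounded_iff)
  have Rout: "(t, x) \<notin> ?K" if "max 0 R < \<bar>x\<bar>" for t x
  proof
    assume "(t, x) \<in> ?K"
    then have "norm (t, x) \<le> R" by (rule R)
    moreover have "\<bar>x\<bar> \<le> norm (t, x)" using norm_snd_le[of x t] by simp
    ultimately show False using that by linarith
  qed
  have Tout: "(t, x) \<notin> ?K" if "t \<notin> {0<..<T}" for t x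
    using K that by auto
  have dt: "((\<lambda>t. f (t, x)) has_real_derivative ?ft (t, x)) (at t)"
    and dx: "((\<lambda>x. f (t, x)) has_real_derivative ?fx (t, x)) (at x)"
    and dtt: "((\<lambda>t. ?ft (t, x)) has_real_derivative dir_deriv (1, 0) ?ft (t, x)) (at t)" for t x
    using partial_derivatives sd(1) sd(2)[OF B(1)] by blast+
  show thesis
  proof (rule that[of "max 0 R" C])
    show "((\<lambda>t. f (t, x)) has_real_derivative ?ft (t, x)) (at t)"
      "((\<lambda>x. f (t, x)) has_real_derivative ?fx (t, x)) (at x)" for t x by (rule dt dx)+
    show "\<bar>f (s, y) - f (t, x)\<bar> \<le> C * (\<bar>s - t\<bar> + \<bar>y - x\<bar>)" for s t x y
    proof -
      have "\<bar>f (s, y) - f (t, y)\<bar> \<le> C1 * \<bar>s - t\<bar>"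
        by (rule bounded_derivative_lipschitz[OF dt C1(2)])
      also have "\<dots> \<le> C * \<bar>s - t\<bar>" using C0 C1 C2 C3 by (intro mult_right_mono) (auto simp: C_def)
      finally have 1: "\<bar>f (s, y) - f (t, y)\<bar> \<le> C * \<bar>s - t\<bar>" .
      have "\<bar>f (t, y) - f (t, x)\<bar> \<le> C2 * \<bar>y - x\<bar>"
        by (rule bounded_derivative_lipschitz[OF dx C2(2)])
      also have "\<dots> \<le> C * \<bar>y - x\<bar>" using C0 C1 C2 C3 by (intro mult_right_mono) (auto simp: C_def)
      finally show ?thesis using 1 unfolding distrib_left by linarith
    qed
    show "\<bar>f (s, x) - f (t, x) - (s - t) * ?ft (t, x)\<bar> \<le> C * (s - t)\<^sup>2" for s t x
    proof -
      \<comment> \<open>Subtracting the linear part leaves a function of r with derivative ft (r, x)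
        - ft (t, x), which is at most C3 |s - t| between t and s.\<close>
      define u where "u r = f (r, x) - r * ?ft (t, x)" for r
      have du: "(u has_real_derivative ?ft (r, x) - ?ft (t, x)) (at r)" for r
        unfolding u_def by (auto intro!: derivative_eq_intros dt)
      have b: "\<bar>?ft (r, x) - ?ft (t, x)\<bar> \<le> C3 * \<bar>s - t\<bar>" if "r \<in> closed_segment t s" for r
      proof -
        have "\<bar>?ft (r, x) - ?ft (t, x)\<bar> \<le> C3 * \<bar>r - t\<bar>"
          by (rule bounded_derivative_lipschitz[OF dtt C3(2)])
        also have "\<dots> \<le> C3 * \<bar>s - t\<bar>"
          using that C3(1) by (intro mult_left_mono) (auto simp: closed_segment_eq_real_ivl split: if_splits)
        finally show ?thesis .
      qed
      have "norm (u s - u t) \<le> C3 * \<bar>s - t\<bar> * norm (s - t)"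
        by (rule field_differentiable_bound[of "closed_segment t s" u])
          (use b in \<open>auto intro: has_field_derivative_at_within du\<close>)
      also have "\<dots> = C3 * (s - t)\<^sup>2" by (simp add: power2_eq_square mult.assoc flip: abs_mult)
      also have "\<dots> \<le> C * (s - t)\<^sup>2"
        using C0 C1 C2 C3 by (intro mult_right_mono) (auto simp: C_def)
      finally show ?thesis by (simp add: u_def algebra_simps)
    qed
    show "\<bar>f z\<bar> \<le> C" "\<bar>?ft z\<bar> \<le> C" for z
      using C0 C1 C2 C3 by (auto simp: C_def intro: order_trans[OF C0(2)] order_trans[OF C1(2)])
    show "0 \<le> C" using C0 C1 C2 C3 by (auto simp: C_def)
  qed (use cont out[OF Rout] out1[OF Rout] out[OF Tout] in auto)
qed

text \<open>\<open>F\<close> is the primitive of f in x that vanishes to the right of the support;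
  its partial derivatives are \<open>Ft\<close> and f. The remainder is quadratic jointly in both
  increments, so substituting L2 functions for the positions leaves it integrable. The factor 2 R is
  the length of the interval that carries the support.\<close>

lemma tail_integral_expansion:
  fixes f ft :: "real \<times> real \<Rightarrow> real"
  assumes R: "0 \<le> R" and C: "0 \<le> C"
    and cont: "continuous_on UNIV f" "continuous_on UNIV ft"
    and supp_all: "\<forall>t x. R < \<bar>x\<bar> \<longrightarrow> f (t, x) = 0" "\<forall>t x. R < \<bar>x\<bar> \<longrightarrow> ft (t, x) = 0"
    and bd: "\<And>z. \<bar>f z\<bar> \<le> C" "\<And>z. \<bar>ft z\<bar> \<le> C"
    and lip: "\<And>s t x y. \<bar>f (s, y) - f (t, x)\<bar> \<le> C * (\<bar>s - t\<bar> + \<bar>y - x\<bar>)"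
    and taylor: "\<And>s t x. \<bar>f (s, x) - f (t, x) - (s - t) * ft (t, x)\<bar> \<le> C * (s - t)\<^sup>2"
  defines "F \<equiv> \<lambda>t x. - (LINT y:{x..}|lborel. f (t, y))"
    and "Ft \<equiv> \<lambda>t x. - (LINT y:{x..}|lborel. ft (t, y))"
  shows "\<bar>F t x\<bar> \<le> 2 * R * C" "\<bar>Ft t x\<bar> \<le> 2 * R * C"
    "\<bar>F s y - F t x\<bar> \<le> (2 * R + 1) * C * (\<bar>s - t\<bar> + \<bar>y - x\<bar>)"
    "\<bar>F s y - F t x - (s - t) * Ft t x - f (t, x) * (y - x)\<bar> \<le> (2 * R + 2) * C * ((s - t)\<^sup>2 + (y - x)\<^sup>2)"
    "(\<lambda>(t, x). F t x) \<in> borel_measurable (borel \<Otimes>\<^sub>M borel)"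
    "(\<lambda>(t, x). Ft t x) \<in> borel_measurable (borel \<Otimes>\<^sub>M borel)"
    "integrable lborel (\<lambda>x. f (t, x))" "integrable lborel (\<lambda>x. ft (t, x))"
proof -
  note supp = supp_all[rule_format]
  have tail: "integrable lborel g" "\<bar>LINT y:{x..}|lborel. g y\<bar> \<le> 2 * R * B"
    if g: "continuous_on UNIV g" "\<And>x. R < \<bar>x\<bar> \<Longrightarrow> g x = 0" "\<And>x. \<bar>g x\<bar> \<le> B" for g :: "real \<Rightarrow> real" and x B
  proof -
    have m[measurable]: "g \<in> borel_measurable borel" using g(1) by (rule borel_measurable_continuous_onI)
    have ib: "integrable lborel (\<lambda>x. B * indicator {-R..R} x)"
      by (intro integrable_mult_right integrable_real_indicator) (auto simp: R)
    have B0: "0 \<le> B" using g(3)[of 0] by linarith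
    have le: "norm (g x) \<le> B * indicator {-R..R} x" for x
      using g(2)[of x] g(3)[of x] B0 by (auto simp: indicator_def)
    show i: "integrable lborel g"
      by (rule Bochner_Integration.integrable_bound[OF ib]) (use le B0 in \<open>auto simp: abs_mult\<close>)
    have "norm (LINT y|lborel. indicator {x..} y *\<^sub>R g y) \<le> (LINT y|lborel. B * indicator {-R..R} y)"
    proof (rule order_trans[OF integral_norm_bound integral_mono[OF integrable_norm ib]])
      show "integrable lborel (\<lambda>y. indicator {x..} y *\<^sub>R g y)"
        by (rule integrable_mult_indicator[OF _ i]) simp
      show "norm (indicator {x..} y *\<^sub>R g y) \<le> B * indicator {-R..R} y" for y
        using le[of y] B0 by (auto simp: indicator_def split: if_splits)
    qed
    also have "\<dots> = 2 * R * B" using R by simp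
    finally show "\<bar>LINT y:{x..}|lborel. g y\<bar> \<le> 2 * R * B" by (simp add: set_lebesgue_integral_def)
  qed
  have sl: "continuous_on UNIV (\<lambda>y. f (t, y))" "continuous_on UNIV (\<lambda>y. ft (t, y))" for t
    by (rule continuous_on_compose2[OF cont(1)] continuous_on_compose2[OF cont(2)]; auto intro!: continuous_intros)+
  show fi: "integrable lborel (\<lambda>x. f (t, x))" and ift: "integrable lborel (\<lambda>x. ft (t, x))" for t
    using tail(1)[OF sl(1) supp(1) bd(1)] tail(1)[OF sl(2) supp(2) bd(2)] by auto
  show "\<bar>F t x\<bar> \<le> 2 * R * C" "\<bar>Ft t x\<bar> \<le> 2 * R * C" for t x
    using tail(2)[OF sl(1) supp(1) bd(1)] tail(2)[OF sl(2) supp(2) bd(2)] by (auto simp: F_def Ft_def)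
  have si: "set_integrable lborel A g" if "integrable lborel g" "A \<in> sets borel" for A and g :: "real \<Rightarrow> real"
    using integrable_mult_indicator[of A lborel g] that by (simp add: set_integrable_def)
  have time: "\<bar>F s x - F t x\<bar> \<le> 2 * R * C * \<bar>s - t\<bar>"
    "\<bar>F s x - F t x - (s - t) * Ft t x\<bar> \<le> 2 * R * C * (s - t)\<^sup>2" for s t x
  proof -
    have "F s x - F t x = - (LINT y:{x..}|lborel. f (s, y) - f (t, y))"
      unfolding F_def by (subst set_integral_diff(2)) (auto intro!: si fi)
    moreover have "\<bar>LINT y:{x..}|lborel. f (s, y) - f (t, y)\<bar> \<le> 2 * R * (C * \<bar>s - t\<bar>)"
    proof (rule tail(2))
      show "\<bar>f (s, z) - f (t, z)\<bar> \<le> C * \<bar>s - t\<bar>" for z using lip[of s z t z] by simp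
    qed (auto intro!: continuous_intros sl simp: supp)
    ultimately show "\<bar>F s x - F t x\<bar> \<le> 2 * R * C * \<bar>s - t\<bar>" by simp
    have "F s x - F t x - (s - t) * Ft t x = - (LINT y:{x..}|lborel. f (s, y) - f (t, y) - (s - t) * ft (t, y))"
      unfolding F_def Ft_def by (subst set_integral_diff(2), (auto intro!: si fi ift)[2])+ simp
    moreover have "\<bar>LINT y:{x..}|lborel. f (s, y) - f (t, y) - (s - t) * ft (t, y)\<bar> \<le> 2 * R * (C * (s - t)\<^sup>2)"
      by (rule tail(2)) (use taylor in \<open>auto intro!: continuous_intros sl simp: supp\<close>)
    ultimately show "\<bar>F s x - F t x - (s - t) * Ft t x\<bar> \<le> 2 * R * C * (s - t)\<^sup>2" by simp
  qed
  \<comment> \<open>The increment of \<open>F\<close> in x is the integral of f over [x, y), here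
    compared with an arbitrary slope c. The slope c = 0 gives the Lipschitz bound, and c = f (t, x)
    the first-order expansion.\<close>
  have space1: "\<bar>F s y - F s x - c * (y - x)\<bar> \<le> B * (y - x)"
    if xy: "x \<le> y" and B: "\<And>z. x \<le> z \<Longrightarrow> z \<le> y \<Longrightarrow> \<bar>f (s, z) - c\<bar> \<le> B" for s x y c B
  proof -
    have "(LINT z:{x..}|lborel. f (s, z)) = (LINT z:{x..<y} \<union> {y..}|lborel. f (s, z))"
      using xy by (intro arg_cong2[where f="\<lambda>S. set_lebesgue_integral lborel S"]) auto
    also have "\<dots> = (LINT z:{x..<y}|lborel. f (s, z)) + (LINT z:{y..}|lborel. f (s, z))"
      by (intro set_integral_Un si fi) auto
    finally have 1: "F s y - F s x = (LINT z:{x..<y}|lborel. f (s, z))" by (simp add: F_def)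
    have ic: "set_integrable lborel {x..<y} (\<lambda>z. c)" for c :: real
      using xy unfolding set_integrable_def
      by (intro integrable_scaleR_left integrable_real_indicator) auto
    have 2: "(LINT z:{x..<y}|lborel. c) = c * (y - x)" for c :: real
      using xy by (simp add: set_lebesgue_integral_def)
    have "F s y - F s x - c * (y - x) = (LINT z:{x..<y}|lborel. f (s, z) - c)"
      unfolding 1 2[symmetric] by (subst set_integral_diff(2)) (auto intro!: si fi ic)
    also have "\<bar>\<dots>\<bar> \<le> (LINT z:{x..<y}|lborel. \<bar>f (s, z) - c\<bar>)"
      using set_integral_norm_bound[OF set_integral_diff(1)[OF si[OF fi[of s], of "{x..<y}"] ic[of c]]] by simp
    also have "\<dots> \<le> (LINT z:{x..<y}|lborel. B)"
      by (rule set_integral_mono) (use B in \<open>auto intro!: si fi ic set_integrable_abs set_integral_diff\<close>)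
    finally show ?thesis unfolding 2 .
  qed
  have space: "\<bar>F s y - F s x - c * (y - x)\<bar> \<le> B * \<bar>y - x\<bar>"
    if B: "\<And>z. \<bar>z - x\<bar> \<le> \<bar>y - x\<bar> \<Longrightarrow> \<bar>f (s, z) - c\<bar> \<le> B" for s x y c B
  proof (cases "x \<le> y")
    case True then show ?thesis using space1[of x y s c B] B by simp
  next
    case False
    then have "\<bar>F s x - F s y - c * (x - y)\<bar> \<le> B * (x - y)"
      by (intro space1) (auto intro!: B)
    then show ?thesis using False by (simp add: algebra_simps abs_if split: if_splits)
  qed
  show "\<bar>F s y - F t x\<bar> \<le> (2 * R + 1) * C * (\<bar>s - t\<bar> + \<bar>y - x\<bar>)" for s t x y
  proof -
    have "\<bar>F s y - F s x - 0 * (y - x)\<bar> \<le> C * \<bar>y - x\<bar>"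
      by (rule space) (use bd in auto)
    then have "\<bar>F s y - F t x\<bar> \<le> 2 * R * C * \<bar>s - t\<bar> + C * \<bar>y - x\<bar>" using time(1)[of s x t] by linarith
    also have "\<dots> \<le> (2 * R + 1) * C * (\<bar>s - t\<bar> + \<bar>y - x\<bar>)"
      using R C by (simp add: algebra_simps)
    finally show ?thesis .
  qed
  show "\<bar>F s y - F t x - (s - t) * Ft t x - f (t, x) * (y - x)\<bar> \<le> (2 * R + 2) * C * ((s - t)\<^sup>2 + (y - x)\<^sup>2)" for s t x y
  proof -
    have "\<bar>F s y - F s x - f (t, x) * (y - x)\<bar> \<le> (C * (\<bar>s - t\<bar> + \<bar>y - x\<bar>)) * \<bar>y - x\<bar>"
    proof (rule space)
      fix z assume z: "\<bar>z - x\<bar> \<le> \<bar>y - x\<bar>"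
      have "\<bar>f (s, z) - f (t, x)\<bar> \<le> C * (\<bar>s - t\<bar> + \<bar>z - x\<bar>)" by (rule lip)
      also have "\<dots> \<le> C * (\<bar>s - t\<bar> + \<bar>y - x\<bar>)" using z C by (intro mult_left_mono) auto
      finally show "\<bar>f (s, z) - f (t, x)\<bar> \<le> C * (\<bar>s - t\<bar> + \<bar>y - x\<bar>)" .
    qed
    also have "\<dots> = C * (\<bar>s - t\<bar> * \<bar>y - x\<bar> + (y - x)\<^sup>2)"
      by (simp add: algebra_simps power2_eq_square flip: abs_mult)
    \<comment> \<open>The mixed term is absorbed by 2 a b \<le> a a + b b. The resulting 2 C joins
      the 2 R C from the expansion in time to form (2 R + 2) C.\<close>
    also have "\<dots> \<le> C * (2 * ((s - t)\<^sup>2 + (y - x)\<^sup>2))"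
    proof (rule mult_left_mono[OF _ C])
      have *: "2 * (\<bar>s - t\<bar> * \<bar>y - x\<bar>) \<le> (s - t)\<^sup>2 + (y - x)\<^sup>2"
        using sum_squares_bound[of "\<bar>s - t\<bar>" "\<bar>y - x\<bar>"] by (simp add: mult.assoc)
      show "\<bar>s - t\<bar> * \<bar>y - x\<bar> + (y - x)\<^sup>2 \<le> 2 * ((s - t)\<^sup>2 + (y - x)\<^sup>2)"
      proof -
        have "p + Y \<le> 2 * (S + Y)" if "2 * p \<le> S + Y" "0 \<le> S" "0 \<le> Y" for p S Y :: real
          using that by (simp add: algebra_simps)
        from this[OF *] show ?thesis by simp
      qed
    qed
    finally have "\<bar>F s y - F t x - (s - t) * Ft t x - f (t, x) * (y - x)\<bar> \<le>
      2 * R * C * (s - t)\<^sup>2 + C * (2 * ((s - t)\<^sup>2 + (y - x)\<^sup>2))" using time(2)[of s x t] by linarith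
    also have "\<dots> \<le> (2 * R + 2) * C * ((s - t)\<^sup>2 + (y - x)\<^sup>2)"
      using R C by (simp add: algebra_simps)
    finally show ?thesis .
  qed
  have [measurable]: "f \<in> borel_measurable (borel \<Otimes>\<^sub>M borel)" "ft \<in> borel_measurable (borel \<Otimes>\<^sub>M borel)"
    using cont by (auto simp: borel_prod intro: borel_measurable_continuous_onI)
  have eq: "indicator {x..} y *\<^sub>R g (t, y) = (if x \<le> y then g (t, y) else 0)" for x y t and g :: "real \<times> real \<Rightarrow> real"
    by (simp add: indicator_def)
  show "(\<lambda>(t, x). F t x) \<in> borel_measurable (borel \<Otimes>\<^sub>M borel)"
    "(\<lambda>(t, x). Ft t x) \<in> borel_measurable (borel \<Otimes>\<^sub>M borel)"
    unfolding F_def Ft_def set_lebesgue_integral_def eq by measurable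
qed

section \<open>Curves in the cone\<close>

lemma cone_K_D:
  assumes "Y \<in> cone_K"
  shows "Y \<in> L2 leb_Omega" "mono_on Omega Y" "m \<in> Omega \<Longrightarrow> continuous (at_right m) Y"
    "Y \<in> borel_measurable leb_Omega" "integrable leb_Omega Y"
proof -
  show "Y \<in> L2 leb_Omega" "mono_on Omega Y" "m \<in> Omega \<Longrightarrow> continuous (at_right m) Y"
    using assms unfolding cone_K_def by blast+
  then show "Y \<in> borel_measurable leb_Omega" "integrable leb_Omega Y"
    using L2_measurable leb_Omega.L2_integrable by blast+
qed

lemma leb_Omega_integrable_bounded:
  fixes u :: "real \<Rightarrow> real"
  assumes "u \<in> borel_measurable leb_Omega" "\<And>m. m \<in> Omega \<Longrightarrow> \<bar>u m\<bar> \<le> B"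
  shows "integrable leb_Omega u"
  using assms by (intro leb_Omega.integrable_const_bound[of _ B]) (auto intro!: AE_I2)

lemma integrable_indicator_leb_Omega:
  fixes u :: "real \<Rightarrow> real"
  assumes u: "integrable leb_Omega u" and S: "S \<in> sets borel"
  shows "integrable leb_Omega (\<lambda>\<omega>. indicator S \<omega> * u \<omega>)"
proof (rule Bochner_Integration.integrable_bound[OF u])
  show "(\<lambda>\<omega>. indicator S \<omega> * u \<omega>) \<in> borel_measurable leb_Omega"
    by (rule borel_measurable_times[OF measurable_leb_Omega_borel[OF borel_measurable_indicator[OF S]]
          borel_measurable_integrable[OF u]])
qed (auto simp: indicator_def)

lemma integral_abs_diff_le_L2_dist:
  assumes "u \<in> L2 leb_Omega" "v \<in> L2 leb_Omega"
  shows "(LINT m|leb_Omega. \<bar>v m - u m\<bar>) \<le> L2_dist leb_Omega u v"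
  using leb_Omega.L1_le_L2[OF L2_diff[OF assms]] by (simp add: L2_dist_def abs_minus_commute)

text \<open>The L2 distance travelled from time 0 is at most the integral of the dominating
  function, and it bounds the growth of the first moment. This is what makes the interaction term
  bounded uniformly in time.\<close>

lemma curve_L1_bound:
  assumes "\<And>t. t \<ge> 0 \<Longrightarrow> X t \<in> cone_K" "abs_continuous_curve (L2_dist leb_Omega) 0 T X"
  obtains B where "0 \<le> B" "\<And>t. t \<in> {0..T} \<Longrightarrow> (LINT m|leb_Omega. \<bar>X t m\<bar>) \<le> B"
proof -
  obtain g where g: "set_integrable lborel {0..T} g" "\<And>r. 0 \<le> g r"
    "\<And>s t. 0 \<le> s \<Longrightarrow> s \<le> t \<Longrightarrow> t \<le> T \<Longrightarrow> L2_dist leb_Omega (X s) (X t) \<le> (LINT r:{s..t}|lborel. g r)"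
    using abs_continuous_curve_nonneg[OF assms(2)] by blast
  define G where "G = (LINT r:{0..T}|lborel. g r)"
  have "0 \<le> G" unfolding G_def set_lebesgue_integral_def by (intro integral_nonneg_AE AE_I2) (auto simp: g)
  show thesis
  proof
    show "0 \<le> (LINT m|leb_Omega. \<bar>X 0 m\<bar>) + G" using \<open>0 \<le> G\<close> by simp
    fix t assume t: "t \<in> {0..T}"
    note K = cone_K_D[OF assms(1)]
    have "(LINT m|leb_Omega. \<bar>X t m\<bar>) \<le> (LINT m|leb_Omega. \<bar>X 0 m\<bar> + \<bar>X t m - X 0 m\<bar>)"
      by (rule integral_mono) (use t K(5) in \<open>auto intro!: Bochner_Integration.integrable_add integrable_abs Bochner_Integration.integrable_diff\<close>)
    also have "\<dots> = (LINT m|leb_Omega. \<bar>X 0 m\<bar>) + (LINT m|leb_Omega. \<bar>X t m - X 0 m\<bar>)"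
      by (rule Bochner_Integration.integral_add) (use t K(5) in auto)
    also have "(LINT m|leb_Omega. \<bar>X t m - X 0 m\<bar>) \<le> L2_dist leb_Omega (X 0) (X t)"
      by (rule integral_abs_diff_le_L2_dist) (use t K(1) in auto)
    also have "\<dots> \<le> (LINT r:{0..t}|lborel. g r)" using g(3)[of 0 t] t by simp
    also have "\<dots> \<le> G"
      unfolding G_def set_lebesgue_integral_def
    proof (rule integral_mono)
      show "integrable lborel (\<lambda>x. indicator {0..t} x *\<^sub>R g x)"
        using set_integrable_subset[OF g(1), of "{0..t}"] t by (auto simp: set_integrable_def)
    qed (use g t in \<open>auto simp: set_integrable_def indicator_def\<close>)
    finally show "(LINT m|leb_Omega. \<bar>X t m\<bar>) \<le> (LINT m|leb_Omega. \<bar>X 0 m\<bar>) + G" by simp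
  qed
qed

text \<open>An absolutely continuous function is a difference of two monotone ones.\<close>

lemma abs_continuous_curve_borel:
  fixes r :: "real \<Rightarrow> real"
  assumes "abs_continuous_curve dist a b r"
  shows "r \<in> borel_measurable (restrict_space borel {a..b})"
proof -
  obtain g where g: "set_integrable lborel {a..b} g" "\<And>z. 0 \<le> g z"
    and inc: "\<And>s t. a \<le> s \<Longrightarrow> s \<le> t \<Longrightarrow> t \<le> b \<Longrightarrow> dist (r s) (r t) \<le> (LINT z:{s..t}|lborel. g z)"
    using abs_continuous_curve_nonneg[OF assms] by blast
  have gi: "set_integrable lborel {a<..<b} g"
    by (rule set_integrable_subset[OF g(1)]) auto
  define F where "F y = (LINT z:{a<..<y}|lborel. g z)" for y
  have F: "dist (r s) (r t) \<le> F t - F s" if "a \<le> s" "s \<le> t" "t \<le> b" for s t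
    using inc[OF that] set_integral_interval_diff(1)[OF gi that] by (simp add: F_def)
  have F1: "mono_on {a..b} F" and F2: "mono_on {a..b} (\<lambda>t. F t + r t)"
  proof -
    show "mono_on {a..b} F"
    proof (rule mono_onI)
      fix s t assume "s \<in> {a..b}" "t \<in> {a..b}" "s \<le> t"
      then have "0 \<le> F t - F s" by (intro order_trans[OF zero_le_dist F]) auto
      then show "F s \<le> F t" by simp
    qed
    show "mono_on {a..b} (\<lambda>t. F t + r t)"
    proof (rule mono_onI)
      fix s t assume "s \<in> {a..b}" "t \<in> {a..b}" "s \<le> t"
      then have "\<bar>r s - r t\<bar> \<le> F t - F s" using F[of s t] by (simp add: dist_real_def)
      then show "F s + r s \<le> F t + r t" by linarith
    qed
  qed
  have "(\<lambda>t. (F t + r t) - F t) \<in> borel_measurable (restrict_space borel {a..b})"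
    using borel_measurable_mono_on_fnc[OF F1] borel_measurable_mono_on_fnc[OF F2] by (rule borel_measurable_diff[rotated])
  then show ?thesis by simp
qed

text \<open>Continuity of the curve in L2 says nothing about single values \<open>X t m\<close>, but
  averages over a window are L2-continuous. Monotonicity places the average over (m, m + d) between
  Y m and Y (m + d), and right continuity closes the gap.\<close>

lemma cone_K_right_average:
  assumes Y: "Y \<in> cone_K" and m: "m \<in> Omega"
  shows "(\<lambda>n. real (Suc n) * (LINT \<omega>|leb_Omega. indicator {m<..<m + 1 / real (Suc n)} \<omega> * Y \<omega>)) \<longlonglongrightarrow> Y m"
proof (rule tendsto_sandwich[of "\<lambda>_. Y m" _ _ "\<lambda>n. Y (m + 1 / real (Suc n))"])
  note K = cone_K_D[OF Y]
  let ?\<delta> = "\<lambda>n. 1 / real (Suc n)"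
  have \<delta>0: "?\<delta> \<longlonglongrightarrow> 0" by (rule LIMSEQ_inverse_real_of_nat[unfolded inverse_eq_divide])
  have lim: "(\<lambda>n. m + ?\<delta> n) \<longlonglongrightarrow> m" using tendsto_add[OF tendsto_const \<delta>0, of m] by simp
  then have "filterlim (\<lambda>n. m + ?\<delta> n) (at_right m) sequentially"
    unfolding filterlim_at by (intro conjI always_eventually allI) (simp_all del: of_nat_Suc)
  moreover have "(Y \<longlongrightarrow> Y m) (at_right m)" using K(3)[OF m] by (simp add: continuous_within)
  ultimately show "(\<lambda>n. Y (m + ?\<delta> n)) \<longlonglongrightarrow> Y m" by (rule filterlim_compose[rotated])
  have ev: "\<forall>\<^sub>F n in sequentially. m + ?\<delta> n < 1"
    using m by (intro order_tendstoD[OF lim]) (auto simp: Omega_def)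
  have ind: "(LINT \<omega>|leb_Omega. indicator {m<..<m + d} \<omega> * c) = d * c" if "m + d < 1" "0 < d" for d c :: real
  proof -
    have "(LINT \<omega>|leb_Omega. indicator {m<..<m + d} \<omega> * c) = (LINT \<omega>|lborel. indicator {m<..<m+d} \<omega> * c)"
      unfolding integral_leb_Omega set_lebesgue_integral_def
      using that m by (intro Bochner_Integration.integral_cong) (auto simp: indicator_def Omega_def)
    then show ?thesis using that by simp
  qed
  note ii = integrable_indicator_leb_Omega
  show "\<forall>\<^sub>F n in sequentially. Y m \<le> real (Suc n) * (LINT \<omega>|leb_Omega. indicator {m<..<m + ?\<delta> n} \<omega> * Y \<omega>)"
    using ev
  proof eventually_elim
    case (elim n)
    have "?\<delta> n * Y m = (LINT \<omega>|leb_Omega. indicator {m<..<m + ?\<delta> n} \<omega> * Y m)"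
      using ind[OF elim] by simp
    also have "\<dots> \<le> (LINT \<omega>|leb_Omega. indicator {m<..<m + ?\<delta> n} \<omega> * Y \<omega>)"
    proof (rule integral_mono)
      show "integrable leb_Omega (\<lambda>\<omega>. indicator {m<..<m + ?\<delta> n} \<omega> * Y m)"
        "integrable leb_Omega (\<lambda>\<omega>. indicator {m<..<m + ?\<delta> n} \<omega> * Y \<omega>)"
        by (rule ii; simp add: K(5))+
      show "indicator {m<..<m + ?\<delta> n} \<omega> * Y m \<le> indicator {m<..<m + ?\<delta> n} \<omega> * Y \<omega>" if "\<omega> \<in> space leb_Omega" for \<omega>
        using mono_onD[OF K(2) m, of \<omega>] that by (auto simp: indicator_def)
    qed
    finally show ?case by (simp add: field_simps)
  qed
  show "\<forall>\<^sub>F n in sequentially. real (Suc n) * (LINT \<omega>|leb_Omega. indicator {m<..<m + ?\<delta> n} \<omega> * Y \<omega>) \<le> Y (m + ?\<delta> n)"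
    using ev
  proof eventually_elim
    case (elim n)
    have in\<Omega>: "m + ?\<delta> n \<in> Omega" using elim m by (auto simp: Omega_def add_pos_pos)
    have "(LINT \<omega>|leb_Omega. indicator {m<..<m + ?\<delta> n} \<omega> * Y \<omega>) \<le> (LINT \<omega>|leb_Omega. indicator {m<..<m + ?\<delta> n} \<omega> * Y (m + ?\<delta> n))"
    proof (rule integral_mono)
      show "integrable leb_Omega (\<lambda>\<omega>. indicator {m<..<m + ?\<delta> n} \<omega> * Y \<omega>)"
        "integrable leb_Omega (\<lambda>\<omega>. indicator {m<..<m + ?\<delta> n} \<omega> * Y (m + ?\<delta> n))"
        by (rule ii; simp add: K(5))+
      show "indicator {m<..<m + ?\<delta> n} \<omega> * Y \<omega> \<le> indicator {m<..<m + ?\<delta> n} \<omega> * Y (m + ?\<delta> n)" if "\<omega> \<in> space leb_Omega" for \<omega>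
        using mono_onD[OF K(2) _ in\<Omega>, of \<omega>] that by (simp add: indicator_def)
    qed
    also have "\<dots> = ?\<delta> n * Y (m + ?\<delta> n)" using ind[OF elim] by simp
    finally show ?case by (simp add: field_simps)
  qed
qed (rule tendsto_const)

text \<open>Right continuity in the mass variable reduces joint measurability to measurability in time.\<close>

lemma curve_measurable_pair:
  assumes cone: "\<And>t. t \<ge> 0 \<Longrightarrow> X t \<in> cone_K"
    and ac: "abs_continuous_curve (L2_dist leb_Omega) 0 T X" and "0 \<le> T"
  shows "(\<lambda>(t, m). X (max 0 (min T t)) m) \<in> borel_measurable (borel \<Otimes>\<^sub>M leb_Omega)"
proof -
  \<comment> \<open>Clamping time to [0, T] gives a function on the whole line while using the curve
    only where it is known to lie in the cone.\<close>
  define c where "c t = max 0 (min T t)" for t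
  have c: "c t \<in> {0..T}" for t using \<open>0 \<le> T\<close> by (auto simp: c_def)
  have cm: "c \<in> borel \<rightarrow>\<^sub>M restrict_space borel {0..T}"
    using c by (intro measurable_restrict_space2) (auto simp: c_def[abs_def])
  note K = cone_K_D[OF cone]
  \<comment> \<open>For a fixed mass, \<open>X (c t) m\<close> is a limit of window averages, each
    of which is absolutely continuous in time and hence Borel.\<close>
  have time: "(\<lambda>t. X (c t) m) \<in> borel_measurable borel" if m: "m \<in> Omega" for m
  proof (rule borel_measurable_LIMSEQ_real)
    show "(\<lambda>n. real (Suc n) * (LINT \<omega>|leb_Omega. indicator {m<..<m + 1 / real (Suc n)} \<omega> * X (c t) \<omega>)) \<longlonglongrightarrow> X (c t) m" for t
      using c[of t] by (intro cone_K_right_average cone m) auto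
    fix n
    let ?I = "\<lambda>t. LINT \<omega>|leb_Omega. indicator {m<..<m + 1 / real (Suc n)} \<omega> * X t \<omega>"
    note ii = integrable_indicator_leb_Omega
    have "abs_continuous_curve dist 0 T ?I"
    proof (rule abs_continuous_curve_bound[OF ac ac, where K=1 and L=0])
      fix s t assume st: "0 \<le> s" "s \<le> t" "t \<le> T"
      have "?I t - ?I s = (LINT \<omega>|leb_Omega. indicator {m<..<m + 1 / real (Suc n)} \<omega> * (X t \<omega> - X s \<omega>))"
        unfolding right_diff_distrib by (rule Bochner_Integration.integral_diff[symmetric]) (use st K(5) in \<open>auto intro!: ii\<close>)
      then have "\<bar>?I t - ?I s\<bar> \<le> (LINT \<omega>|leb_Omega. \<bar>indicator {m<..<m + 1 / real (Suc n)} \<omega> * (X t \<omega> - X s \<omega>)\<bar>)"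
        by (simp only: integral_abs_bound)
      also have "\<dots> \<le> (LINT \<omega>|leb_Omega. \<bar>X t \<omega> - X s \<omega>\<bar>)"
      proof (rule integral_mono)
        have i: "integrable leb_Omega (\<lambda>\<omega>. X t \<omega> - X s \<omega>)" using st K(5) by auto
        show "integrable leb_Omega (\<lambda>\<omega>. \<bar>indicator {m<..<m + 1 / real (Suc n)} \<omega> * (X t \<omega> - X s \<omega>)\<bar>)"
          by (intro integrable_abs ii i) simp
        show "integrable leb_Omega (\<lambda>\<omega>. \<bar>X t \<omega> - X s \<omega>\<bar>)" using i by (rule integrable_abs)
      qed (simp add: indicator_def)
      also have "\<dots> \<le> L2_dist leb_Omega (X s) (X t)"
        by (rule integral_abs_diff_le_L2_dist) (use st K(1) in auto)
      finally show "dist (?I s) (?I t) \<le> 1 * L2_dist leb_Omega (X s) (X t) + 0 * L2_dist leb_Omega (X s) (X t)"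
        by (simp add: dist_real_def abs_minus_commute)
    qed auto
    then have "?I \<in> borel_measurable (restrict_space borel {0..T})" by (rule abs_continuous_curve_borel)
    then have "(\<lambda>t. ?I (c t)) \<in> borel_measurable borel" by (rule measurable_compose[OF cm])
    then show "(\<lambda>t. real (Suc n) * ?I (c t)) \<in> borel_measurable borel" by (rule borel_measurable_times[OF borel_measurable_const])
  qed
  \<comment> \<open>The first point of the grid of mesh 1 / (n + 1) strictly to the right of m; the
    added 1 makes the approach one-sided, as right continuity requires.\<close>
  define k where "k n m = (real_of_int \<lfloor>real (Suc n) * m\<rfloor> + 1) / real (Suc n)" for n m
  have k: "m < k n m" "k n m \<le> m + 1 / real (Suc n)" for n m
    unfolding k_def by (simp_all add: field_simps del: of_nat_Suc) linarith+
  \<comment> \<open>Indexed by the integer grid position, so that only countably many measurable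
    functions of time are pieced together. The value 0 covers grid points outside
    \<open>Omega\<close>; for a given m the point \<open>k n m\<close> is one of these for finitely
    many n only.\<close>
  define Y where "Y n t i = (if (real_of_int i + 1) / real (Suc n) \<in> Omega then X (c t) ((real_of_int i + 1) / real (Suc n)) else 0)" for n t i
  have Ym: "(\<lambda>t. Y n t i) \<in> borel_measurable borel" for n i
    unfolding Y_def by (cases "(real_of_int i + 1) / real (Suc n) \<in> Omega") (auto intro!: time)
  have "(\<lambda>p. X (c (fst p)) (snd p)) \<in> borel_measurable (borel \<Otimes>\<^sub>M leb_Omega)"
  proof (rule borel_measurable_LIMSEQ_real)
    fix p :: "real \<times> real" assume "p \<in> space (borel \<Otimes>\<^sub>M leb_Omega)"
    then have m: "snd p \<in> Omega" by (auto simp: space_pair_measure)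
    let ?m = "snd p"
    have d0: "(\<lambda>n. 1 / real (Suc n)) \<longlonglongrightarrow> 0" by (rule LIMSEQ_inverse_real_of_nat[unfolded inverse_eq_divide])
    have lim: "(\<lambda>n. k n ?m) \<longlonglongrightarrow> ?m"
    proof (rule tendsto_sandwich[of "\<lambda>_. ?m" _ _ "\<lambda>n. ?m + 1 / real (Suc n)"])
      show "\<forall>\<^sub>F n in sequentially. ?m \<le> k n ?m" using k(1) by (auto intro!: always_eventually less_imp_le)
      show "\<forall>\<^sub>F n in sequentially. k n ?m \<le> ?m + 1 / real (Suc n)" using k(2) by (intro always_eventually) blast
      show "(\<lambda>n. ?m + 1 / real (Suc n)) \<longlonglongrightarrow> ?m" using tendsto_add[OF tendsto_const d0, of ?m] by simp
    qed (rule tendsto_const)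
    then have "filterlim (\<lambda>n. k n ?m) (at_right ?m) sequentially"
      unfolding filterlim_at using k(1) by (auto intro!: always_eventually simp: less_imp_neq[symmetric])
    moreover have "(X (c (fst p)) \<longlongrightarrow> X (c (fst p)) ?m) (at_right ?m)"
      using K(3)[OF _ m, of "c (fst p)"] c[of "fst p"] by (simp add: continuous_within)
    ultimately have "(\<lambda>n. X (c (fst p)) (k n ?m)) \<longlonglongrightarrow> X (c (fst p)) ?m" by (rule filterlim_compose[rotated])
    moreover have "\<forall>\<^sub>F n in sequentially. X (c (fst p)) (k n ?m) = Y n (fst p) \<lfloor>real (Suc n) * ?m\<rfloor>"
    proof -
      have "\<forall>\<^sub>F n in sequentially. k n ?m < 1"
        using m by (intro order_tendstoD[OF lim]) (auto simp: Omega_def)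
      then show ?thesis
      proof eventually_elim
        case (elim n)
        then have "k n ?m \<in> Omega" using k(1)[of ?m n] m by (auto simp: Omega_def)
        then show ?case by (simp add: Y_def k_def)
      qed
    qed
    ultimately show "(\<lambda>n. Y n (fst p) \<lfloor>real (Suc n) * snd p\<rfloor>) \<longlonglongrightarrow> X (c (fst p)) (snd p)"
      by (rule Lim_transform_eventually)
  next
    fix n
    have sm: "snd \<in> borel_measurable (borel \<Otimes>\<^sub>M leb_Omega)"
      using measurable_compose[OF measurable_snd measurable_leb_Omega_borel[of "\<lambda>x. x"]] by simp
    show "(\<lambda>p. Y n (fst p) \<lfloor>real (Suc n) * snd p\<rfloor>) \<in> borel_measurable (borel \<Otimes>\<^sub>M leb_Omega)"
    proof (rule measurable_compose_countable[where f="\<lambda>i p. Y n (fst p) i"])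
      show "(\<lambda>p. Y n (fst p) i) \<in> borel_measurable (borel \<Otimes>\<^sub>M leb_Omega)" for i
        by (rule measurable_compose[OF measurable_fst Ym])
      show "(\<lambda>p. \<lfloor>real (Suc n) * snd p\<rfloor>) \<in> borel \<Otimes>\<^sub>M leb_Omega \<rightarrow>\<^sub>M count_space UNIV"
        using sm by measurable
    qed
  qed
  then show ?thesis by (simp add: c_def case_prod_beta')
qed

text \<open>Split the error of the difference quotient. With u the difference quotient of the curve,
  the Taylor remainder contributes at most K |s - t| (1 + u u), and replacing u by \<open>D\<close>
  contributes at most C |u - D|. Since u tends to \<open>D\<close> in L2, the integral of u u stays
  bounded, so the first part vanishes through its factor |s - t|, and the second vanishes in
  L1.\<close>

lemma L2_derivative_functional:
  fixes F Ft :: "real \<Rightarrow> real \<Rightarrow> real" and f :: "real \<times> real \<Rightarrow> real"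
  assumes h: "h \<in> borel_measurable leb_Omega" "\<And>m. m \<in> Omega \<Longrightarrow> \<bar>h m\<bar> \<le> L"
    and F: "\<And>t. F t \<in> borel_measurable borel" "\<And>t x. \<bar>F t x\<bar> \<le> K"
    and Ft: "\<And>t. Ft t \<in> borel_measurable borel" "\<And>t x. \<bar>Ft t x\<bar> \<le> K"
    and f: "\<And>t. (\<lambda>x. f (t, x)) \<in> borel_measurable borel" "\<And>z. \<bar>f z\<bar> \<le> C"
    and exp: "\<And>s t x y. \<bar>F s y - F t x - (s - t) * Ft t x - f (t, x) * (y - x)\<bar> \<le> K * ((s - t)\<^sup>2 + (y - x)\<^sup>2)"
    and X: "\<And>t. t \<ge> 0 \<Longrightarrow> X t \<in> L2 leb_Omega" and t: "t > 0" and D: "has_L2_derivative X D t"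
  shows "((\<lambda>s. LINT m|leb_Omega. h m * F s (X s m)) has_real_derivative
      (LINT m|leb_Omega. h m * (Ft t (X t m) + f (t, X t m) * D m))) (at t)"
proof -
  define E where "E s = (LINT m|leb_Omega. h m * F s (X s m))" for s
  define E' where "E' = (LINT m|leb_Omega. h m * (Ft t (X t m) + f (t, X t m) * D m))"
  define u where "u s m = (X s m - X t m) / (s - t)" for s m
  define Q where "Q s = L2_dist leb_Omega (u s) D" for s
  have DL: "D \<in> L2 leb_Omega" and Q0: "(Q \<longlongrightarrow> 0) (at t)"
  proof -
    have "Q = (\<lambda>s. L2_dist leb_Omega (\<lambda>m. (X s m - X t m) / (s - t)) D)"
      by (simp add: fun_eq_iff Q_def u_def[abs_def])
    then show "D \<in> L2 leb_Omega" "(Q \<longlongrightarrow> 0) (at t)"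
      using D unfolding has_L2_derivative_def by simp_all
  qed
  obtain m0 where "m0 \<in> Omega" by (auto simp: Omega_def intro: that[of "1/2"])
  then have L0: "0 \<le> L" using h(2)[of m0] by linarith
  have K0: "0 \<le> K" using F(2)[of 0 0] by linarith
  have C0: "0 \<le> C" using f(2)[of "(0,0)"] by linarith
  define S where "S = (LINT m|leb_Omega. (D m)\<^sup>2)"
  \<comment> \<open>The integrated bound: \<open>Q s\<close> is the L2 distance from the difference
    quotient to \<open>D\<close>, and the bracket bounds the integral of 1 + u u.\<close>
  define B where "B s = L * (K * \<bar>s - t\<bar> * (1 + 2 * (Q s)\<^sup>2 + 2 * S) + C * Q s)" for s
  have bound: "\<bar>(E s - E t) / (s - t) - E'\<bar> \<le> B s" if s: "0 \<le> s" "s \<noteq> t" for s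
  proof -
    have Xm[measurable]: "X s \<in> borel_measurable leb_Omega" "X t \<in> borel_measurable leb_Omega" "D \<in> borel_measurable leb_Omega"
      using X[of s] X[of t] s t DL by (auto dest: L2_measurable)
    note [measurable] = h(1) measurable_compose[OF _ F(1)] measurable_compose[OF _ Ft(1)] measurable_compose[OF _ f(1)]
    have iF: "integrable leb_Omega (\<lambda>m. h m * F r (X r m))" if "r = s \<or> r = t" for r
      using that by (intro leb_Omega_integrable_bounded[where B="L * K"])
        (auto simp: abs_mult intro!: mult_mono h F L0)
    have iD: "integrable leb_Omega D" by (rule leb_Omega.L2_integrable[OF DL])
    have iD': "integrable leb_Omega (\<lambda>m. h m * (Ft t (X t m) + f (t, X t m) * D m))"
    proof (rule Bochner_Integration.integrable_bound)
      show "integrable leb_Omega (\<lambda>m. L * (K + C * \<bar>D m\<bar>))" using iD by auto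
      show "AE m in leb_Omega. norm (h m * (Ft t (X t m) + f (t, X t m) * D m)) \<le> norm (L * (K + C * \<bar>D m\<bar>))"
      proof (rule AE_I2)
        fix m assume m: "m \<in> space leb_Omega"
        have "\<bar>Ft t (X t m) + f (t, X t m) * D m\<bar> \<le> \<bar>Ft t (X t m)\<bar> + \<bar>f (t, X t m)\<bar> * \<bar>D m\<bar>"
          by (metis abs_mult abs_triangle_ineq)
        also have "\<dots> \<le> K + C * \<bar>D m\<bar>" by (intro add_mono mult_right_mono Ft f) auto
        finally have "\<bar>h m * (Ft t (X t m) + f (t, X t m) * D m)\<bar> \<le> L * (K + C * \<bar>D m\<bar>)"
          using h(2)[of m] m L0 by (simp add: abs_mult mult_mono)
        then show "norm (h m * (Ft t (X t m) + f (t, X t m) * D m)) \<le> norm (L * (K + C * \<bar>D m\<bar>))" by simp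
      qed
    qed measurable
    have uL: "(\<lambda>m. u s m - D m) \<in> L2 leb_Omega"
      using L2_diff[OF L2_cmult[OF L2_diff[OF X[of s] X[of t]], of "1 / (s - t)"] DL] s t
      by (simp add: u_def)
    have Qsq: "(LINT m|leb_Omega. (u s m - D m)\<^sup>2) = (Q s)\<^sup>2"
      unfolding Q_def L2_dist_def by (subst real_sqrt_pow2) auto
    have Qab: "(LINT m|leb_Omega. \<bar>u s m - D m\<bar>) \<le> Q s"
      using leb_Omega.L1_le_L2[OF uL] by (simp add: Q_def L2_dist_def)
    let ?G = "\<lambda>m. h m * ((F s (X s m) - F t (X t m)) / (s - t) - (Ft t (X t m) + f (t, X t m) * D m))"
    have "(E s - E t) / (s - t) - E' = (LINT m|leb_Omega. (h m * F s (X s m) - h m * F t (X t m)) / (s - t)) - E'"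
      unfolding E_def by (subst Bochner_Integration.integral_diff[symmetric]) (auto intro!: iF)
    also have "\<dots> = (LINT m|leb_Omega. (h m * F s (X s m) - h m * F t (X t m)) / (s - t) - h m * (Ft t (X t m) + f (t, X t m) * D m))"
      unfolding E'_def by (rule Bochner_Integration.integral_diff[symmetric])
        (auto intro!: iF iD' integrable_divide Bochner_Integration.integrable_diff)
    also have "\<dots> = (LINT m|leb_Omega. ?G m)"
      by (rule Bochner_Integration.integral_cong) (auto simp: algebra_simps diff_divide_distrib)
    finally have "\<bar>(E s - E t) / (s - t) - E'\<bar> \<le> (LINT m|leb_Omega. \<bar>?G m\<bar>)"
      using integral_abs_bound[of leb_Omega ?G] by simp
    also have "\<dots> \<le> (LINT m|leb_Omega. L * (K * \<bar>s - t\<bar> * (1 + 2 * (u s m - D m)\<^sup>2 + 2 * (D m)\<^sup>2) + C * \<bar>u s m - D m\<bar>))"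
    proof (rule integral_mono')
      show "integrable leb_Omega (\<lambda>m. L * (K * \<bar>s - t\<bar> * (1 + 2 * (u s m - D m)\<^sup>2 + 2 * (D m)\<^sup>2) + C * \<bar>u s m - D m\<bar>))"
        using uL DL leb_Omega.L2_integrable[OF uL] by (auto simp: L2_def)
      fix m assume m: "m \<in> space leb_Omega"
      have us: "X s m - X t m = (s - t) * u s m" using s by (simp add: u_def)
      have "\<bar>(F s (X s m) - F t (X t m)) / (s - t) - (Ft t (X t m) + f (t, X t m) * u s m)\<bar> =
        \<bar>F s (X s m) - F t (X t m) - (s - t) * Ft t (X t m) - f (t, X t m) * (X s m - X t m)\<bar> / \<bar>s - t\<bar>"
        using s unfolding us by (simp add: field_simps flip: abs_divide)
      also have "\<dots> \<le> K * ((s - t)\<^sup>2 + (X s m - X t m)\<^sup>2) / \<bar>s - t\<bar>"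
        by (intro divide_right_mono exp) auto
      also have "\<dots> = K * \<bar>s - t\<bar> * (1 + (u s m)\<^sup>2)"
      proof -
        have sq: "(s - t)\<^sup>2 = \<bar>s - t\<bar> * \<bar>s - t\<bar>" by (simp add: power2_eq_square flip: abs_mult)
        have *: "K * (a * a + a * a * v) / a = K * a * (1 + v)" if "a \<noteq> 0" for a v
          using that by (simp add: field_simps)
        show ?thesis unfolding us power_mult_distrib sq by (rule *) (use s in simp)
      qed
      also have "\<dots> \<le> K * \<bar>s - t\<bar> * (1 + 2 * (u s m - D m)\<^sup>2 + 2 * (D m)\<^sup>2)"
      proof -
        \<comment> \<open>The parallelogram identity for u - D and D.\<close>
        have "(u s m)\<^sup>2 + (u s m - 2 * D m)\<^sup>2 = 2 * (u s m - D m)\<^sup>2 + 2 * (D m)\<^sup>2"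
          by (simp add: power2_eq_square algebra_simps)
        then have "(u s m)\<^sup>2 \<le> 2 * (u s m - D m)\<^sup>2 + 2 * (D m)\<^sup>2"
          using zero_le_power2[of "u s m - 2 * D m"] by linarith
        then show ?thesis using K0 by (intro mult_left_mono) auto
      qed
      finally have 1: "\<bar>(F s (X s m) - F t (X t m)) / (s - t) - (Ft t (X t m) + f (t, X t m) * u s m)\<bar>
        \<le> K * \<bar>s - t\<bar> * (1 + 2 * (u s m - D m)\<^sup>2 + 2 * (D m)\<^sup>2)" .
      have 2: "\<bar>f (t, X t m) * u s m - f (t, X t m) * D m\<bar> \<le> C * \<bar>u s m - D m\<bar>"
        unfolding right_diff_distrib[symmetric] abs_mult by (intro mult_right_mono f) auto
      have "\<bar>(F s (X s m) - F t (X t m)) / (s - t) - (Ft t (X t m) + f (t, X t m) * D m)\<bar>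
        \<le> K * \<bar>s - t\<bar> * (1 + 2 * (u s m - D m)\<^sup>2 + 2 * (D m)\<^sup>2) + C * \<bar>u s m - D m\<bar>"
        using 1 2 by linarith
      then show "\<bar>?G m\<bar> \<le> L * (K * \<bar>s - t\<bar> * (1 + 2 * (u s m - D m)\<^sup>2 + 2 * (D m)\<^sup>2) + C * \<bar>u s m - D m\<bar>)"
        unfolding abs_mult[of "h m"] using h(2)[of m] m L0 by (intro mult_mono) auto
      show "0 \<le> L * (K * \<bar>s - t\<bar> * (1 + 2 * (u s m - D m)\<^sup>2 + 2 * (D m)\<^sup>2) + C * \<bar>u s m - D m\<bar>)"
        using L0 K0 C0 by simp
    qed
    also have "\<dots> = L * (K * \<bar>s - t\<bar> * (1 + 2 * (Q s)\<^sup>2 + 2 * S) + C * (LINT m|leb_Omega. \<bar>u s m - D m\<bar>))"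
    proof -
      have i: "integrable leb_Omega (\<lambda>m. (u s m - D m)\<^sup>2)" "integrable leb_Omega (\<lambda>m. (D m)\<^sup>2)" "integrable leb_Omega (\<lambda>m. \<bar>u s m - D m\<bar>)"
        using uL DL leb_Omega.L2_integrable[OF uL] by (auto simp: L2_def)
      have "(LINT m|leb_Omega. 1 + 2 * (u s m - D m)\<^sup>2 + 2 * (D m)\<^sup>2) = 1 + 2 * (Q s)\<^sup>2 + 2 * S"
        using i by (simp add: Qsq S_def leb_Omega.prob_space[simplified])
      moreover have "(LINT m|leb_Omega. K * \<bar>s - t\<bar> * (1 + 2 * (u s m - D m)\<^sup>2 + 2 * (D m)\<^sup>2) + C * \<bar>u s m - D m\<bar>) =
         (LINT m|leb_Omega. K * \<bar>s - t\<bar> * (1 + 2 * (u s m - D m)\<^sup>2 + 2 * (D m)\<^sup>2)) + (LINT m|leb_Omega. C * \<bar>u s m - D m\<bar>)"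
        using i by (intro Bochner_Integration.integral_add) auto
      ultimately show ?thesis by simp
    qed
    also have "\<dots> \<le> B s"
      unfolding B_def using Qab L0 C0 by (intro mult_left_mono add_left_mono) auto
    finally show ?thesis .
  qed
  have "(B \<longlongrightarrow> L * (K * \<bar>t - t\<bar> * (1 + 2 * 0\<^sup>2 + 2 * S) + C * 0)) (at t)"
    unfolding B_def by (intro tendsto_intros Q0)
  then have B0: "(B \<longlongrightarrow> 0) (at t)" by simp
  have "\<forall>\<^sub>F s in at t. norm ((E s - E t) / (s - t) - E') \<le> B s"
  proof -
    \<comment> \<open>The derivative is two-sided, but the curve is controlled only at nonnegative
      times; t > 0 leaves room on both sides.\<close>
    have "\<forall>\<^sub>F s in at t. 0 < s" using order_tendstoD(1)[OF tendsto_ident_at t] .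
    moreover have "\<forall>\<^sub>F s in at t. s \<noteq> t" by (simp add: eventually_at_filter)
    ultimately show ?thesis by eventually_elim (use bound in auto)
  qed
  then have "((\<lambda>s. (E s - E t) / (s - t) - E') \<longlongrightarrow> 0) (at t)"
    by (rule Lim_null_comparison[OF _ B0])
  then show ?thesis
    unfolding has_field_derivative_iff E_def E'_def by (rule LIM_zero_cancel)
qed

text \<open>For small \<open>\<epsilon>\<close> the perturbation \<open>Y + \<epsilon> h p(Y)\<close> stays nondecreasing, hence is admissible in the
  variational inequality.\<close>

lemma subdiff_K_test:
  fixes p :: "real \<Rightarrow> real"
  assumes Y: "Y \<in> cone_K" and W: "W \<in> subdiff_K Y"
    and h: "mono_on Omega h" "\<And>m. m \<in> Omega \<Longrightarrow> \<bar>h m\<bar> \<le> L" "\<And>m. m \<in> Omega \<Longrightarrow> continuous (at_right m) h"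
    and p: "\<And>x. 0 \<le> p x" "\<And>x. p x \<le> C" "\<And>x y. \<bar>p y - p x\<bar> \<le> C * \<bar>y - x\<bar>"
  shows "(LINT m|leb_Omega. W m * (h m * p (Y m))) \<le> 0"
proof -
  note K = cone_K_D[OF Y]
  obtain m0 where "m0 \<in> Omega" by (auto simp: Omega_def intro: that[of "1/2"])
  then have L0: "0 \<le> L" using h(2)[of m0] by linarith
  have C0: "0 \<le> C" using p(1)[of 0] p(2)[of 0] by linarith
  \<comment> \<open>\<open>L * C\<close> bounds the slope at which the perturbation can decrease
    relative to \<open>Y\<close>, and \<epsilon> times this slope must not exceed 1. The summand 1
    keeps the quotient defined when the product is zero.\<close>
  define \<epsilon> where "\<epsilon> = 1 / (1 + L * C)"
  have e: "\<epsilon> > 0" "\<epsilon> * (L * C) \<le> 1" using L0 C0 by (auto simp: \<epsilon>_def field_simps add_pos_nonneg)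
  have cont: "continuous_on UNIV p"
  proof (rule lipschitz_on_continuous_on)
    show "C-lipschitz_on UNIV p" using p(3) C0 by (auto simp: lipschitz_on_def dist_real_def)
  qed
  have hm[measurable]: "h \<in> borel_measurable leb_Omega" by (rule mono_on_borel_measurable_leb_Omega[OF h(1)])
  have pm[measurable]: "(\<lambda>m. p (Y m)) \<in> borel_measurable leb_Omega"
    using K(4) borel_measurable_continuous_onI[OF cont] by measurable
  define Z where "Z m = Y m + \<epsilon> * (h m * p (Y m))" for m
  have "Z \<in> cone_K"
    unfolding cone_K_def
  proof (intro CollectI conjI ballI)
    have "(\<lambda>m. h m * p (Y m)) \<in> L2 leb_Omega"
    proof (rule leb_Omega.L2_bounded)
      show "\<bar>h m * p (Y m)\<bar> \<le> L * C" if "m \<in> space leb_Omega" for m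
        unfolding abs_mult using that h(2)[of m] p L0 by (intro mult_mono) auto
    qed measurable
    then show "Z \<in> L2 leb_Omega"
      unfolding Z_def by (intro L2_add L2_cmult K(1))
    show "mono_on Omega Z"
    proof (rule mono_onI)
      fix r s assume rs: "r \<in> Omega" "s \<in> Omega" "r \<le> s"
      have Yrs: "Y r \<le> Y s" and hrs: "h r \<le> h s" using mono_onD[OF K(2)] mono_onD[OF h(1)] rs by auto
      \<comment> \<open>Replacing \<open>h s\<close> by \<open>h r\<close> uses that h is
        nondecreasing and p nonnegative. What remains is only the variation of p, which the
        increment of \<open>Y\<close> pays for.\<close>
      have "h r * p (Y r) - h s * p (Y s) \<le> h r * p (Y r) - h r * p (Y s)"
        using mult_right_mono[OF hrs p(1)[of "Y s"]] by simp
      also have "\<dots> \<le> \<bar>h r\<bar> * \<bar>p (Y s) - p (Y r)\<bar>"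
        unfolding abs_mult[symmetric] by (simp add: algebra_simps abs_le_iff)
      also have "\<dots> \<le> L * (C * \<bar>Y s - Y r\<bar>)" using h(2)[OF rs(1)] p(3) L0 by (intro mult_mono) auto
      finally have "\<epsilon> * (h r * p (Y r) - h s * p (Y s)) \<le> \<epsilon> * (L * (C * \<bar>Y s - Y r\<bar>))"
        using e(1) by (intro mult_left_mono) auto
      also have "\<dots> = (\<epsilon> * (L * C)) * (Y s - Y r)" using Yrs by simp
      also have "\<dots> \<le> 1 * (Y s - Y r)" using e(2) Yrs by (intro mult_right_mono) auto
      finally show "Z r \<le> Z s" by (simp add: Z_def algebra_simps)
    qed
    fix m assume m: "m \<in> Omega"
    have "continuous (at_right m) (\<lambda>m. p (Y m))"
      by (rule continuous_within_compose3[OF _ K(3)[OF m]])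
        (use cont in \<open>auto simp: continuous_on_eq_continuous_at\<close>)
    then show "continuous (at_right m) Z"
      unfolding Z_def by (intro continuous_intros K(3)[OF m] h(3)[OF m])
  qed
  then have "L2_inner leb_Omega W (\<lambda>m. Z m - Y m) \<le> 0" using W by (auto simp: subdiff_K_def)
  also have "L2_inner leb_Omega W (\<lambda>m. Z m - Y m) = (LINT m|leb_Omega. \<epsilon> * (W m * (h m * p (Y m))))"
    unfolding L2_inner_def Z_def by (intro Bochner_Integration.integral_cong) auto
  also have "\<dots> = \<epsilon> * (LINT m|leb_Omega. W m * (h m * p (Y m)))" by simp
  finally show ?thesis using e(1) by (simp add: mult_le_0_iff)
qed

section \<open>Image measures of densities on the mass interval\<close>

lemma pushforward_density:
  fixes k X g :: "real \<Rightarrow> real"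
  assumes k: "integrable leb_Omega k" "\<And>m. 0 \<le> k m" and X[measurable]: "X \<in> borel_measurable leb_Omega"
  defines "\<mu> \<equiv> distr (density leb_Omega (\<lambda>m. ennreal (k m))) borel X"
  shows "finite_measure \<mu>" "sets \<mu> = sets borel"
    "g \<in> borel_measurable borel \<Longrightarrow> (LINT x|\<mu>. g x) = (LINT m|leb_Omega. k m * g (X m))"
    "g \<in> borel_measurable borel \<Longrightarrow> integrable \<mu> g \<longleftrightarrow> integrable leb_Omega (\<lambda>m. k m * g (X m))"
proof -
  have km[measurable]: "k \<in> borel_measurable leb_Omega" using k by auto
  show "sets \<mu> = sets borel" by (simp add: \<mu>_def)
  have "emeasure (density leb_Omega (\<lambda>m. ennreal (k m))) Omega = ennreal (LINT m:Omega|leb_Omega. k m)"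
    using k by (intro emeasure_density_integral) (auto simp: sets.top[of leb_Omega, simplified])
  then have "finite_measure (density leb_Omega (\<lambda>m. ennreal (k m)))"
    by (intro finite_measureI) (simp add: space_density)
  then show "finite_measure \<mu>" unfolding \<mu>_def by (rule finite_measure.finite_measure_distr) simp
  assume [measurable]: "g \<in> borel_measurable borel"
  have "(LINT x|\<mu>. g x) = (LINT m|density leb_Omega (\<lambda>m. ennreal (k m)). g (X m))"
    unfolding \<mu>_def by (rule integral_distr) auto
  also have "\<dots> = (LINT m|leb_Omega. k m *\<^sub>R g (X m))"
    by (rule integral_density) (auto simp: k)
  finally show "(LINT x|\<mu>. g x) = (LINT m|leb_Omega. k m * g (X m))" by simp
  have "integrable \<mu> g \<longleftrightarrow> integrable (density leb_Omega (\<lambda>m. ennreal (k m))) (\<lambda>m. g (X m))"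
    unfolding \<mu>_def by (rule integrable_distr_eq) auto
  also have "\<dots> \<longleftrightarrow> integrable leb_Omega (\<lambda>m. k m *\<^sub>R g (X m))"
    by (rule integrable_density) (auto simp: k)
  finally show "integrable \<mu> g \<longleftrightarrow> integrable leb_Omega (\<lambda>m. k m * g (X m))" by simp
qed

section \<open>Entropy production along a Lagrangian solution\<close>

text \<open>The properties of the interaction on which the estimates rest: they make
  \<open>mean_Phi\<close> of an integrable map integrable, with a bound by its first moment.\<close>

locale linear_growth =
  fixes \<Phi> :: "real \<Rightarrow> real" and C\<^sub>\<Phi> :: real
  assumes Phi_measurable [measurable]: "\<Phi> \<in> borel_measurable borel"
    and C_Phi: "0 \<le> C\<^sub>\<Phi>" "\<And>x. \<bar>\<Phi> x\<bar> \<le> C\<^sub>\<Phi> * (1 + \<bar>x\<bar>)"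
begin

lemma Phi_diff_bound: "\<bar>\<Phi> (x - y)\<bar> \<le> C\<^sub>\<Phi> * (1 + \<bar>x\<bar> + \<bar>y\<bar>)"
proof -
  have "\<bar>\<Phi> (x - y)\<bar> \<le> C\<^sub>\<Phi> * (1 + \<bar>x - y\<bar>)" by (rule C_Phi)
  also have "\<dots> \<le> C\<^sub>\<Phi> * (1 + \<bar>x\<bar> + \<bar>y\<bar>)" by (intro mult_left_mono C_Phi) auto
  finally show ?thesis .
qed

lemma Phi_integrable:
  assumes Y: "integrable leb_Omega Y"
  shows "integrable leb_Omega (\<lambda>\<omega>. \<Phi> (x - Y \<omega>))"
    and "\<bar>LINT \<omega>|leb_Omega. \<Phi> (x - Y \<omega>)\<bar> \<le> C\<^sub>\<Phi> * (1 + \<bar>x\<bar> + (LINT \<omega>|leb_Omega. \<bar>Y \<omega>\<bar>))"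
proof -
  have [measurable]: "Y \<in> borel_measurable leb_Omega" using Y by auto
  have i: "integrable leb_Omega (\<lambda>\<omega>. C\<^sub>\<Phi> * (1 + \<bar>x\<bar> + \<bar>Y \<omega>\<bar>))" using Y by auto
  show j: "integrable leb_Omega (\<lambda>\<omega>. \<Phi> (x - Y \<omega>))"
  proof (rule Bochner_Integration.integrable_bound[OF i])
    have "\<bar>\<Phi> (x - Y \<omega>)\<bar> \<le> \<bar>C\<^sub>\<Phi> * (1 + \<bar>x\<bar> + \<bar>Y \<omega>\<bar>)\<bar>" for \<omega>
      using Phi_diff_bound[of x "Y \<omega>"] by linarith
    then show "AE \<omega> in leb_Omega. norm (\<Phi> (x - Y \<omega>)) \<le> norm (C\<^sub>\<Phi> * (1 + \<bar>x\<bar> + \<bar>Y \<omega>\<bar>))"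
      by (intro AE_I2) simp
  qed measurable
  have "\<bar>LINT \<omega>|leb_Omega. \<Phi> (x - Y \<omega>)\<bar> \<le> (LINT \<omega>|leb_Omega. \<bar>\<Phi> (x - Y \<omega>)\<bar>)"
    by (rule integral_abs_bound)
  also have "\<dots> \<le> (LINT \<omega>|leb_Omega. C\<^sub>\<Phi> * (1 + \<bar>x\<bar> + \<bar>Y \<omega>\<bar>))"
    by (rule integral_mono) (use i j Phi_diff_bound in auto)
  also have "\<dots> = C\<^sub>\<Phi> * (1 + \<bar>x\<bar> + (LINT \<omega>|leb_Omega. \<bar>Y \<omega>\<bar>))"
    using Y leb_Omega.prob_space by simp
  finally show "\<bar>LINT \<omega>|leb_Omega. \<Phi> (x - Y \<omega>)\<bar> \<le> C\<^sub>\<Phi> * (1 + \<bar>x\<bar> + (LINT \<omega>|leb_Omega. \<bar>Y \<omega>\<bar>))" .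
qed

lemma mean_Phi_measurable:
  assumes [measurable]: "Y \<in> borel_measurable leb_Omega"
  shows "mean_Phi \<Phi> Y \<in> borel_measurable leb_Omega"
  unfolding mean_Phi_def[abs_def] by measurable

lemma mean_Phi_bound:
  assumes Y: "integrable leb_Omega Y"
  shows "\<bar>mean_Phi \<Phi> Y m\<bar> \<le> C\<^sub>\<Phi> * (1 + \<bar>Y m\<bar> + (LINT \<omega>|leb_Omega. \<bar>Y \<omega>\<bar>))"
  unfolding mean_Phi_def by (rule Phi_integrable(2)[OF Y])

lemma mean_Phi_integrable:
  assumes Y: "integrable leb_Omega Y"
  shows "integrable leb_Omega (mean_Phi \<Phi> Y)"
    "(LINT m|leb_Omega. \<bar>mean_Phi \<Phi> Y m\<bar>) \<le> C\<^sub>\<Phi> * (1 + 2 * (LINT \<omega>|leb_Omega. \<bar>Y \<omega>\<bar>))"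
proof -
  let ?B = "\<lambda>m. C\<^sub>\<Phi> * (1 + \<bar>Y m\<bar> + (LINT \<omega>|leb_Omega. \<bar>Y \<omega>\<bar>))"
  have i: "integrable leb_Omega ?B" using Y by auto
  show j: "integrable leb_Omega (mean_Phi \<Phi> Y)"
  proof (rule Bochner_Integration.integrable_bound[OF i])
    have "\<bar>mean_Phi \<Phi> Y m\<bar> \<le> \<bar>?B m\<bar>" for m
      using mean_Phi_bound[OF Y, of m] by linarith
    then show "AE m in leb_Omega. norm (mean_Phi \<Phi> Y m) \<le> norm (?B m)"
      by (intro AE_I2) simp
  qed (use Y in \<open>auto intro!: mean_Phi_measurable\<close>)
  have "(LINT m|leb_Omega. \<bar>mean_Phi \<Phi> Y m\<bar>) \<le> (LINT m|leb_Omega. ?B m)"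
    by (rule integral_mono) (use i j mean_Phi_bound[OF Y] in auto)
  also have "\<dots> = C\<^sub>\<Phi> * (1 + 2 * (LINT \<omega>|leb_Omega. \<bar>Y \<omega>\<bar>))"
    using Y leb_Omega.prob_space by simp
  finally show "(LINT m|leb_Omega. \<bar>mean_Phi \<Phi> Y m\<bar>) \<le> C\<^sub>\<Phi> * (1 + 2 * (LINT \<omega>|leb_Omega. \<bar>Y \<omega>\<bar>))" .
qed

end

text \<open>\<Psi> stands for the initial velocity plus the initial interaction; the initial data
  enter the evolution only through this sum, whose primitive is the flux.\<close>

locale lagrangian_curve = linear_growth +
  fixes \<Psi> :: "real \<Rightarrow> real" and X :: "real \<Rightarrow> real \<Rightarrow> real"
  assumes Psi: "\<Psi> \<in> L2 leb_Omega"
    and cone: "\<And>t. 0 \<le> t \<Longrightarrow> X t \<in> cone_K"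
    and ac: "\<And>b. 0 < b \<Longrightarrow> abs_continuous_curve (L2_dist leb_Omega) 0 b X"
    and evolution: "AE t in lborel. 0 < t \<longrightarrow> (\<exists>D. has_L2_derivative X D t \<and>
      (\<lambda>m. \<Psi> m - mean_Phi \<Phi> (X t) m - D m) \<in> subdiff_K (X t))"
begin

text \<open>The weak integrand in mass coordinates, with \<open>c = \<eta> 0\<close>.\<close>

definition entropy_production :: "real \<Rightarrow> (real \<Rightarrow> real) \<Rightarrow> (real \<times> real \<Rightarrow> real) \<Rightarrow> real \<Rightarrow> real" where
  "entropy_production c h f t =
     c * (LINT x|lborel. dir_deriv (1, 0) f (t, x)) +
     (LINT m|leb_Omega. h m * (LINT x:{X t m..}|lborel. dir_deriv (1, 0) f (t, x))) -
     (LINT m|leb_Omega. h m * \<Psi> m * f (t, X t m)) +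
     (LINT m|leb_Omega. h m * f (t, X t m) * mean_Phi \<Phi> (X t) m)"

text \<open>On a bounded time interval a measurable bounded function is integrable. Measurability in
  time of the mass integrals comes from joint measurability of the curve in time and mass;
  boundedness comes from the support of f and the uniform first-moment bound.\<close>

lemma entropy_production_integrable:
  assumes T: "0 < T" and f: "f \<in> test_functions ({0<..<T} \<times> UNIV)"
    and h: "h \<in> borel_measurable leb_Omega" "\<And>m. m \<in> Omega \<Longrightarrow> \<bar>h m\<bar> \<le> L"
  shows "set_integrable lborel {0<..<T} (entropy_production c h f)"
proof -
  let ?ft = "dir_deriv (1, 0) f"
  obtain R C where RC: "0 \<le> R" "0 \<le> C"
    and cont: "continuous_on UNIV f" "continuous_on UNIV ?ft"
    and supp: "\<And>t x. R < \<bar>x\<bar> \<Longrightarrow> f (t, x) = 0" "\<And>t x. R < \<bar>x\<bar> \<Longrightarrow> ?ft (t, x) = 0"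
    and bd: "\<And>z. \<bar>f z\<bar> \<le> C" "\<And>z. \<bar>?ft z\<bar> \<le> C"
    and lip: "\<And>s t x y. \<bar>f (s, y) - f (t, x)\<bar> \<le> C * (\<bar>s - t\<bar> + \<bar>y - x\<bar>)"
    and taylor: "\<And>s t x. \<bar>f (s, x) - f (t, x) - (s - t) * ?ft (t, x)\<bar> \<le> C * (s - t)\<^sup>2"
    by (rule test_function_plane[OF f]) (rule that; assumption)
  have "\<forall>t x. R < \<bar>x\<bar> \<longrightarrow> f (t, x) = 0" "\<forall>t x. R < \<bar>x\<bar> \<longrightarrow> ?ft (t, x) = 0"
    using supp by auto
  note te = tail_integral_expansion[OF RC cont this bd lip taylor]
  obtain B where B: "0 \<le> B" "\<And>t. t \<in> {0..T} \<Longrightarrow> (LINT m|leb_Omega. \<bar>X t m\<bar>) \<le> B"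
    using curve_L1_bound[OF cone ac[OF T]] by blast
  \<comment> \<open>The clamped curve is jointly measurable over the whole time line and agrees with
    \<open>X\<close> on (0, T), so measurability is shown for it and integrability
    transferred.\<close>
  define Xc where "Xc t = X (max 0 (min T t))" for t
  have Xc: "Xc t = X t" if "t \<in> {0<..<T}" for t using that by (auto simp: Xc_def)
  have XX[measurable]: "(\<lambda>p. Xc (fst p) (snd p)) \<in> borel_measurable (borel \<Otimes>\<^sub>M leb_Omega)"
    using curve_measurable_pair[OF cone ac[OF T]] T by (simp add: Xc_def case_prod_beta')
  have XX'[measurable]: "(\<lambda>p. Xc (fst (fst p)) (snd p)) \<in> borel_measurable ((borel \<Otimes>\<^sub>M leb_Omega) \<Otimes>\<^sub>M leb_Omega)"
    using measurable_compose[OF _ XX, of "\<lambda>p. (fst (fst p), snd p)" "(borel \<Otimes>\<^sub>M leb_Omega) \<Otimes>\<^sub>M leb_Omega"] by simp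
  have [measurable]: "f \<in> borel_measurable (borel \<Otimes>\<^sub>M borel)" "?ft \<in> borel_measurable (borel \<Otimes>\<^sub>M borel)"
    using cont by (auto simp: borel_prod intro: borel_measurable_continuous_onI)
  note [measurable] = h(1) L2_measurable[OF Psi]
  have Ftm[measurable]: "(\<lambda>p. LINT y:{snd p..}|lborel. ?ft (fst p, y)) \<in> borel_measurable (borel \<Otimes>\<^sub>M borel)"
    using borel_measurable_uminus[OF te(6)] by (simp add: case_prod_beta')
  define w where "w t = c * (LINT x|lborel. ?ft (t, x)) +
     (LINT m|leb_Omega. h m * (LINT x:{Xc t m..}|lborel. ?ft (t, x))) -
     (LINT m|leb_Omega. h m * \<Psi> m * f (t, Xc t m)) +
     (LINT m|leb_Omega. h m * f (t, Xc t m) * mean_Phi \<Phi> (Xc t) m)" for t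
  have wm: "w \<in> borel_measurable borel"
  proof -
    have 1: "(\<lambda>t. LINT x|lborel. ?ft (t, x)) \<in> borel_measurable borel" by measurable
    have 2: "(\<lambda>t. LINT m|leb_Omega. h m * (LINT x:{Xc t m..}|lborel. ?ft (t, x))) \<in> borel_measurable borel"
    proof (rule leb_Omega.borel_measurable_lebesgue_integral)
      have "(\<lambda>p. (fst p, Xc (fst p) (snd p))) \<in> borel \<Otimes>\<^sub>M leb_Omega \<rightarrow>\<^sub>M borel \<Otimes>\<^sub>M borel" by measurable
      from measurable_compose[OF this Ftm]
      have "(\<lambda>p. LINT x:{Xc (fst p) (snd p)..}|lborel. ?ft (fst p, x)) \<in> borel_measurable (borel \<Otimes>\<^sub>M leb_Omega)" by simp
      then have "(\<lambda>p. h (snd p) * (LINT x:{Xc (fst p) (snd p)..}|lborel. ?ft (fst p, x))) \<in> borel_measurable (borel \<Otimes>\<^sub>M leb_Omega)"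
        by (intro borel_measurable_times measurable_compose[OF measurable_snd h(1)])
      then show "(\<lambda>(t, m). h m * (LINT x:{Xc t m..}|lborel. ?ft (t, x))) \<in> borel_measurable (borel \<Otimes>\<^sub>M leb_Omega)"
        by (simp add: case_prod_beta')
    qed
    have fX: "(\<lambda>p. f (fst p, Xc (fst p) (snd p))) \<in> borel_measurable (borel \<Otimes>\<^sub>M leb_Omega)" by measurable
    have 3: "(\<lambda>t. LINT m|leb_Omega. h m * \<Psi> m * f (t, Xc t m)) \<in> borel_measurable borel"
    proof (rule leb_Omega.borel_measurable_lebesgue_integral)
      have "(\<lambda>p. h (snd p) * \<Psi> (snd p) * f (fst p, Xc (fst p) (snd p))) \<in> borel_measurable (borel \<Otimes>\<^sub>M leb_Omega)"
        by (intro borel_measurable_times fX measurable_compose[OF measurable_snd h(1)] measurable_compose[OF measurable_snd L2_measurable[OF Psi]])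
      then show "(\<lambda>(t, m). h m * \<Psi> m * f (t, Xc t m)) \<in> borel_measurable (borel \<Otimes>\<^sub>M leb_Omega)"
        by (simp add: case_prod_beta')
    qed
    have "(\<lambda>p. LINT \<omega>|leb_Omega. \<Phi> (Xc (fst p) (snd p) - Xc (fst p) \<omega>)) \<in> borel_measurable (borel \<Otimes>\<^sub>M leb_Omega)"
    proof (rule leb_Omega.borel_measurable_lebesgue_integral)
      have "(\<lambda>q. \<Phi> (Xc (fst (fst q)) (snd (fst q)) - Xc (fst (fst q)) (snd q))) \<in> borel_measurable ((borel \<Otimes>\<^sub>M leb_Omega) \<Otimes>\<^sub>M leb_Omega)"
        by (intro measurable_compose[OF _ Phi_measurable] borel_measurable_diff XX' measurable_compose[OF measurable_fst XX])
      then show "(\<lambda>(p, \<omega>). \<Phi> (Xc (fst p) (snd p) - Xc (fst p) \<omega>)) \<in> borel_measurable ((borel \<Otimes>\<^sub>M leb_Omega) \<Otimes>\<^sub>M leb_Omega)"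
        by (simp add: case_prod_beta')
    qed
    then have mP: "(\<lambda>p. mean_Phi \<Phi> (Xc (fst p)) (snd p)) \<in> borel_measurable (borel \<Otimes>\<^sub>M leb_Omega)"
      by (simp add: mean_Phi_def)
    have 4: "(\<lambda>t. LINT m|leb_Omega. h m * f (t, Xc t m) * mean_Phi \<Phi> (Xc t) m) \<in> borel_measurable borel"
    proof (rule leb_Omega.borel_measurable_lebesgue_integral)
      have "(\<lambda>p. h (snd p) * f (fst p, Xc (fst p) (snd p)) * mean_Phi \<Phi> (Xc (fst p)) (snd p)) \<in> borel_measurable (borel \<Otimes>\<^sub>M leb_Omega)"
        by (intro borel_measurable_times fX mP measurable_compose[OF measurable_snd h(1)])
      then show "(\<lambda>(t, m). h m * f (t, Xc t m) * mean_Phi \<Phi> (Xc t) m) \<in> borel_measurable (borel \<Otimes>\<^sub>M leb_Omega)"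
        by (simp add: case_prod_beta')
    qed
    show ?thesis
      unfolding w_def
      by (intro borel_measurable_add borel_measurable_diff borel_measurable_times[OF borel_measurable_const] 1 2 3 4)
  qed
  obtain m0 where "m0 \<in> Omega" by (auto simp: Omega_def intro: that[of "1/2"])
  then have L0: "0 \<le> L" using h(2)[of m0] by linarith
  have int_le: "\<bar>LINT m|leb_Omega. u m\<bar> \<le> (LINT m|leb_Omega. v m)"
    if "integrable leb_Omega v" "\<And>m. m \<in> Omega \<Longrightarrow> \<bar>u m\<bar> \<le> v m" for u v :: "real \<Rightarrow> real"
  proof -
    have "\<bar>LINT m|leb_Omega. u m\<bar> \<le> (LINT m|leb_Omega. \<bar>u m\<bar>)" by (rule integral_abs_bound)
    also have "\<dots> \<le> (LINT m|leb_Omega. v m)"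
      by (rule integral_mono') (use that order_trans[OF abs_ge_zero that(2)] in auto)
    finally show ?thesis .
  qed
  define BB where "BB = \<bar>c\<bar> * (2 * R * C) + L * (2 * R * C) + L * C * (LINT m|leb_Omega. \<bar>\<Psi> m\<bar>) + L * C * (C\<^sub>\<Phi> * (1 + 2 * B))"
  have bound: "\<bar>w t\<bar> \<le> BB" if t: "t \<in> {0<..<T}" for t
  proof -
    have XK: "Xc t \<in> cone_K" using t by (simp add: Xc cone)
    note Xi = cone_K_D(5)[OF XK]
    \<comment> \<open>The time derivative of f vanishes left of - R, so the full integral is a tail
      integral and inherits its bound.\<close>
    have "(LINT x|lborel. ?ft (t, x)) = (LINT x:{- R - 1..}|lborel. ?ft (t, x))"
      unfolding set_lebesgue_integral_def using supp(2)[of _ t]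
      by (intro Bochner_Integration.integral_cong) (auto simp: indicator_def not_le)
    then have "\<bar>LINT x|lborel. ?ft (t, x)\<bar> \<le> 2 * R * C" using te(2)[of "- R - 1" t] by simp
    then have b1: "\<bar>c * (LINT x|lborel. ?ft (t, x))\<bar> \<le> \<bar>c\<bar> * (2 * R * C)"
      unfolding abs_mult by (intro mult_left_mono) auto
    have "\<bar>LINT m|leb_Omega. h m * (LINT x:{Xc t m..}|lborel. ?ft (t, x))\<bar> \<le> (LINT m|leb_Omega. L * (2 * R * C))"
      by (rule int_le) (use te(2)[of _ t] h(2) L0 in \<open>auto simp: abs_mult intro!: mult_mono\<close>)
    then have b2: "\<bar>LINT m|leb_Omega. h m * (LINT x:{Xc t m..}|lborel. ?ft (t, x))\<bar> \<le> L * (2 * R * C)"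
      using leb_Omega.prob_space by simp
    have "\<bar>LINT m|leb_Omega. h m * \<Psi> m * f (t, Xc t m)\<bar> \<le> (LINT m|leb_Omega. L * C * \<bar>\<Psi> m\<bar>)"
    proof (rule int_le)
      show "integrable leb_Omega (\<lambda>m. L * C * \<bar>\<Psi> m\<bar>)" using leb_Omega.L2_integrable[OF Psi] by auto
      show "\<bar>h m * \<Psi> m * f (t, Xc t m)\<bar> \<le> L * C * \<bar>\<Psi> m\<bar>" if "m \<in> Omega" for m
        using mult_mono[OF h(2)[OF that] bd(1)[of "(t, Xc t m)"] L0 abs_ge_zero]
          mult_right_mono[of "\<bar>h m\<bar> * \<bar>f (t, Xc t m)\<bar>" "L * C" "\<bar>\<Psi> m\<bar>"] by (simp add: abs_mult mult_ac)
    qed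
    then have b3: "\<bar>LINT m|leb_Omega. h m * \<Psi> m * f (t, Xc t m)\<bar> \<le> L * C * (LINT m|leb_Omega. \<bar>\<Psi> m\<bar>)" by simp
    have "\<bar>LINT m|leb_Omega. h m * f (t, Xc t m) * mean_Phi \<Phi> (Xc t) m\<bar> \<le> (LINT m|leb_Omega. L * C * \<bar>mean_Phi \<Phi> (Xc t) m\<bar>)"
    proof (rule int_le)
      show "integrable leb_Omega (\<lambda>m. L * C * \<bar>mean_Phi \<Phi> (Xc t) m\<bar>)" using mean_Phi_integrable(1)[OF Xi] by auto
      show "\<bar>h m * f (t, Xc t m) * mean_Phi \<Phi> (Xc t) m\<bar> \<le> L * C * \<bar>mean_Phi \<Phi> (Xc t) m\<bar>" if "m \<in> Omega" for m
        unfolding abs_mult using h(2)[OF that] bd L0 RC by (intro mult_mono) auto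
    qed
    also have "\<dots> = L * C * (LINT m|leb_Omega. \<bar>mean_Phi \<Phi> (Xc t) m\<bar>)" by simp
    also have "\<dots> \<le> L * C * (C\<^sub>\<Phi> * (1 + 2 * B))"
    proof (rule mult_left_mono)
      have "(LINT m|leb_Omega. \<bar>mean_Phi \<Phi> (Xc t) m\<bar>) \<le> C\<^sub>\<Phi> * (1 + 2 * (LINT \<omega>|leb_Omega. \<bar>Xc t \<omega>\<bar>))"
        by (rule mean_Phi_integrable(2)[OF Xi])
      also have "\<dots> \<le> C\<^sub>\<Phi> * (1 + 2 * B)"
        using B(2)[of t] t Xc[OF t] C_Phi(1) by (intro mult_left_mono) auto
      finally show "(LINT m|leb_Omega. \<bar>mean_Phi \<Phi> (Xc t) m\<bar>) \<le> C\<^sub>\<Phi> * (1 + 2 * B)" .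
    qed (use L0 RC in auto)
    finally have b4: "\<bar>LINT m|leb_Omega. h m * f (t, Xc t m) * mean_Phi \<Phi> (Xc t) m\<bar> \<le> L * C * (C\<^sub>\<Phi> * (1 + 2 * B))" .
    show ?thesis using b1 b2 b3 b4 unfolding w_def BB_def by linarith
  qed
  have eq: "entropy_production c h f t = w t" if "t \<in> {0<..<T}" for t
    using Xc[OF that] by (simp add: entropy_production_def w_def)
  have "set_integrable lborel {0<..<T} w"
    unfolding set_integrable_def
  proof (rule Bochner_Integration.integrable_bound)
    show "integrable lborel (\<lambda>t. indicator {0<..<T} t * BB)"
      using T by (intro integrable_mult_left integrable_real_indicator) auto
    show "(\<lambda>t. indicator {0<..<T} t *\<^sub>R w t) \<in> borel_measurable lborel"
      using wm by simp
    have "\<bar>w t\<bar> \<le> \<bar>BB\<bar>" if "t \<in> {0<..<T}" for t using bound[OF that] by linarith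
    then show "AE t in lborel. norm (indicator {0<..<T} t *\<^sub>R w t) \<le> norm (indicator {0<..<T} t * BB)"
      by (intro AE_I2) (auto simp: indicator_def)
  qed
  then show ?thesis
    by (rule iffD1[OF set_integrable_cong, rotated -1]) (auto simp: eq)
qed

text \<open>A primitive in time of the production, corrected by \<open>E t + c * F t a\<close>, has
  derivative equal to minus the integral of W h f, where W is the element of the subdifferential.
  This is nonnegative at almost every time, and the correction vanishes at both ends, so the
  monotonicity theorem gives the sign of the integral.\<close>

theorem entropy_production_nonneg:
  assumes T: "0 < T" and f: "f \<in> test_functions ({0<..<T} \<times> UNIV)" "\<And>z. 0 \<le> f z"
    and h: "mono_on Omega h" "\<And>m. m \<in> Omega \<Longrightarrow> \<bar>h m\<bar> \<le> L" "\<And>m. m \<in> Omega \<Longrightarrow> continuous (at_right m) h"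
  shows "0 \<le> (LINT t:{0<..<T}|lborel. entropy_production c h f t)"
proof -
  let ?ft = "dir_deriv (1, 0) f"
  obtain R C where RC: "0 \<le> R" "0 \<le> C"
    and cont: "continuous_on UNIV f" "continuous_on UNIV ?ft"
    and supp: "\<And>t x. R < \<bar>x\<bar> \<Longrightarrow> f (t, x) = 0" "\<And>t x. R < \<bar>x\<bar> \<Longrightarrow> ?ft (t, x) = 0"
    and supp_t: "\<And>t x. t \<notin> {0<..<T} \<Longrightarrow> f (t, x) = 0"
    and bd: "\<And>z. \<bar>f z\<bar> \<le> C" "\<And>z. \<bar>?ft z\<bar> \<le> C"
    and lip: "\<And>s t x y. \<bar>f (s, y) - f (t, x)\<bar> \<le> C * (\<bar>s - t\<bar> + \<bar>y - x\<bar>)"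
    and taylor: "\<And>s t x. \<bar>f (s, x) - f (t, x) - (s - t) * ?ft (t, x)\<bar> \<le> C * (s - t)\<^sup>2"
    by (rule test_function_plane[OF f(1)]) (rule that; assumption)
  have "\<forall>t x. R < \<bar>x\<bar> \<longrightarrow> f (t, x) = 0" "\<forall>t x. R < \<bar>x\<bar> \<longrightarrow> ?ft (t, x) = 0"
    using supp by auto
  note te = tail_integral_expansion[OF RC cont this bd lip taylor]
  define F where "F t x = - (LINT y:{x..}|lborel. f (t, y))" for t x
  define Ft where "Ft t x = - (LINT y:{x..}|lborel. ?ft (t, y))" for t x
  define K where "K = (2 * R + 2) * C"
  have K0: "0 \<le> K" using RC by (simp add: K_def)
  have Kle: "2 * R * C \<le> K" "(2 * R + 1) * C \<le> K" using RC by (auto simp: K_def algebra_simps)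
  have Fb: "\<bar>F t x\<bar> \<le> K" "\<bar>Ft t x\<bar> \<le> K" for t x
    using te(1)[of x t] te(2)[of x t] Kle unfolding F_def Ft_def by linarith+
  have Flip: "\<bar>F s y - F t x\<bar> \<le> K * (\<bar>s - t\<bar> + \<bar>y - x\<bar>)" for s t x y
    using te(3)[of y s x t] mult_right_mono[OF Kle(2), of "\<bar>s - t\<bar> + \<bar>y - x\<bar>"] unfolding F_def by linarith
  have Fexp: "\<bar>F s y - F t x - (s - t) * Ft t x - f (t, x) * (y - x)\<bar> \<le> K * ((s - t)\<^sup>2 + (y - x)\<^sup>2)" for s t x y
    unfolding F_def Ft_def K_def by (rule te(4))
  have Fm: "F t \<in> borel_measurable borel" "Ft t \<in> borel_measurable borel" "(\<lambda>x. f (t, x)) \<in> borel_measurable borel" for t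
  proof -
    have "(\<lambda>x. (t, x)) \<in> borel \<rightarrow>\<^sub>M borel \<Otimes>\<^sub>M borel" by measurable
    from measurable_compose[OF this te(5)] measurable_compose[OF this te(6)]
    show "F t \<in> borel_measurable borel" "Ft t \<in> borel_measurable borel" by (simp_all add: F_def[abs_def] Ft_def[abs_def])
    show "(\<lambda>x. f (t, x)) \<in> borel_measurable borel"
      by (intro borel_measurable_continuous_onI continuous_on_compose2[OF cont(1)]) (auto intro!: continuous_intros)
  qed
  have hm[measurable]: "h \<in> borel_measurable leb_Omega" by (rule mono_on_borel_measurable_leb_Omega[OF h(1)])
  obtain m0 where "m0 \<in> Omega" by (auto simp: Omega_def intro: that[of "1/2"])
  then have L0: "0 \<le> L" using h(2)[of m0] by linarith
  define w where "w = entropy_production c h f"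
  have wi: "set_integrable lborel {0<..<T} w"
    unfolding w_def by (rule entropy_production_integrable[OF T f(1) hm h(2)])
  \<comment> \<open>A point left of the support in x, so that \<open>F t a\<close> is minus the full
    integral of f in x. Its time derivative cancels the term with factor c in the
    production.\<close>
  define a where "a = - R - 1"
  define E where "E t = (LINT m|leb_Omega. h m * F t (X t m))" for t
  define r where "r t = (E t + c * F t a) + (LINT z:{0<..<t}|lborel. w z)" for t
  have hF: "integrable leb_Omega (\<lambda>m. h m * F t (X t m))" if "0 \<le> t" for t
  proof (rule leb_Omega_integrable_bounded)
    show "(\<lambda>m. h m * F t (X t m)) \<in> borel_measurable leb_Omega"
      by (rule borel_measurable_times[OF hm measurable_compose[OF cone_K_D(4)[OF cone[OF that]] Fm(1)]])
    show "\<bar>h m * F t (X t m)\<bar> \<le> L * K" if "m \<in> Omega" for m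
      unfolding abs_mult using h(2)[OF that] Fb L0 by (intro mult_mono) auto
  qed
  have acE: "abs_continuous_curve dist 0 T E"
  proof (rule abs_continuous_curve_bound[OF abs_continuous_curve_id ac[OF T], where K="L * K" and L="L * K"])
    fix s t assume st: "0 \<le> s" "s \<le> t" "t \<le> T"
    have Xi: "integrable leb_Omega (\<lambda>m. X t m - X s m)"
      using cone_K_D(5)[OF cone] st by auto
    have "E t - E s = (LINT m|leb_Omega. h m * F t (X t m) - h m * F s (X s m))"
      unfolding E_def by (rule Bochner_Integration.integral_diff[symmetric]) (use hF st in auto)
    then have "\<bar>E t - E s\<bar> \<le> (LINT m|leb_Omega. \<bar>h m * F t (X t m) - h m * F s (X s m)\<bar>)"
      by (simp only: integral_abs_bound)
    also have "\<dots> \<le> (LINT m|leb_Omega. L * (K * (\<bar>t - s\<bar> + \<bar>X t m - X s m\<bar>)))"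
    proof (rule integral_mono)
      show "integrable leb_Omega (\<lambda>m. \<bar>h m * F t (X t m) - h m * F s (X s m)\<bar>)"
        using hF st by (intro integrable_abs Bochner_Integration.integrable_diff) auto
      show "integrable leb_Omega (\<lambda>m. L * (K * (\<bar>t - s\<bar> + \<bar>X t m - X s m\<bar>)))" using Xi by auto
      show "\<bar>h m * F t (X t m) - h m * F s (X s m)\<bar> \<le> L * (K * (\<bar>t - s\<bar> + \<bar>X t m - X s m\<bar>))" if "m \<in> space leb_Omega" for m
        unfolding right_diff_distrib[symmetric] abs_mult using that L0 by (intro mult_mono h(2) Flip) auto
    qed
    also have "\<dots> = L * K * \<bar>t - s\<bar> + L * K * (LINT m|leb_Omega. \<bar>X t m - X s m\<bar>)"
      using Xi leb_Omega.prob_space by (simp add: algebra_simps)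
    also have "\<dots> \<le> L * K * \<bar>t - s\<bar> + L * K * L2_dist leb_Omega (X s) (X t)"
      using L0 K0 st by (intro add_left_mono mult_left_mono integral_abs_diff_le_L2_dist cone_K_D(1) cone) auto
    finally show "dist (E s) (E t) \<le> L * K * dist s t + L * K * L2_dist leb_Omega (X s) (X t)"
      by (simp add: dist_real_def abs_minus_commute)
  qed (use L0 K0 in auto)
  have acF: "abs_continuous_curve dist 0 T (\<lambda>t. F t a)"
  proof (rule abs_continuous_curve_bound[OF abs_continuous_curve_id abs_continuous_curve_id, where K=K and L=0])
    show "dist (F s a) (F t a) \<le> K * dist s t + 0 * dist s t" for s t
      using Flip[of s a t a] by (simp add: dist_real_def)
  qed (use K0 in auto)
  have acEF: "abs_continuous_curve dist 0 T (\<lambda>t. E t + c * F t a)"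
  proof (rule abs_continuous_curve_bound[OF acE acF, where K=1 and L="\<bar>c\<bar>"])
    fix s t :: real
    have "E s + c * F s a - (E t + c * F t a) = (E s - E t) + c * (F s a - F t a)" by (simp add: algebra_simps)
    then have "\<bar>E s + c * F s a - (E t + c * F t a)\<bar> \<le> \<bar>E s - E t\<bar> + \<bar>c\<bar> * \<bar>F s a - F t a\<bar>"
      by (metis abs_mult abs_triangle_ineq)
    then show "dist (E s + c * F s a) (E t + c * F t a) \<le> 1 * dist (E s) (E t) + \<bar>c\<bar> * dist (F s a) (F t a)"
      by (simp add: dist_real_def)
  qed auto
  have acr: "abs_continuous_curve dist 0 T r"
  proof (rule abs_continuous_curve_bound[OF acEF abs_continuous_curve_integral[OF wi], where K=1 and L=1])
    show "dist (r s) (r t) \<le> 1 * dist (E s + c * F s a) (E t + c * F t a) +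
      1 * dist (LINT z:{0<..<s}|lborel. w z) (LINT z:{0<..<t}|lborel. w z)" for s t
      unfolding r_def mult_1 by (rule dist_triangle_add)
  qed (use T in auto)
  have "r 0 \<le> r T"
  proof (rule abs_continuous_mono_AE[OF _ acr])
    show "AE t in lborel. t \<in> {0<..<T} \<longrightarrow> (\<exists>d\<ge>0. (r has_real_derivative d) (at t))"
      using evolution AE_has_derivative_integral[OF wi]
    proof (eventually_elim, intro impI)
      fix t assume ev: "0 < t \<longrightarrow> (\<exists>D. has_L2_derivative X D t \<and> (\<lambda>m. \<Psi> m - mean_Phi \<Phi> (X t) m - D m) \<in> subdiff_K (X t))"
        and dw: "t \<in> {0<..<T} \<longrightarrow> ((\<lambda>y. LINT z:{0<..<y}|lborel. w z) has_real_derivative w t) (at t)"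
        and t: "t \<in> {0<..<T}"
      obtain D where D: "has_L2_derivative X D t" "(\<lambda>m. \<Psi> m - mean_Phi \<Phi> (X t) m - D m) \<in> subdiff_K (X t)"
        using ev t by auto
      have XK: "X t \<in> cone_K" using t by (intro cone) auto
      have DL: "D \<in> L2 leb_Omega" using D(1) unfolding has_L2_derivative_def by blast
      note Dm[measurable] = L2_measurable[OF DL] and Di = leb_Omega.L2_integrable[OF DL]
      define E' where "E' = (LINT m|leb_Omega. h m * (Ft t (X t m) + f (t, X t m) * D m))"
      have dE: "(E has_real_derivative E') (at t)"
        unfolding E_def[abs_def] E'_def
        by (rule L2_derivative_functional[OF hm h(2) Fm(1) Fb(1) Fm(2) Fb(2) Fm(3) bd(1) Fexp cone_K_D(1)[OF cone] _ D(1)])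
          (use t in auto)
      have dF: "((\<lambda>s. F s a) has_real_derivative Ft t a) (at t)"
        unfolding has_field_derivative_iff
      proof (rule LIM_zero_cancel, rule Lim_null_comparison)
        have "norm ((F s a - F t a) / (s - t) - Ft t a) \<le> K * \<bar>s - t\<bar>" if "s \<noteq> t" for s
        proof -
          have "(F s a - F t a) / (s - t) - Ft t a = (F s a - F t a - (s - t) * Ft t a) / (s - t)"
            using that by (simp add: field_simps)
          then have "norm ((F s a - F t a) / (s - t) - Ft t a) = \<bar>F s a - F t a - (s - t) * Ft t a\<bar> / \<bar>s - t\<bar>" by simp
          also have "\<dots> \<le> K * (s - t)\<^sup>2 / \<bar>s - t\<bar>"
            using Fexp[of s a t a] by (intro divide_right_mono) auto
          also have "\<dots> = K * \<bar>s - t\<bar>"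
          proof -
            have sq: "(s - t)\<^sup>2 = \<bar>s - t\<bar> * \<bar>s - t\<bar>" by (simp add: power2_eq_square flip: abs_mult)
            have *: "K * (b * b) / b = K * b" if "b \<noteq> 0" for b using that by simp
            show ?thesis unfolding sq by (rule *) (use that in simp)
          qed
          finally show ?thesis .
        qed
        then show "\<forall>\<^sub>F s in at t. norm ((F s a - F t a) / (s - t) - Ft t a) \<le> K * \<bar>s - t\<bar>"
          by (auto simp: eventually_at_filter)
        have "((\<lambda>s. K * \<bar>s - t\<bar>) \<longlongrightarrow> K * \<bar>t - t\<bar>) (at t)" by (intro tendsto_intros)
        then show "((\<lambda>s. K * \<bar>s - t\<bar>) \<longlongrightarrow> 0) (at t)" by simp
      qed
      \<comment> \<open>The terms in \<open>Ft\<close> cancel between \<open>E'\<close>,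
        \<open>c * Ft t a\<close> and \<open>w t\<close>; what is left is h f times (D + mean_Phi -
        \<Psi>), integrated over mass.\<close>
      have dr: "(r has_real_derivative (E' + c * Ft t a + w t)) (at t)"
        unfolding r_def[abs_def] by (intro DERIV_add dE DERIV_cmult dF) (use dw t in auto)
      have "(LINT x:{a..}|lborel. ?ft (t, x)) = (LINT x|lborel. ?ft (t, x))"
        unfolding set_lebesgue_integral_def using supp(2)[of _ t]
        by (intro Bochner_Integration.integral_cong) (auto simp: indicator_def not_le a_def)
      then have wt: "w t = - c * Ft t a + (LINT m|leb_Omega. h m * - Ft t (X t m)) -
         (LINT m|leb_Omega. h m * \<Psi> m * f (t, X t m)) + (LINT m|leb_Omega. h m * f (t, X t m) * mean_Phi \<Phi> (X t) m)"
        by (simp add: w_def entropy_production_def Ft_def)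
      have fXm[measurable]: "(\<lambda>m. f (t, X t m)) \<in> borel_measurable leb_Omega" "(\<lambda>m. Ft t (X t m)) \<in> borel_measurable leb_Omega"
        using measurable_compose[OF cone_K_D(4)[OF XK]] Fm by blast+
      have i1: "integrable leb_Omega (\<lambda>m. h m * Ft t (X t m))"
      proof (rule leb_Omega_integrable_bounded)
        show "\<bar>h m * Ft t (X t m)\<bar> \<le> L * K" if "m \<in> Omega" for m
          unfolding abs_mult using h(2)[OF that] Fb L0 by (intro mult_mono) auto
      qed measurable
      have ib: "integrable leb_Omega (\<lambda>m. (h m * f (t, X t m)) * u m)" if u: "integrable leb_Omega u" for u
      proof (rule Bochner_Integration.integrable_bound)
        show "integrable leb_Omega (\<lambda>m. L * C * u m)" using u by auto
        show "(\<lambda>m. (h m * f (t, X t m)) * u m) \<in> borel_measurable leb_Omega" using u by measurable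
        show "AE m in leb_Omega. norm ((h m * f (t, X t m)) * u m) \<le> norm (L * C * u m)"
        proof (rule AE_I2)
          fix m assume "m \<in> space leb_Omega"
          then have "\<bar>h m * f (t, X t m)\<bar> \<le> L * C"
            unfolding abs_mult using h(2)[of m] bd(1) L0 by (intro mult_mono) auto
          also have "\<dots> = \<bar>L * C\<bar>" using L0 RC by simp
          finally show "norm ((h m * f (t, X t m)) * u m) \<le> norm (L * C * u m)"
            unfolding real_norm_def abs_mult[of _ "u m"] by (rule mult_right_mono) simp
        qed
      qed
      note i2 = ib[OF Di] and i3 = ib[OF leb_Omega.L2_integrable[OF Psi]] and i4 = ib[OF mean_Phi_integrable(1)[OF cone_K_D(5)[OF XK]]]
      \<comment> \<open>The variational inequality at time t, tested with the profile p = f (t, x):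
        nonnegativity, the upper bound and the Lipschitz bound of f are exactly what admissibility
        of the competitor requires.\<close>
      have "(LINT m|leb_Omega. (\<Psi> m - mean_Phi \<Phi> (X t) m - D m) * (h m * f (t, X t m))) \<le> 0"
        by (rule subdiff_K_test[OF XK D(2) h, where p="\<lambda>x. f (t, x)"])
          (use f(2) bd(1) lip[of t _ t] in \<open>auto simp: abs_le_iff\<close>)
      also have "(LINT m|leb_Omega. (\<Psi> m - mean_Phi \<Phi> (X t) m - D m) * (h m * f (t, X t m))) =
        (LINT m|leb_Omega. (h m * f (t, X t m)) * \<Psi> m - (h m * f (t, X t m)) * mean_Phi \<Phi> (X t) m - (h m * f (t, X t m)) * D m)"
        by (intro Bochner_Integration.integral_cong) (auto simp: algebra_simps)
      also have "\<dots> = (LINT m|leb_Omega. (h m * f (t, X t m)) * \<Psi> m) - (LINT m|leb_Omega. (h m * f (t, X t m)) * mean_Phi \<Phi> (X t) m)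
          - (LINT m|leb_Omega. (h m * f (t, X t m)) * D m)"
        using i2 i3 i4 by simp
      finally have var: "\<dots> \<le> 0" .
      have "E' = (LINT m|leb_Omega. h m * Ft t (X t m) + (h m * f (t, X t m)) * D m)"
        unfolding E'_def by (intro Bochner_Integration.integral_cong) (auto simp: algebra_simps)
      also have "\<dots> = (LINT m|leb_Omega. h m * Ft t (X t m)) + (LINT m|leb_Omega. (h m * f (t, X t m)) * D m)"
        using i1 i2 by simp
      finally have "0 \<le> E' + c * Ft t a + w t"
        using var unfolding wt by (simp add: mult_ac)
      then show "\<exists>d\<ge>0. (r has_real_derivative d) (at t)" using dr by blast
    qed
  qed (use T in simp)
  \<comment> \<open>Test functions are supported in the open time interval, so the correction
    contributes nothing at times 0 and T.\<close>
  moreover have "F t x = 0" if "t \<notin> {0<..<T}" for t x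
    using supp_t[OF that] by (simp add: F_def set_lebesgue_integral_def)
  then have "r 0 = 0" "r T = (LINT t:{0<..<T}|lborel. w t)"
    by (simp_all add: r_def E_def set_lebesgue_integral_def)
  ultimately show ?thesis by (simp add: w_def)
qed

end

section \<open>From mass coordinates to the balance law\<close>

text \<open>The layer-cake formula with g the derivative of \<psi>: its total integral is zero,
  which removes the term with \<open>H 0\<close>, and its tail integral from \<open>X m\<close> is -
  \<psi> (X m).\<close>

lemma integral_cdf_composite_deriv:
  fixes X k H \<psi> :: "real \<Rightarrow> real"
  assumes X: "mono_on Omega X" and k: "integrable leb_Omega k"
    and H: "\<And>m. m \<in> {0..1} \<Longrightarrow> H m = H 0 + (LINT z:{0<..<m}|lborel. k z)"
    and \<psi>: "\<psi> \<in> test_functions UNIV"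
  shows "(LINT x|lborel. H (measure (distr leb_Omega borel X) {..x}) * deriv \<psi> x) = - (LINT m|leb_Omega. k m * \<psi> (X m))"
proof -
  obtain R where R: "\<And>x. (\<psi> has_real_derivative deriv \<psi> x) (at x)" "continuous_on UNIV (deriv \<psi>)"
    "\<And>x. \<bar>x\<bar> > R \<Longrightarrow> \<psi> x = 0"
    using test_function_real[OF \<psi>] by blast
  have d: "integrable lborel (deriv \<psi>)" "(LINT x|lborel. deriv \<psi> x) = 0"
    "(LINT x:{a..}|lborel. deriv \<psi> x) = - \<psi> a" for a
    by (rule integral_derivative_compact_support[OF R]; assumption)+
  have "(LINT x|lborel. H (measure (distr leb_Omega borel X) {..x}) * deriv \<psi> x) =
      H 0 * (LINT x|lborel. deriv \<psi> x) + (LINT m|leb_Omega. k m * (LINT x:{X m..}|lborel. deriv \<psi> x))"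
    by (rule layer_cake(2)[OF X k d(1) H])
  then show ?thesis unfolding d(2,3) by simp
qed

text \<open>The integrability part of the layer-cake formula, with g the indicator of the
  interval.\<close>

lemma set_integrable_cdf_composite:
  fixes X k H :: "real \<Rightarrow> real"
  assumes "mono_on Omega X" "integrable leb_Omega k"
    and "\<And>m. m \<in> {0..1} \<Longrightarrow> H m = H 0 + (LINT z:{0<..<m}|lborel. k z)"
  shows "set_integrable lborel {a..b} (\<lambda>x. H (measure (distr leb_Omega borel X) {..x}))"
proof -
  have "integrable lborel (indicator {a..b} :: real \<Rightarrow> real)"
    by (rule integrable_real_indicator) (auto simp: emeasure_lborel_Icc_eq)
  from layer_cake(1)[OF assms(1,2) this assms(3)] show ?thesis
    by (simp add: set_integrable_def mult.commute)
qed

lemma distr_derivative_cdf: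
  assumes X: "mono_on Omega X"
  defines "\<rho> \<equiv> distr leb_Omega borel X"
  shows "distr_derivative (\<lambda>x. measure \<rho> {..x}) \<rho> (null_measure borel)"
proof -
  note Xm = mono_on_borel_measurable_leb_Omega[OF X]
  \<comment> \<open>The identity is the primitive of the weight 1, so the distribution function
    itself is an instance of the composite formula.\<close>
  have H: "m = 0 + (LINT z:{0<..<m}|lborel. 1)" if "m \<in> {0..1}" for m :: real
    using that by (simp add: set_lebesgue_integral_def)
  interpret \<rho>: prob_space \<rho> unfolding \<rho>_def by (rule leb_Omega.prob_space_distr[OF Xm])
  show ?thesis
    unfolding distr_derivative_def
  proof (intro conjI allI ballI)
    show "finite_measure \<rho>" by unfold_locales
    show "finite_measure (null_measure borel :: real measure)" by (rule finite_measureI) simp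
    show "set_integrable lborel {a..b} (\<lambda>x. measure \<rho> {..x})" for a b
      unfolding \<rho>_def by (rule set_integrable_cdf_composite[OF X, of "\<lambda>_. 1" "\<lambda>m. m"]) (use H in auto)
    fix \<psi> :: "real \<Rightarrow> real" assume \<psi>: "\<psi> \<in> test_functions UNIV"
    obtain B where B: "continuous_on UNIV \<psi>" using test_function_bounded[OF \<psi>] by blast
    have "(LINT x|\<rho>. \<psi> x) = (LINT m|leb_Omega. \<psi> (X m))"
      unfolding \<rho>_def by (rule integral_distr[OF Xm borel_measurable_continuous_onI[OF B]])
    moreover have "(LINT x|lborel. measure \<rho> {..x} * deriv \<psi> x) = - (LINT m|leb_Omega. 1 * \<psi> (X m))"
      unfolding \<rho>_def by (rule integral_cdf_composite_deriv[OF X _ _ \<psi>, of "\<lambda>_. 1" "\<lambda>m. m"]) (use H in auto)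
    moreover have "(LINT x|null_measure borel. \<psi> x) = 0"
      by (intro integral_eq_zero_AE AE_I[of _ _ UNIV]) auto
    ultimately show "(LINT x|\<rho>. \<psi> x) - (LINT x|null_measure borel. \<psi> x) = - (LINT x|lborel. measure \<rho> {..x} * deriv \<psi> x)"
      by simp
  qed (simp_all add: \<rho>_def)
qed

text \<open>The distributional derivative of \<open>\<eta> \<circ> M\<^sub>t\<close> is the image of the signed measure \<open>h dm\<close> under \<open>X\<^sub>t\<close>;
  its two parts are obtained from \<open>k = h\<close> and \<open>k = - h\<close>.\<close>

definition entropy_measure :: "(real \<Rightarrow> real) \<Rightarrow> (real \<Rightarrow> real) \<Rightarrow> real measure" where
  "entropy_measure k X = distr (density leb_Omega (\<lambda>m. ennreal (max 0 (k m)))) borel X"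

lemma distr_derivative_cdf_composite:
  assumes X: "mono_on Omega X" and k: "integrable leb_Omega k"
    and H: "\<And>m. m \<in> {0..1} \<Longrightarrow> H m = H 0 + (LINT z:{0<..<m}|lborel. k z)"
  shows "distr_derivative (\<lambda>x. H (measure (distr leb_Omega borel X) {..x}))
    (entropy_measure k X) (entropy_measure (\<lambda>m. - k m) X)"
proof -
  note Xm[measurable] = mono_on_borel_measurable_leb_Omega[OF X]
  have km[measurable]: "k \<in> borel_measurable leb_Omega" using k by auto
  have kp: "integrable leb_Omega (\<lambda>m. max 0 (k m))" "integrable leb_Omega (\<lambda>m. max 0 (- k m))"
    using k by auto
  note p = pushforward_density[OF kp(1) _ Xm, folded entropy_measure_def]
  note n = pushforward_density[OF kp(2) _ Xm, folded entropy_measure_def[of "\<lambda>m. - k m"]]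
  show ?thesis
    unfolding distr_derivative_def
  proof (intro conjI allI ballI)
    show "set_integrable lborel {a..b} (\<lambda>x. H (measure (distr leb_Omega borel X) {..x}))" for a b
      by (rule set_integrable_cdf_composite[OF X k H])
    fix \<psi> :: "real \<Rightarrow> real" assume \<psi>: "\<psi> \<in> test_functions UNIV"
    obtain B where B: "\<And>x. \<bar>\<psi> x\<bar> \<le> B" "continuous_on UNIV \<psi>" using test_function_bounded[OF \<psi>] by blast
    have \<psi>m[measurable]: "\<psi> \<in> borel_measurable borel" by (rule borel_measurable_continuous_onI[OF B(2)])
    have i: "integrable leb_Omega (\<lambda>m. u m * \<psi> (X m))" if u: "integrable leb_Omega u" for u
    proof (rule Bochner_Integration.integrable_bound)
      show "integrable leb_Omega (\<lambda>m. B * u m)" using u by auto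
      show "(\<lambda>m. u m * \<psi> (X m)) \<in> borel_measurable leb_Omega" using u by measurable
      have "\<bar>u m\<bar> * \<bar>\<psi> (X m)\<bar> \<le> \<bar>B\<bar> * \<bar>u m\<bar>" for m
        using mult_right_mono[OF order_trans[OF B(1)[of "X m"] abs_ge_self], of "\<bar>u m\<bar>"] by (simp add: mult.commute)
      then show "AE m in leb_Omega. norm (u m * \<psi> (X m)) \<le> norm (B * u m)"
        by (intro AE_I2) (simp add: abs_mult)
    qed
    have "(LINT x|entropy_measure k X. \<psi> x) - (LINT x|entropy_measure (\<lambda>m. - k m) X. \<psi> x) =
      (LINT m|leb_Omega. max 0 (k m) * \<psi> (X m) - max 0 (- k m) * \<psi> (X m))"
      using p(3)[OF _ \<psi>m] n(3)[OF _ \<psi>m] Bochner_Integration.integral_diff[OF i[OF kp(1)] i[OF kp(2)]] by simp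
    also have "\<dots> = (LINT m|leb_Omega. k m * \<psi> (X m))"
      by (intro Bochner_Integration.integral_cong) (auto simp: max_def)
    also have "\<dots> = - (LINT x|lborel. H (measure (distr leb_Omega borel X) {..x}) * deriv \<psi> x)"
      using integral_cdf_composite_deriv[OF X k H \<psi>] by simp
    finally show "(LINT x|entropy_measure k X. \<psi> x) - (LINT x|entropy_measure (\<lambda>m. - k m) X. \<psi> x) =
      - (LINT x|lborel. H (measure (distr leb_Omega borel X) {..x}) * deriv \<psi> x)" .
  qed (use p(1,2) n(1,2) in auto)
qed

text \<open>At almost every mass the derivative of \<eta> is \<open>h\<close> and that of
  \<open>A\<close> is \<Psi>, the latter by Lebesgue differentiation. Since derivatives are unique,
  the almost-everywhere identity for q identifies its derivative as h \<Psi>. As \<eta> is Lipschitz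
  and q absolutely continuous, both are recovered from these derivatives by integration.\<close>

lemma entropy_pair_representation:
  assumes pair: "entropy_pair A \<eta> q" and \<Psi>: "\<Psi> \<in> L2 leb_Omega"
    and A: "\<And>m. m \<in> {0..1} \<Longrightarrow> A m = (LINT z:{0<..<m}|lborel. \<Psi> z)"
  obtains h L where "mono_on Omega h" "\<And>m. m \<in> Omega \<Longrightarrow> \<bar>h m\<bar> \<le> L"
    "\<And>m. m \<in> Omega \<Longrightarrow> continuous (at_right m) h"
    "\<And>m. m \<in> {0..1} \<Longrightarrow> \<eta> m = \<eta> 0 + (LINT z:{0<..<m}|lborel. h z)"
    "\<And>m. m \<in> {0..1} \<Longrightarrow> q m = q 0 + (LINT z:{0<..<m}|lborel. h z * \<Psi> z)"
proof -
  obtain L where lip: "L-lipschitz_on {0..1} \<eta>" and conv: "convex_on {0..1} \<eta>"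
    and acq: "abs_continuous_curve dist 0 1 q"
    and der: "AE m in lborel. m \<in> {0<..<1} \<longrightarrow> (\<exists>\<eta>' A'. (\<eta> has_real_derivative \<eta>') (at m) \<and>
        (A has_real_derivative A') (at m) \<and> (q has_real_derivative \<eta>' * A') (at m))"
    using pair by (auto simp: entropy_pair_def)
  obtain h where h: "mono_on Omega h" "\<And>m. m \<in> Omega \<Longrightarrow> \<bar>h m\<bar> \<le> L"
    "\<And>m. m \<in> Omega \<Longrightarrow> continuous (at_right m) h"
    "\<And>m d. m \<in> Omega \<Longrightarrow> (\<eta> has_real_derivative d) (at m) \<Longrightarrow> d = h m"
    using convex_right_derivative[OF lip conv] unfolding Omega_def by blast
  have hm: "h \<in> borel_measurable leb_Omega" by (rule mono_on_borel_measurable_leb_Omega[OF h(1)])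
  have hi: "set_integrable lborel {0<..<1} h"
    using leb_Omega_integrable_bounded[OF hm h(2)] by (simp add: integrable_leb_Omega)
  have hPi: "set_integrable lborel {0<..<1} (\<lambda>z. h z * \<Psi> z)"
    using leb_Omega.L2_integrable[OF L2_mult_bounded[OF \<Psi> hm, of L]] h(2) by (simp add: integrable_leb_Omega)
  have Pi: "set_integrable lborel {0<..<1} \<Psi>"
    using leb_Omega.L2_integrable[OF \<Psi>] by (simp add: integrable_leb_Omega)
  \<comment> \<open>\<open>A\<close> is known only on [0, 1], so its derivative is compared with
    that of the integral inside the open interval.\<close>
  have dA: "AE m in lborel. m \<in> {0<..<1} \<longrightarrow> (\<forall>A'. (A has_real_derivative A') (at m) \<longrightarrow> A' = \<Psi> m)"
    using AE_has_derivative_integral[OF Pi]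
  proof (eventually_elim, intro impI allI)
    fix m A' assume dm: "m \<in> {0<..<1} \<longrightarrow> ((\<lambda>y. LINT z:{0<..<y}|lborel. \<Psi> z) has_real_derivative \<Psi> m) (at m)"
      and m: "m \<in> {0<..<1}" and A': "(A has_real_derivative A') (at m)"
    have "((\<lambda>y. LINT z:{0<..<y}|lborel. \<Psi> z) has_real_derivative A') (at m)"
      by (rule has_field_derivative_transform_within_open[OF A' open_greaterThanLessThan m]) (use A in auto)
    then show "A' = \<Psi> m" using dm m DERIV_unique by blast
  qed
  have "abs_continuous_curve dist 0 1 \<eta>"
    by (rule abs_continuous_curve_bound[OF abs_continuous_curve_id abs_continuous_curve_id, where K=L and L=0])
      (use lipschitz_onD[OF lip] lipschitz_on_nonneg[OF lip] in auto)
  moreover have "AE m in lborel. m \<in> {0<..<1} \<longrightarrow> (\<eta> has_real_derivative h m) (at m)"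
    using der by eventually_elim (use h(4) in \<open>force simp: Omega_def\<close>)
  ultimately have "\<eta> m = \<eta> 0 + (LINT z:{0<..<m}|lborel. h z)" if "m \<in> {0..1}" for m
    using that by (rule abs_continuous_FTC[OF _ hi])
  moreover have "AE m in lborel. m \<in> {0<..<1} \<longrightarrow> (q has_real_derivative h m * \<Psi> m) (at m)"
    using der dA
  proof (eventually_elim, intro impI)
    fix m assume 1: "m \<in> {0<..<1} \<longrightarrow> (\<exists>\<eta>' A'. (\<eta> has_real_derivative \<eta>') (at m) \<and>
        (A has_real_derivative A') (at m) \<and> (q has_real_derivative \<eta>' * A') (at m))"
      and 2: "m \<in> {0<..<1} \<longrightarrow> (\<forall>A'. (A has_real_derivative A') (at m) \<longrightarrow> A' = \<Psi> m)" and m: "m \<in> {0<..<1}"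
    obtain e A' where *: "(\<eta> has_real_derivative e) (at m)" "(A has_real_derivative A') (at m)"
      "(q has_real_derivative e * A') (at m)" using 1 m by blast
    have "e = h m" by (rule h(4)[OF _ *(1)]) (use m in \<open>simp add: Omega_def\<close>)
    moreover have "A' = \<Psi> m" using 2 m *(2) by blast
    ultimately show "(q has_real_derivative h m * \<Psi> m) (at m)" using *(3) by simp
  qed
  then have "q m = q 0 + (LINT z:{0<..<m}|lborel. h z * \<Psi> z)" if "m \<in> {0..1}" for m
    using that by (rule abs_continuous_FTC[OF acq hPi])
  ultimately show thesis using h(1-3) that by blast
qed

context lagrangian_curve
begin

text \<open>The layer-cake formula is applied to \<eta> with the time derivative of f and to q with
  its space derivative; in the second case \<open>q 0\<close> drops out and the tail integral is -
  f. The source term becomes a mass integral because \<open>conv\<close> evaluated at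
  \<open>X t m\<close> is \<open>mean_Phi\<close> at m. The separate integrability claims ensure
  that none of the split integrals takes a default value.\<close>

lemma weak_integrand_Lagrangian:
  assumes t: "0 \<le> t" and f: "f \<in> test_functions ({0<..<T} \<times> UNIV)"
    and h: "h \<in> borel_measurable leb_Omega" "\<And>m. m \<in> Omega \<Longrightarrow> \<bar>h m\<bar> \<le> L"
    and \<eta>: "\<And>m. m \<in> {0..1} \<Longrightarrow> \<eta> m = \<eta> 0 + (LINT z:{0<..<m}|lborel. h z)"
    and q: "\<And>m. m \<in> {0..1} \<Longrightarrow> q m = q 0 + (LINT z:{0<..<m}|lborel. h z * \<Psi> z)"
    and \<rho>: "\<rho> t = distr leb_Omega borel (X t)" and M: "\<And>x. M t x = measure (\<rho> t) {..x}"
    and \<mu>: "\<mu> t = entropy_measure h (X t)" and \<nu>: "\<nu> t = entropy_measure (\<lambda>m. - h m) (X t)"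
  shows "integrable lborel (flux_integrand \<eta> q M f t)"
    "integrable (\<mu> t) (source_integrand \<Phi> \<rho> f t)" "integrable (\<nu> t) (source_integrand \<Phi> \<rho> f t)"
    "weak_integrand \<Phi> \<eta> q M \<rho> \<mu> \<nu> f t = entropy_production (\<eta> 0) h f t"
proof -
  let ?ft = "dir_deriv (1, 0) f" and ?fx = "dir_deriv (0, 1) f"
  obtain R C where RC: "0 \<le> R" "0 \<le> C"
    and dx: "\<And>t x. ((\<lambda>x. f (t, x)) has_real_derivative ?fx (t, x)) (at x)"
    and cont: "continuous_on UNIV f" "continuous_on UNIV ?ft" "continuous_on UNIV ?fx"
    and supp: "\<And>t x. R < \<bar>x\<bar> \<Longrightarrow> f (t, x) = 0" "\<And>t x. R < \<bar>x\<bar> \<Longrightarrow> ?ft (t, x) = 0"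
    and bd: "\<And>z. \<bar>f z\<bar> \<le> C" "\<And>z. \<bar>?ft z\<bar> \<le> C"
    and lip: "\<And>s t x y. \<bar>f (s, y) - f (t, x)\<bar> \<le> C * (\<bar>s - t\<bar> + \<bar>y - x\<bar>)"
    and taylor: "\<And>s t x. \<bar>f (s, x) - f (t, x) - (s - t) * ?ft (t, x)\<bar> \<le> C * (s - t)\<^sup>2"
    by (rule test_function_plane[OF f]) (rule that; assumption)
  have "\<forall>t x. R < \<bar>x\<bar> \<longrightarrow> f (t, x) = 0" "\<forall>t x. R < \<bar>x\<bar> \<longrightarrow> ?ft (t, x) = 0"
    using supp by auto
  note te = tail_integral_expansion[OF RC cont(1,2) this bd lip taylor]
  note K = cone_K_D[OF cone[OF t]]
  have slice: "continuous_on UNIV (\<lambda>x. g (t, x))" if "continuous_on UNIV g" for g :: "real \<times> real \<Rightarrow> real"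
    by (rule continuous_on_compose2[OF that]) (auto intro!: continuous_intros)
  have dfx: "integrable lborel (\<lambda>x. ?fx (t, x))" "(LINT x|lborel. ?fx (t, x)) = 0"
    "(LINT x:{a..}|lborel. ?fx (t, x)) = - f (t, a)" for a
    by (rule integral_derivative_compact_support[OF dx slice[OF cont(3)] supp(1)]; assumption)+
  have hi: "integrable leb_Omega h" by (rule leb_Omega_integrable_bounded[OF h])
  have hPi: "integrable leb_Omega (\<lambda>z. h z * \<Psi> z)"
    using leb_Omega.L2_integrable[OF L2_mult_bounded[OF Psi h(1), of L]] h(2) by simp
  have N: "M t x = measure (distr leb_Omega borel (X t)) {..x}" for x by (simp add: M \<rho>)
  have i1: "integrable lborel (\<lambda>x. \<eta> (M t x) * ?ft (t, x))"
    unfolding N by (rule layer_cake(1)[OF K(2) hi te(8) \<eta>])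
  have i2: "integrable lborel (\<lambda>x. q (M t x) * ?fx (t, x))"
    unfolding N by (rule layer_cake(1)[OF K(2) hPi dfx(1) q])
  show "integrable lborel (flux_integrand \<eta> q M f t)"
    unfolding flux_integrand_def[abs_def] by (rule Bochner_Integration.integrable_add[OF i1 i2])
  have e1: "(LINT x|lborel. \<eta> (M t x) * ?ft (t, x)) = \<eta> 0 * (LINT x|lborel. ?ft (t, x)) +
      (LINT m|leb_Omega. h m * (LINT x:{X t m..}|lborel. ?ft (t, x)))"
    unfolding N by (rule layer_cake(2)[OF K(2) hi te(8) \<eta>])
  have e2: "(LINT x|lborel. q (M t x) * ?fx (t, x)) = q 0 * (LINT x|lborel. ?fx (t, x)) +
      (LINT m|leb_Omega. h m * \<Psi> m * (LINT x:{X t m..}|lborel. ?fx (t, x)))"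
    unfolding N by (rule layer_cake(2)[OF K(2) hPi dfx(1) q])
  have flux: "(LINT x|lborel. flux_integrand \<eta> q M f t x) =
    \<eta> 0 * (LINT x|lborel. ?ft (t, x)) + (LINT m|leb_Omega. h m * (LINT x:{X t m..}|lborel. ?ft (t, x)))
    - (LINT m|leb_Omega. h m * \<Psi> m * f (t, X t m))"
    unfolding flux_integrand_def Bochner_Integration.integral_add[OF i1 i2] e1 e2 dfx(2,3) by simp
  have Xm[measurable]: "X t \<in> borel_measurable leb_Omega" by (rule K(4))
  have conv: "conv \<Phi> (\<rho> t) x = (LINT \<omega>|leb_Omega. \<Phi> (x - X t \<omega>))" for x
    unfolding conv_def \<rho> by (rule integral_distr) auto
  have fm[measurable]: "(\<lambda>x. f (t, x)) \<in> borel_measurable borel"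
    by (rule borel_measurable_continuous_onI[OF slice[OF cont(1)]])
  have sm: "source_integrand \<Phi> \<rho> f t \<in> borel_measurable borel"
    unfolding source_integrand_def[abs_def] conv by measurable
  have sX: "source_integrand \<Phi> \<rho> f t (X t m) = f (t, X t m) * mean_Phi \<Phi> (X t) m" for m
    by (simp add: source_integrand_def conv mean_Phi_def)
  note mPi = mean_Phi_integrable(1)[OF K(5)]
  have i: "integrable leb_Omega (\<lambda>m. u m * source_integrand \<Phi> \<rho> f t (X t m))"
    if u: "u \<in> borel_measurable leb_Omega" "\<And>m. m \<in> Omega \<Longrightarrow> \<bar>u m\<bar> \<le> L" for u
  proof (rule Bochner_Integration.integrable_bound)
    show "integrable leb_Omega (\<lambda>m. L * C * mean_Phi \<Phi> (X t) m)" using mPi by auto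
    show "(\<lambda>m. u m * source_integrand \<Phi> \<rho> f t (X t m)) \<in> borel_measurable leb_Omega"
      by (rule borel_measurable_times[OF u(1) measurable_compose[OF Xm sm]])
    show "AE m in leb_Omega. norm (u m * source_integrand \<Phi> \<rho> f t (X t m)) \<le> norm (L * C * mean_Phi \<Phi> (X t) m)"
    proof (rule AE_I2)
      fix m assume m: "m \<in> space leb_Omega"
      then have "0 \<le> L" using u(2)[of m] by simp
      then have "\<bar>u m\<bar> * \<bar>f (t, X t m)\<bar> \<le> L * C" using u(2)[of m] m bd(1) by (intro mult_mono) auto
      then have "\<bar>u m\<bar> * \<bar>f (t, X t m)\<bar> * \<bar>mean_Phi \<Phi> (X t) m\<bar> \<le> L * C * \<bar>mean_Phi \<Phi> (X t) m\<bar>"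
        by (rule mult_right_mono) simp
      then show "norm (u m * source_integrand \<Phi> \<rho> f t (X t m)) \<le> norm (L * C * mean_Phi \<Phi> (X t) m)"
        using \<open>0 \<le> L\<close> RC by (simp add: sX abs_mult mult.assoc)
    qed
  qed
  have hp: "(\<lambda>m. max 0 (h m)) \<in> borel_measurable leb_Omega" "(\<lambda>m. max 0 (- h m)) \<in> borel_measurable leb_Omega"
    using h(1) by auto
  have hb: "\<bar>max 0 (h m)\<bar> \<le> L" "\<bar>max 0 (- h m)\<bar> \<le> L" if "m \<in> Omega" for m
    using h(2)[OF that] by auto
  have ip: "integrable leb_Omega (\<lambda>m. max 0 (h m) * source_integrand \<Phi> \<rho> f t (X t m))"
    and i_n: "integrable leb_Omega (\<lambda>m. max 0 (- h m) * source_integrand \<Phi> \<rho> f t (X t m))"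
    by (rule i[OF hp(1) hb(1)], assumption) (rule i[OF hp(2) hb(2)], assumption)
  have kp: "integrable leb_Omega (\<lambda>m. max 0 (h m))" "integrable leb_Omega (\<lambda>m. max 0 (- h m))"
    using hi by auto
  note p = pushforward_density[OF kp(1) _ Xm, folded entropy_measure_def]
  note n = pushforward_density[OF kp(2) _ Xm, folded entropy_measure_def[of "\<lambda>m. - h m"]]
  show "integrable (\<mu> t) (source_integrand \<Phi> \<rho> f t)" "integrable (\<nu> t) (source_integrand \<Phi> \<rho> f t)"
    unfolding \<mu> \<nu> using p(4)[OF _ sm] n(4)[OF _ sm] ip i_n by simp_all
  have "(LINT x|\<mu> t. source_integrand \<Phi> \<rho> f t x) - (LINT x|\<nu> t. source_integrand \<Phi> \<rho> f t x) =
    (LINT m|leb_Omega. max 0 (h m) * source_integrand \<Phi> \<rho> f t (X t m) - max 0 (- h m) * source_integrand \<Phi> \<rho> f t (X t m))"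
    unfolding \<mu> \<nu>
    using p(3)[OF _ sm] n(3)[OF _ sm] Bochner_Integration.integral_diff[OF ip i_n] by simp
  \<comment> \<open>The positive and negative parts recombine to h, so the result is the integral
    against the signed image measure.\<close>
  also have "\<dots> = (LINT m|leb_Omega. h m * f (t, X t m) * mean_Phi \<Phi> (X t) m)"
    by (intro Bochner_Integration.integral_cong) (auto simp: max_def sX)
  finally show "weak_integrand \<Phi> \<eta> q M \<rho> \<mu> \<nu> f t = entropy_production (\<eta> 0) h f t"
    unfolding weak_integrand_def flux entropy_production_def by simp
qed

text \<open>The two measures representing the derivative of \<eta> composed with \<open>M t\<close>
  are built from \<open>h\<close> and \<open>X t\<close> alone, so one choice serves all test
  functions, as the order of the quantifiers demands.\<close>

theorem entropy_solution_cdf: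
  assumes T: "0 < T" and A: "\<And>m. m \<in> {0..1} \<Longrightarrow> A m = (LINT z:{0<..<m}|lborel. \<Psi> z)"
    and \<rho>: "\<And>t. 0 \<le> t \<Longrightarrow> \<rho> t = distr leb_Omega borel (X t)"
    and M: "\<And>t x. 0 \<le> t \<Longrightarrow> M t x = measure (\<rho> t) {..x}"
  shows "entropy_solution \<Phi> A T M \<rho>"
  unfolding entropy_solution_def
proof (intro conjI ballI allI impI)
  fix t assume "t \<in> {0..T}"
  then have t: "0 \<le> t" by simp
  note K = cone_K_D[OF cone[OF t]]
  interpret \<rho>: prob_space "\<rho> t" unfolding \<rho>[OF t] by (rule leb_Omega.prob_space_distr[OF K(4)])
  show "M t x \<in> {0..1}" for x by (simp add: M[OF t])
  have "sets (\<rho> t) = sets borel" by (simp add: \<rho>[OF t])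
  then have "{..y} \<in> sets (\<rho> t)" for y by simp
  then show "mono (M t)" unfolding M[OF t] by (intro monoI \<rho>.finite_measure_mono) auto
  have "M t = (\<lambda>x. measure (\<rho> t) {..x})" using M[OF t] by auto
  then show "distr_derivative (M t) (\<rho> t) (null_measure borel)"
    using distr_derivative_cdf[OF K(2)] by (simp add: \<rho>[OF t])
  show "integrable (\<rho> t) (\<lambda>y. \<Phi> (x - y))" for x
    unfolding \<rho>[OF t] using Phi_integrable(1)[OF K(5), of x] K(4) by (subst integrable_distr_eq) auto
next
  fix \<eta> q assume pair: "entropy_pair A \<eta> q"
  obtain h L where h: "mono_on Omega h" "\<And>m. m \<in> Omega \<Longrightarrow> \<bar>h m\<bar> \<le> L"
    "\<And>m. m \<in> Omega \<Longrightarrow> continuous (at_right m) h"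
    and \<eta>: "\<And>m. m \<in> {0..1} \<Longrightarrow> \<eta> m = \<eta> 0 + (LINT z:{0<..<m}|lborel. h z)"
    and q: "\<And>m. m \<in> {0..1} \<Longrightarrow> q m = q 0 + (LINT z:{0<..<m}|lborel. h z * \<Psi> z)"
  proof (rule entropy_pair_representation[OF pair Psi])
    show "A m = (LINT z:{0<..<m}|lborel. \<Psi> z)" if "m \<in> {0..1}" for m using that by (rule A)
  qed (rule that; assumption)
  note hm = mono_on_borel_measurable_leb_Omega[OF h(1)]
  have hi: "integrable leb_Omega h" by (rule leb_Omega_integrable_bounded[OF hm h(2)])
  define \<mu> where "\<mu> t = entropy_measure h (X t)" for t
  define \<nu> where "\<nu> t = entropy_measure (\<lambda>m. - h m) (X t)" for t
  show "\<exists>\<mu> \<nu>. (\<forall>t\<in>{0<..<T}. distr_derivative (\<lambda>x. \<eta> (M t x)) (\<mu> t) (\<nu> t)) \<and>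
           (\<forall>f\<in>test_functions ({0<..<T} \<times> UNIV). (\<forall>z. 0 \<le> f z) \<longrightarrow>
              (\<forall>t\<in>{0<..<T}.
                 integrable lborel (flux_integrand \<eta> q M f t) \<and>
                 integrable (\<mu> t) (source_integrand \<Phi> \<rho> f t) \<and>
                 integrable (\<nu> t) (source_integrand \<Phi> \<rho> f t)) \<and>
              set_integrable lborel {0<..<T} (weak_integrand \<Phi> \<eta> q M \<rho> \<mu> \<nu> f) \<and>
              0 \<le> (LINT t:{0<..<T}|lborel. weak_integrand \<Phi> \<eta> q M \<rho> \<mu> \<nu> f t))"
  proof (rule exI[of _ \<mu>], rule exI[of _ \<nu>], intro conjI ballI impI)
    fix t assume "t \<in> {0<..<T}"
    then have t: "0 \<le> t" by simp
    show "distr_derivative (\<lambda>x. \<eta> (M t x)) (\<mu> t) (\<nu> t)"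
      using distr_derivative_cdf_composite[OF cone_K_D(2)[OF cone[OF t]] hi \<eta>]
      by (simp add: \<mu>_def \<nu>_def M[OF t] \<rho>[OF t])
  next
    fix f :: "real \<times> real \<Rightarrow> real" assume f: "f \<in> test_functions ({0<..<T} \<times> UNIV)" "\<forall>z. 0 \<le> f z"
    have weak: "integrable lborel (flux_integrand \<eta> q M f t)"
      "integrable (\<mu> t) (source_integrand \<Phi> \<rho> f t)" "integrable (\<nu> t) (source_integrand \<Phi> \<rho> f t)"
      "weak_integrand \<Phi> \<eta> q M \<rho> \<mu> \<nu> f t = entropy_production (\<eta> 0) h f t" if "t \<in> {0<..<T}" for t
      by (rule weak_integrand_Lagrangian[OF _ f(1) hm h(2) \<eta> q \<rho> M \<mu>_def \<nu>_def]; use that in simp)+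
    show "integrable lborel (flux_integrand \<eta> q M f t)"
      "integrable (\<mu> t) (source_integrand \<Phi> \<rho> f t)" "integrable (\<nu> t) (source_integrand \<Phi> \<rho> f t)" if "t \<in> {0<..<T}" for t
      by (rule weak(1-3)[OF that])+
    show "set_integrable lborel {0<..<T} (weak_integrand \<Phi> \<eta> q M \<rho> \<mu> \<nu> f)"
      using entropy_production_integrable[OF T f(1) hm h(2), where c="\<eta> 0"]
      by (rule iffD2[OF set_integrable_cong, rotated -1]) (auto simp: weak(4))
    have "(LINT t:{0<..<T}|lborel. weak_integrand \<Phi> \<eta> q M \<rho> \<mu> \<nu> f t) = (LINT t:{0<..<T}|lborel. entropy_production (\<eta> 0) h f t)"
      by (rule set_lebesgue_integral_cong) (auto simp: weak(4))
    also have "0 \<le> \<dots>" using f by (intro entropy_production_nonneg[OF T _ _ h]) auto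
    finally show "0 \<le> (LINT t:{0<..<T}|lborel. weak_integrand \<Phi> \<eta> q M \<rho> \<mu> \<nu> f t)" .
  qed
qed

end

section \<open>Verification of the assumptions for the given initial data\<close>

theorem theorem5p3:
  fixes \<phi> \<Phi> vbar psibar Mbar Xbar Vbar Psibar A :: "real \<Rightarrow> real"
    and rhobar :: "real measure"
    and X M :: "real \<Rightarrow> real \<Rightarrow> real"
    and \<rho> :: "real \<Rightarrow> real measure"
  assumes protocol: "protocol \<phi>"
    and Phi: "\<Phi> = primitive \<phi>"
    and data: "(rhobar, vbar) \<in> T2"
    and psibar: "psibar = (\<lambda>x. vbar x + conv \<Phi> rhobar x)"
    and Mbar: "Mbar = (\<lambda>x. measure rhobar {..x})"
    and Xbar: "Xbar = rearrangement rhobar"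
    and Vbar: "Vbar = vbar \<circ> Xbar"
    and Psibar: "Psibar = psibar \<circ> Xbar"
    and A: "\<And>m. m \<in> {0..1} \<Longrightarrow> A m = (LBINT \<omega>=ereal 0..ereal m. Psibar \<omega>)"
    and X: "lagrangian_solution \<Phi> Xbar Vbar X"
    and rho: "\<And>t. t \<ge> 0 \<Longrightarrow> \<rho> t = distr leb_Omega borel (X t)"
    and M: "\<And>t x. t \<ge> 0 \<Longrightarrow> M t x = measure (\<rho> t) {..x}"
  shows "psibar \<in> L2 rhobar \<and>
         (\<forall>T>0. entropy_solution \<Phi> A T M \<rho>) \<and>
         M 0 = Mbar"
proof -
  obtain C where C: "0 \<le> C" "\<And>x. \<bar>\<Phi> x\<bar> \<le> C * (1 + \<bar>x\<bar>)"
    using protocol_primitive(2)[OF protocol] by (auto simp: Phi)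
  interpret linear_growth \<Phi> C
    using C borel_measurable_mono[OF protocol_primitive(1)[OF protocol]] by unfold_locales (auto simp: Phi)
  have rb: "prob_space rhobar" "sets rhobar = sets borel" "integrable rhobar (\<lambda>x. x\<^sup>2)" and vL: "vbar \<in> L2 rhobar"
    using data by (auto simp: T2_def P2_def)
  interpret rhobar: prob_space rhobar by (rule rb(1))
  have cone: "X t \<in> cone_K" if "0 \<le> t" for t using X that by (simp add: lagrangian_solution_def)
  have X0: "X 0 m = Xbar m" if "m \<in> Omega" for m using X that by (simp add: lagrangian_solution_def)
  note K0 = cone_K_D[OF cone[of 0, simplified]]
  \<comment> \<open>The curve starts at the rearrangement of the initial measure, at least on
    \<open>Omega\<close>; this gives the initial value of \<open>M\<close> and lets integrals
    against \<open>rhobar\<close> be moved to the mass interval.\<close>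
  have rhobar_eq: "distr leb_Omega borel (X 0) = rhobar"
    by (rule distr_rearrangement[OF rb(1,2) K0(2)]) (simp add: X0 Xbar)
  have conv: "conv \<Phi> rhobar x = (LINT \<omega>|leb_Omega. \<Phi> (x - X 0 \<omega>))" for x
    unfolding conv_def rhobar_eq[symmetric] using K0(4) by (rule integral_distr) measurable
  have mb: "borel_measurable rhobar = borel_measurable borel"
    by (rule measurable_cong_sets[OF rb(2) refl])
  have psi: "psibar \<in> L2 rhobar"
  proof -
    note [measurable] = K0(4)
    have cm: "conv \<Phi> rhobar \<in> borel_measurable rhobar"
      unfolding mb conv[abs_def] by measurable
    have idL: "(\<lambda>x. x) \<in> L2 rhobar" using rb by (simp add: L2_def mb)
    \<comment> \<open>A square-integrable majorant of the convolution: its growth is linear in x,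
      and \<open>rhobar\<close> has a finite second moment.\<close>
    have "(\<lambda>x. C * (1 + \<bar>x\<bar> + (LINT \<omega>|leb_Omega. \<bar>X 0 \<omega>\<bar>))) \<in> L2 rhobar"
      by (intro L2_cmult L2_add rhobar.L2_const L2_abs idL)
    then have "conv \<Phi> rhobar \<in> L2 rhobar"
      by (rule L2_dominated[OF _ cm]) (use Phi_integrable(2)[OF K0(5)] in \<open>simp add: conv\<close>)
    then show ?thesis unfolding psibar by (rule L2_add[OF vL])
  qed
  \<comment> \<open>The forcing in the Lagrangian evolution is the density of the flux. The identity
    holds for every real m: both sides are evaluated at the same position \<open>Xbar m\<close>, and
    the integral defining \<open>mean_Phi\<close> only sees \<open>Omega\<close>.\<close>
  have Psi_eq: "Vbar m + mean_Phi \<Phi> Xbar m = Psibar m" for m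
  proof -
    have "mean_Phi \<Phi> Xbar m = (LINT \<omega>|leb_Omega. \<Phi> (Xbar m - X 0 \<omega>))"
      unfolding mean_Phi_def by (rule Bochner_Integration.integral_cong) (auto simp: X0)
    then show ?thesis by (simp add: Vbar Psibar psibar conv)
  qed
  \<comment> \<open>Change of variables from \<open>rhobar\<close> to the mass interval. It goes
    through \<open>X 0\<close>, whose measurability is known from the cone, and \<open>Xbar\<close>
    is substituted on \<open>Omega\<close> at the end.\<close>
  have PsiL: "Psibar \<in> L2 leb_Omega"
  proof -
    have "psibar \<in> borel_measurable borel" "integrable rhobar (\<lambda>x. (psibar x)\<^sup>2)"
      using psi by (auto simp: L2_def mb)
    then have "integrable leb_Omega (\<lambda>m. (psibar (X 0 m))\<^sup>2)" "(\<lambda>m. psibar (X 0 m)) \<in> borel_measurable leb_Omega"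
      using integrable_distr_eq[OF K0(4), of "\<lambda>x. (psibar x)\<^sup>2"] measurable_compose[OF K0(4)]
      by (auto simp: rhobar_eq)
    then have "(\<lambda>m. psibar (X 0 m)) \<in> L2 leb_Omega" by (simp add: L2_def)
    moreover have "(\<lambda>m. psibar (X 0 m)) \<in> L2 leb_Omega \<longleftrightarrow> Psibar \<in> L2 leb_Omega"
      by (rule L2_cong) (simp add: Psibar X0)
    ultimately show ?thesis by simp
  qed
  interpret lagrangian_curve \<Phi> C Psibar X
  proof unfold_locales
    show "AE t in lborel. 0 < t \<longrightarrow> (\<exists>D. has_L2_derivative X D t \<and>
      (\<lambda>m. Psibar m - mean_Phi \<Phi> (X t) m - D m) \<in> subdiff_K (X t))"
      using X by (simp add: lagrangian_solution_def Psi_eq)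
    show "abs_continuous_curve (L2_dist leb_Omega) 0 b X" if "0 < b" for b
      using X that by (simp add: lagrangian_solution_def)
  qed (fact PsiL, rule cone)
  have A': "A m = (LINT z:{0<..<m}|lborel. Psibar z)" if "m \<in> {0..1}" for m
    using A[OF that] that by (simp add: interval_lebesgue_integral_def zero_ereal_def)
  have "M 0 = Mbar" using M[of 0] rho[of 0] by (auto simp: Mbar rhobar_eq)
  then show ?thesis using psi entropy_solution_cdf[OF _ A' rho M] by blast
qed

end
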